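(* Let $k$ be a field, $n\ge2$, and let $q\in k^\times$ be a primitive $r$-th root of unity with $q^2\ne1$. Then the coordinate ring of quantum Euclidean $2n$-space satisfies $$\operatorname{PIdeg}\mathcal O_q(\mathfrak ok^{2n})=\begin{cases}r^{n-1},&r\text{ odd},\\ r^{n-1}/2^{\lfloor\frac{n-1}2\rfloor},&r\text{ even},\ r\notin4\mathbb Z,\\ r^{n-1}/2^{n-2},&r\in4\mathbb Z.\end{cases}$$
   Context: $k$ has arbitrary characteristic. $\mathcal O_q(\mathfrak ok^{2n})$ is the $k$-algebra $K_{n,\Gamma}^{P,Q}(k)$ with $q_i=1$ and $p_i=q^{-2}$ for all $i$, and $\gamma_{ij}=q^{-1}$ for $i<j$, $\gamma_{ii}=1$, $\gamma_{ij}=q$ for $i>j$. Here, for $P=(p_1,\dots,p_n)$, $Q=(q_1,\dots,q_n)\in(k^\times)^n$ with $p_i\ne q_i$ and $\Gamma=(\gamma_{ij})\in M_n(k^\times)$ with $\gamma_{ii}=1$, $\gamma_{ji}=\gamma_{ij}^{-1}$, $K_{n,\Gamma}^{P,Q}(k)$ has generators $x_i,y_i$ ($1\le i\le n$) and relations $y_iy_j=\gamma_{ij}y_jy_i$ (all $i,j$); $x_ix_j=q_ip_j^{-1}\gamma_{ij}x_jx_i$ ($i<j$); $x_iy_j=p_j\gamma_{ji}y_jx_i$ ($i<j$); $x_iy_j=q_j\gamma_{ji}y_jx_i$ ($i>j$); $x_iy_i=q_iy_ix_i+\sum_{\ell<i}(q_\ell-p_\ell)y_\ell x_\ell$ (all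 $i$). $\operatorname{PIdeg}$ is the PI degree of a prime PI ring. *)

theory Defs
  imports
    "HOL-Algebra.Embedded_Algebras"
    "HOL-Algebra.QuotRing"
    "HOL-Library.Poly_Mapping"
begin

section \<open>Free associative algebras\<close>

text \<open>The free monoid on \<open>'a\<close> is written additively since convolution of finitely supported
  functions is available over additive monoids of keys. Thus \<open>'a fmon \<Rightarrow>\<^sub>0 'k\<close> is the free
  associative unital \<open>'k\<close>-algebra on \<open>'a\<close>.\<close>

datatype 'a fmon = Word (letters: "'a list")

instantiation fmon :: (type) monoid_add
begin

definition zero_fmon :: "'a fmon" where
  "0 = Word []"

definition plus_fmon :: "'a fmon \<Rightarrow> 'a fmon \<Rightarrow> 'a fmon" where
  "u + v = Word (letters u @ letters v)"

instance
  by standard (simp_all add: zero_fmon_def plus_fmon_def)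

end

definition free_algebra :: "'a set \<Rightarrow> ('a fmon \<Rightarrow>\<^sub>0 'k::ring_1) ring" where
  "free_algebra G =
    \<lparr>carrier = {f. \<forall>w \<in> Poly_Mapping.keys f. set (letters w) \<subseteq> G},
     mult = (*), one = 1, zero = 0, add = (+)\<rparr>"

definition var :: "'a \<Rightarrow> ('a fmon \<Rightarrow>\<^sub>0 'k::ring_1)" where
  "var a = Poly_Mapping.single (Word [a]) 1"

definition scalar :: "'k \<Rightarrow> ('a fmon \<Rightarrow>\<^sub>0 'k::ring_1)" where
  "scalar c = Poly_Mapping.single 0 c"

section \<open>The algebras \<open>K\<close> and the coordinate ring of quantum Euclidean space\<close>

datatype gen = X nat | Y nat

definition K_gens :: "nat \<Rightarrow> gen set" where
  "K_gens n = X ` {1..n} \<union> Y ` {1..n}"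

definition K_relations ::
  "nat \<Rightarrow> (nat \<Rightarrow> 'k::field) \<Rightarrow> (nat \<Rightarrow> 'k) \<Rightarrow> (nat \<Rightarrow> nat \<Rightarrow> 'k) \<Rightarrow> (gen fmon \<Rightarrow>\<^sub>0 'k) set" where
  "K_relations n p q \<gamma> = (let x = (\<lambda>i. var (X i)); y = (\<lambda>i. var (Y i)) in
      {y i * y j - scalar (\<gamma> i j) * (y j * y i) | i j. i \<in> {1..n} \<and> j \<in> {1..n}}
    \<union> {x i * x j - scalar (q i * inverse (p j) * \<gamma> i j) * (x j * x i) | i j.
         i \<in> {1..n} \<and> j \<in> {1..n} \<and> i < j}
    \<union> {x i * y j - scalar (p j * \<gamma> j i) * (y j * x i) | i j.
         i \<in> {1..n} \<and> j \<in> {1..n} \<and> i < j}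
    \<union> {x i * y j - scalar (q j * \<gamma> j i) * (y j * x i) | i j.
         i \<in> {1..n} \<and> j \<in> {1..n} \<and> i > j}
    \<union> {x i * y i - (scalar (q i) * (y i * x i)
           + (\<Sum>l = 1..<i. scalar (q l - p l) * (y l * x l))) | i. i \<in> {1..n}})"

definition K_algebra ::
  "nat \<Rightarrow> (nat \<Rightarrow> 'k::field) \<Rightarrow> (nat \<Rightarrow> 'k) \<Rightarrow> (nat \<Rightarrow> nat \<Rightarrow> 'k) \<Rightarrow> (gen fmon \<Rightarrow>\<^sub>0 'k) set ring" where
  "K_algebra n p q \<gamma> =
    free_algebra (K_gens n) Quot
      (Idl\<^bsub>(free_algebra (K_gens n) :: (gen fmon \<Rightarrow>\<^sub>0 'k) ring)\<^esub> (K_relations n p q \<gamma>))"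

definition quantum_euclidean :: "nat \<Rightarrow> 'k::field \<Rightarrow> (gen fmon \<Rightarrow>\<^sub>0 'k) set ring" where
  "quantum_euclidean n q =
    K_algebra n (\<lambda>i. inverse (q ^ 2)) (\<lambda>i. 1)
      (\<lambda>i j. if i < j then inverse q else if i = j then 1 else q)"

section \<open>Prime PI rings and the PI degree\<close>

definition prime_ring :: "('a, 'b) ring_scheme \<Rightarrow> bool" where
  "prime_ring R \<longleftrightarrow> ring R \<and> carrier R \<noteq> {\<zero>\<^bsub>R\<^esub>} \<and>
    (\<forall>a \<in> carrier R. \<forall>b \<in> carrier R.
       (\<forall>x \<in> carrier R. a \<otimes>\<^bsub>R\<^esub> x \<otimes>\<^bsub>R\<^esub> b = \<zero>\<^bsub>R\<^esub>) \<longrightarrow> a = \<zero>\<^bsub>R\<^esub> \<or> b = \<zero>\<^bsub>R\<^esub>)"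

definition eval_word :: "('a, 'b) ring_scheme \<Rightarrow> (nat \<Rightarrow> 'a) \<Rightarrow> nat fmon \<Rightarrow> 'a" where
  "eval_word R \<rho> w = foldr (\<lambda>i a. \<rho> i \<otimes>\<^bsub>R\<^esub> a) (letters w) \<one>\<^bsub>R\<^esub>"

definition eval_poly :: "('a, 'b) ring_scheme \<Rightarrow> (nat \<Rightarrow> 'a) \<Rightarrow> (nat fmon \<Rightarrow>\<^sub>0 int) \<Rightarrow> 'a" where
  "eval_poly R \<rho> f =
    (\<Oplus>\<^bsub>R\<^esub>w \<in> Poly_Mapping.keys f. [Poly_Mapping.lookup f w] \<cdot>\<^bsub>R\<^esub> eval_word R \<rho> w)"

text \<open>A noncommutative polynomial is monic if some monomial of highest degree has coefficient 1.\<close>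

definition monic_ncpoly :: "(nat fmon \<Rightarrow>\<^sub>0 int) \<Rightarrow> bool" where
  "monic_ncpoly f \<longleftrightarrow> (\<exists>w. Poly_Mapping.lookup f w = 1 \<and>
     (\<forall>v \<in> Poly_Mapping.keys f. length (letters v) \<le> length (letters w)))"

definition PI_ring :: "('a, 'b) ring_scheme \<Rightarrow> bool" where
  "PI_ring R \<longleftrightarrow> ring R \<and>
     (\<exists>f. monic_ncpoly f \<and> (\<forall>\<rho>. range \<rho> \<subseteq> carrier R \<longrightarrow> eval_poly R \<rho> f = \<zero>\<^bsub>R\<^esub>))"

definition ring_center :: "('a, 'b) ring_scheme \<Rightarrow> 'a set" where
  "ring_center R = {z \<in> carrier R. \<forall>x \<in> carrier R. z \<otimes>\<^bsub>R\<^esub> x = x \<otimes>\<^bsub>R\<^esub> z}"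

text \<open>The ring of central quotients of \<open>R\<close>, i.e. the localization at the nonzero central elements.
  The equality of fractions needs no extra multiplier because the nonzero central elements of a
  prime ring are regular; the construction is only meaningful for prime rings.\<close>

definition denoms :: "('a, 'b) ring_scheme \<Rightarrow> 'a set" where
  "denoms R = ring_center R - {\<zero>\<^bsub>R\<^esub>}"

definition frac_rel :: "('a, 'b) ring_scheme \<Rightarrow> (('a \<times> 'a) \<times> ('a \<times> 'a)) set" where
  "frac_rel R = {((a, s), (b, t)). a \<in> carrier R \<and> s \<in> denoms R \<and> b \<in> carrier R \<and> t \<in> denoms R
     \<and> a \<otimes>\<^bsub>R\<^esub> t = b \<otimes>\<^bsub>R\<^esub> s}"

definition central_frac :: "('a, 'b) ring_scheme \<Rightarrow> 'a \<Rightarrow> 'a \<Rightarrow> ('a \<times> 'a) set" where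
  "central_frac R a s = frac_rel R `` {(a, s)}"

definition central_quotients :: "('a, 'b) ring_scheme \<Rightarrow> ('a \<times> 'a) set ring" where
  "central_quotients R =
    \<lparr>carrier = (carrier R \<times> denoms R) // frac_rel R,
     mult = (\<lambda>A B. \<Union>(a, s) \<in> A. \<Union>(b, t) \<in> B. central_frac R (a \<otimes>\<^bsub>R\<^esub> b) (s \<otimes>\<^bsub>R\<^esub> t)),
     one = central_frac R \<one>\<^bsub>R\<^esub> \<one>\<^bsub>R\<^esub>,
     zero = central_frac R \<zero>\<^bsub>R\<^esub> \<one>\<^bsub>R\<^esub>,
     add = (\<lambda>A B. \<Union>(a, s) \<in> A. \<Union>(b, t) \<in> B.
              central_frac R (a \<otimes>\<^bsub>R\<^esub> t \<oplus>\<^bsub>R\<^esub> b \<otimes>\<^bsub>R\<^esub> s) (s \<otimes>\<^bsub>R\<^esub> t))\<rparr>"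

definition center_fractions :: "('a, 'b) ring_scheme \<Rightarrow> ('a \<times> 'a) set set" where
  "center_fractions R = {central_frac R z s | z s. z \<in> ring_center R \<and> s \<in> denoms R}"

text \<open>By Posner's theorem the ring of central quotients of a prime PI ring is a central simple
  algebra, of finite dimension \<open>d\<^sup>2\<close> over the field of fractions of the center; \<open>d\<close> is the PI degree.\<close>

definition PIdeg :: "('a, 'b) ring_scheme \<Rightarrow> nat" where
  "PIdeg R = (THE d. ring.dimension (central_quotients R) (d ^ 2) (center_fractions R)
                       (carrier (central_quotients R)))"

definition primitive_root_of_unity :: "nat \<Rightarrow> 'k::field \<Rightarrow> bool" where
  "primitive_root_of_unity r q \<longleftrightarrow> r > 0 \<and> q ^ r = 1 \<and> (\<forall>m. 0 < m \<and> m < r \<longrightarrow> q ^ m \<noteq> 1)"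

end

theory Submission
  imports Defs "HOL-Combinatorics.Permutations" Complex_Main
begin

text \<open>The elements \<open>\<Omega>\<^sub>i = (1 - q\<^sup>-\<^sup>2) (y\<^sub>1 x\<^sub>1 + \<dots> + y\<^sub>i x\<^sub>i)\<close> commute up to powers of \<open>q\<close> with all
  generators, and \<open>x\<^sub>i\<close> is a multiple of \<open>y\<^sub>i\<^sup>-\<^sup>1 (\<Omega>\<^sub>i - \<Omega>\<^sub>i\<^sub>-\<^sub>1)\<close>. This gives a homomorphism from the algebra to the
  quantum torus in \<open>y\<^sub>1, \<dots>, y\<^sub>n, \<Omega>\<^sub>1, \<dots>, \<Omega>\<^sub>n\<close>. It is injective because the ordered words \<open>y\<^sub>1\<^sup>a \<dots> x\<^sub>n\<^sup>b\<close> span the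
  algebra and have images with distinct lowest terms; in particular the algebra is a domain.

  Since \<open>q\<^sup>r = 1\<close>, the center consists of the elements supported on the radical of the commutation form
  modulo \<open>r\<close>, and up to central denominators every element is a combination over the center of monomials
  representing the classes modulo this radical. So the square of the PI degree is the index of the radical,
  and with one variable more than classes the standard polynomial vanishes. The index follows from
  a decomposition of the form into hyperbolic planes with values 1, 2 and 4.\<close>

text \<open>The torus contains inverses that the algebra lacks. Two observations bridge this gap:
  the \<open>y_i\<close> and the Omega_i lie in the algebra, so commuting with them alone already
  forces the support of a central element into the radical; and division by a monomial can be
  replaced by multiplication with a central monomial whose exponents are large multiples of
  \<open>r\<close>. The exponent \<open>r^(n-1)\<close> comes from the rank 2n-2 of the commutation
  form over the integers. Its integral radical is spanned by the exponents of Omega_n (the central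
  quadratic form) and of Omega_1 y_1^(-2), which up to a scalar is x_1 y_1^(-1). The other n-1
  planes arise as follows: y_1 and y_2 give one of value 1 up to sign, and n-2 pairs remain in which
  Omega_(i+1) Omega_i^(-1) is dual to y_(i+1) with value 2, because Omega_i and y_j commute up to
  q^(-2). These pairs are not orthogonal to each other; two of them together split into planes of
  values 1 and 4, and a last single one is a plane of value 2. The powers of 2 in the result are
  what gcd(2,r) and gcd(4,r) take away.\<close>

section \<open>Central quotients of prime rings\<close>

locale prime_localization = ring R for R (structure) +
  assumes prime: "prime_ring R"
begin

lemma centerD:
  "z \<in> ring_center R \<Longrightarrow> z \<in> carrier R"
  "z \<in> ring_center R \<Longrightarrow> x \<in> carrier R \<Longrightarrow> z \<otimes> x = x \<otimes> z"
  by (auto simp: ring_center_def)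

lemma denomsD:
  assumes "s \<in> denoms R"
  shows "s \<in> carrier R" "s \<noteq> \<zero>" "s \<in> ring_center R" "x \<in> carrier R \<Longrightarrow> s \<otimes> x = x \<otimes> s"
  using assms by (auto simp: denoms_def ring_center_def)

lemma center_closed:
  assumes "a \<in> ring_center R" "b \<in> ring_center R"
  shows "a \<otimes> b \<in> ring_center R" "a \<oplus> b \<in> ring_center R" "\<ominus> a \<in> ring_center R"
proof -
  note C = centerD(1)[OF assms(1)] centerD(1)[OF assms(2)]
  have "(a \<otimes> b) \<otimes> x = x \<otimes> (a \<otimes> b)" if x: "x \<in> carrier R" for x
  proof -
    have "(a \<otimes> b) \<otimes> x = a \<otimes> (x \<otimes> b)"
      using C x centerD(2)[OF assms(2) x] by (simp add: m_assoc)
    also have "\<dots> = (x \<otimes> a) \<otimes> b"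
      using C x centerD(2)[OF assms(1) x] by (simp add: m_assoc[symmetric])
    finally show ?thesis using C x by (simp add: m_assoc)
  qed
  then show "a \<otimes> b \<in> ring_center R" using C by (simp add: ring_center_def)
  show "a \<oplus> b \<in> ring_center R"
    using assms C by (simp add: ring_center_def l_distr r_distr)
  show "\<ominus> a \<in> ring_center R"
    using assms(1) C by (simp add: ring_center_def l_minus r_minus)
qed

lemma one_center: "\<one> \<in> ring_center R"
  by (simp add: ring_center_def)

lemma zero_center: "\<zero> \<in> ring_center R"
  by (simp add: ring_center_def)

text \<open>A central \<open>s\<close> can be moved past any \<open>x\<close>, so
  \<open>s a = 0\<close> gives \<open>s x a = 0\<close> for all \<open>x\<close>, and primeness
  applies.\<close>

lemma denoms_regular:
  assumes "s \<in> denoms R" "a \<in> carrier R" "s \<otimes> a = \<zero>"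
  shows "a = \<zero>"
proof -
  have "s \<otimes> x \<otimes> a = \<zero>" if x: "x \<in> carrier R" for x
  proof -
    have "s \<otimes> x \<otimes> a = x \<otimes> (s \<otimes> a)"
      using denomsD(1,4)[OF assms(1)] x assms(2) by (simp add: m_assoc)
    then show ?thesis using assms(3) x by simp
  qed
  then show ?thesis
    using prime assms(2) denomsD(1,2)[OF assms(1)] unfolding prime_ring_def by blast
qed

lemma denoms_cancel:
  assumes "s \<in> denoms R" "a \<in> carrier R" "b \<in> carrier R" "a \<otimes> s = b \<otimes> s"
  shows "a = b"
proof -
  have "s \<otimes> (a \<ominus> b) = \<zero>"
    using assms denomsD[OF assms(1)] by (simp add: minus_eq r_distr r_minus r_neg)
  then have "a \<ominus> b = \<zero>"
    using denoms_regular assms by (meson minus_closed)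
  then show ?thesis
    using assms by (metis r_right_minus_eq)
qed

lemma denoms_lcomm:
  assumes "s \<in> denoms R" "x \<in> carrier R" "y \<in> carrier R"
  shows "x \<otimes> (s \<otimes> y) = s \<otimes> (x \<otimes> y)"
  using assms denomsD(1)[OF assms(1)] denomsD(4)[OF assms(1,2)] by (simp add: m_assoc[symmetric])

lemma denoms_mult:
  assumes "s \<in> denoms R" "t \<in> denoms R"
  shows "s \<otimes> t \<in> denoms R"
  using assms denoms_regular[OF assms(1)] denomsD[OF assms(1)] denomsD[OF assms(2)] center_closed(1)
  unfolding denoms_def by blast

lemma one_denoms: "\<one> \<in> denoms R"
proof -
  have "\<one> \<noteq> \<zero>"
    using prime unfolding prime_ring_def using carrier_one_zero by blast
  then show ?thesis by (simp add: denoms_def one_center)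
qed

text \<open>Only transitivity needs work: the required equation is first obtained multiplied by the
  middle denominator \<open>t\<close>, which is then cancelled. This is where primeness
  enters.\<close>

lemma frac_rel_equiv: "equiv (carrier R \<times> denoms R) (frac_rel R)"
proof (rule equivI)
  show "frac_rel R \<subseteq> (carrier R \<times> denoms R) \<times> (carrier R \<times> denoms R)"
    by (auto simp: frac_rel_def)
  show "refl_on (carrier R \<times> denoms R) (frac_rel R)"
    by (auto simp: refl_on_def frac_rel_def)
  show "sym (frac_rel R)"
    by (auto simp: sym_def frac_rel_def)
  show "trans (frac_rel R)"
  proof (rule transI)
    fix p1 p2 p3
    assume "(p1, p2) \<in> frac_rel R" "(p2, p3) \<in> frac_rel R"
    then obtain a s b t c u where p: "p1 = (a, s)" "p2 = (b, t)" "p3 = (c, u)"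
      and C: "a \<in> carrier R" "b \<in> carrier R" "c \<in> carrier R"
      and D: "s \<in> denoms R" "t \<in> denoms R" "u \<in> denoms R"
      and e: "a \<otimes> t = b \<otimes> s" "b \<otimes> u = c \<otimes> t"
      unfolding frac_rel_def by auto
    note DC = denomsD(1)[OF D(1)] denomsD(1)[OF D(2)] denomsD(1)[OF D(3)]
    have "(a \<otimes> u) \<otimes> t = (a \<otimes> t) \<otimes> u"
      using C DC denomsD(4)[OF D(2), of u] by (simp add: m_assoc)
    also have "\<dots> = (b \<otimes> u) \<otimes> s"
      using C DC e(1) denomsD(4)[OF D(1), of u] by (simp add: m_assoc)
    also have "\<dots> = (c \<otimes> s) \<otimes> t"
      using C DC e(2) denomsD(4)[OF D(1), of t] by (simp add: m_assoc)
    finally have "a \<otimes> u = c \<otimes> s"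
      using denoms_cancel[OF D(2)] C DC by simp
    then show "(p1, p3) \<in> frac_rel R"
      unfolding p frac_rel_def using C D by auto
  qed
qed

abbreviation frac where "frac \<equiv> central_frac R"
abbreviation Q where "Q \<equiv> central_quotients R"

lemma frac_eq_iff:
  assumes "a \<in> carrier R" "s \<in> denoms R" "b \<in> carrier R" "t \<in> denoms R"
  shows "frac a s = frac b t \<longleftrightarrow> a \<otimes> t = b \<otimes> s"
proof -
  have "frac a s = frac b t \<longleftrightarrow> ((a, s), (b, t)) \<in> frac_rel R"
    unfolding central_frac_def
    by (rule eq_equiv_class_iff[OF frac_rel_equiv]) (use assms in auto)
  then show ?thesis using assms by (simp add: frac_rel_def)
qed

lemma mem_fracD:
  assumes "(b, t) \<in> frac a s"
  shows "a \<in> carrier R" "s \<in> denoms R" "b \<in> carrier R" "t \<in> denoms R" "frac b t = frac a s"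
proof -
  show *: "a \<in> carrier R" "s \<in> denoms R" "b \<in> carrier R" "t \<in> denoms R"
    using assms unfolding central_frac_def frac_rel_def by auto
  show "frac b t = frac a s"
    using assms * unfolding frac_eq_iff[OF *(3,4,1,2)] unfolding central_frac_def frac_rel_def by auto
qed

lemma frac_refl: "a \<in> carrier R \<Longrightarrow> s \<in> denoms R \<Longrightarrow> (a, s) \<in> frac a s"
  unfolding central_frac_def frac_rel_def by auto

lemma frac_expand:
  assumes "a \<in> carrier R" "s \<in> denoms R" "t \<in> denoms R"
  shows "frac a s = frac (a \<otimes> t) (s \<otimes> t)"
  using assms denomsD(1)[OF assms(2)] denomsD(1)[OF assms(3)] denomsD(4)[OF assms(2)] denoms_mult[OF assms(2,3)]
  by (subst frac_eq_iff) (auto simp: m_assoc)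

lemma frac_in_Q: "a \<in> carrier R \<Longrightarrow> s \<in> denoms R \<Longrightarrow> frac a s \<in> carrier Q"
  unfolding central_quotients_def central_frac_def by (auto intro: quotientI)

lemma Q_cases:
  assumes "A \<in> carrier Q"
  obtains a s where "A = frac a s" "a \<in> carrier R" "s \<in> denoms R"
  using assms unfolding central_quotients_def central_frac_def by (auto elim!: quotientE)

lemma UN_const:
  assumes "x \<in> A" "\<And>y. y \<in> A \<Longrightarrow> f y = c"
  shows "(\<Union>y\<in>A. f y) = c"
  using assms by blast

text \<open>The product of classes is a union over all representatives. By \<open>key\<close> every
  pair of representatives contributes the same class, so the union collapses by
  \<open>UN_const\<close>; the sum is treated in the same way.\<close>

lemma Q_mult:
  assumes "a \<in> carrier R" "s \<in> denoms R" "b \<in> carrier R" "t \<in> denoms R"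
  shows "frac a s \<otimes>\<^bsub>Q\<^esub> frac b t = frac (a \<otimes> b) (s \<otimes> t)"
proof -
  have key: "frac (a' \<otimes> b') (s' \<otimes> t') = frac (a \<otimes> b) (s \<otimes> t)"
    if 1: "(a', s') \<in> frac a s" and 2: "(b', t') \<in> frac b t" for a' s' b' t'
  proof -
    note m1 = mem_fracD[OF 1] and m2 = mem_fracD[OF 2]
    have e1: "a' \<otimes> s = a \<otimes> s'" using m1 frac_eq_iff by blast
    have e2: "b' \<otimes> t = b \<otimes> t'" using m2 frac_eq_iff by blast
    note C = m1(1,3) m2(1,3) denomsD(1)[OF m1(2)] denomsD(1)[OF m1(4)] denomsD(1)[OF m2(2)] denomsD(1)[OF m2(4)]
    have "(a' \<otimes> b') \<otimes> (s \<otimes> t) = a' \<otimes> (b' \<otimes> s) \<otimes> t" using C by (simp add: m_assoc)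
    also have "\<dots> = (a' \<otimes> s) \<otimes> (b' \<otimes> t)"
      using C denoms_lcomm[OF m1(2) m2(3)] by (simp add: m_assoc)
    also have "\<dots> = a \<otimes> (s' \<otimes> b) \<otimes> t'" using C unfolding e1 e2 by (simp add: m_assoc)
    also have "\<dots> = (a \<otimes> b) \<otimes> (s' \<otimes> t')"
      using C denoms_lcomm[OF m1(4) m2(1)] by (simp add: m_assoc)
    finally show ?thesis
      using C m1 m2 denoms_mult by (subst frac_eq_iff) auto
  qed
  have "(\<Union>(b', t')\<in>frac b t. frac (a' \<otimes> b') (s' \<otimes> t')) = frac (a \<otimes> b) (s \<otimes> t)"
    if 1: "(a', s') \<in> frac a s" for a' s'
    by (rule UN_const[OF frac_refl]) (use assms key[OF 1] in auto)
  then have "(\<Union>(a', s')\<in>frac a s. \<Union>(b', t')\<in>frac b t. frac (a' \<otimes> b') (s' \<otimes> t')) = frac (a \<otimes> b) (s \<otimes> t)"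
    by (intro UN_const[OF frac_refl]) (use assms in auto)
  then show ?thesis by (simp add: central_quotients_def)
qed

lemma Q_add_general:
  assumes "a \<in> carrier R" "s \<in> denoms R" "b \<in> carrier R" "t \<in> denoms R"
  shows "frac a s \<oplus>\<^bsub>Q\<^esub> frac b t = frac (a \<otimes> t \<oplus> b \<otimes> s) (s \<otimes> t)"
proof -
  have key: "frac (a' \<otimes> t' \<oplus> b' \<otimes> s') (s' \<otimes> t') = frac (a \<otimes> t \<oplus> b \<otimes> s) (s \<otimes> t)"
    if 1: "(a', s') \<in> frac a s" and 2: "(b', t') \<in> frac b t" for a' s' b' t'
  proof -
    note m1 = mem_fracD[OF 1] and m2 = mem_fracD[OF 2]
    have e1: "a' \<otimes> s = a \<otimes> s'" using m1 frac_eq_iff by blast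
    have e2: "b' \<otimes> t = b \<otimes> t'" using m2 frac_eq_iff by blast
    note C = m1(1,3) m2(1,3) denomsD(1)[OF m1(2)] denomsD(1)[OF m1(4)] denomsD(1)[OF m2(2)] denomsD(1)[OF m2(4)]
    have "(a' \<otimes> t') \<otimes> (s \<otimes> t) = (a' \<otimes> s) \<otimes> (t \<otimes> t')"
    proof -
      have "(a' \<otimes> t') \<otimes> (s \<otimes> t) = a' \<otimes> (t' \<otimes> (s \<otimes> t))" using C by (simp add: m_assoc)
      also have "t' \<otimes> (s \<otimes> t) = (s \<otimes> t) \<otimes> t'" using C denomsD(4)[OF m2(4)] by simp
      finally show ?thesis using C by (simp add: m_assoc)
    qed
    also have "\<dots> = (a \<otimes> t) \<otimes> (s' \<otimes> t')"
    proof -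
      have "s' \<otimes> (t \<otimes> t') = t \<otimes> (s' \<otimes> t')"
        using C denomsD(4)[OF m1(4) C(7)] by (simp add: m_assoc[symmetric])
      then show ?thesis using C unfolding e1 by (simp add: m_assoc)
    qed
    finally have f1: "(a' \<otimes> t') \<otimes> (s \<otimes> t) = (a \<otimes> t) \<otimes> (s' \<otimes> t')" .
    have "(b' \<otimes> s') \<otimes> (s \<otimes> t) = (b' \<otimes> t) \<otimes> (s \<otimes> s')"
    proof -
      have "s' \<otimes> (s \<otimes> t) = (s \<otimes> t) \<otimes> s'" using C denomsD(4)[OF m1(4)] by simp
      also have "\<dots> = t \<otimes> (s \<otimes> s')" using C denomsD(4)[OF m1(2) C(7)] by (simp add: m_assoc)
      finally show ?thesis using C by (simp add: m_assoc)
    qed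
    also have "\<dots> = (b \<otimes> s) \<otimes> (s' \<otimes> t')"
    proof -
      have "t' \<otimes> (s \<otimes> s') = (s \<otimes> s') \<otimes> t'" using C denomsD(4)[OF m2(4)] by simp
      then show ?thesis using C unfolding e2 by (simp add: m_assoc)
    qed
    finally have f2: "(b' \<otimes> s') \<otimes> (s \<otimes> t) = (b \<otimes> s) \<otimes> (s' \<otimes> t')" .
    have "(a' \<otimes> t' \<oplus> b' \<otimes> s') \<otimes> (s \<otimes> t) = (a \<otimes> t \<oplus> b \<otimes> s) \<otimes> (s' \<otimes> t')"
      using C f1 f2 by (simp add: l_distr)
    then show ?thesis
      using C m1 m2 denoms_mult by (subst frac_eq_iff) auto
  qed
  have "(\<Union>(b', t')\<in>frac b t. frac (a' \<otimes> t' \<oplus> b' \<otimes> s') (s' \<otimes> t')) = frac (a \<otimes> t \<oplus> b \<otimes> s) (s \<otimes> t)"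
    if 1: "(a', s') \<in> frac a s" for a' s'
    by (rule UN_const[OF frac_refl]) (use assms key[OF 1] in auto)
  then have "(\<Union>(a', s')\<in>frac a s. \<Union>(b', t')\<in>frac b t. frac (a' \<otimes> t' \<oplus> b' \<otimes> s') (s' \<otimes> t'))
      = frac (a \<otimes> t \<oplus> b \<otimes> s) (s \<otimes> t)"
    by (intro UN_const[OF frac_refl]) (use assms in auto)
  then show ?thesis by (simp add: central_quotients_def)
qed

lemma Q_add:
  assumes "a \<in> carrier R" "b \<in> carrier R" "s \<in> denoms R"
  shows "frac a s \<oplus>\<^bsub>Q\<^esub> frac b s = frac (a \<oplus> b) s"
  unfolding Q_add_general[OF assms(1,3,2,3)]
  using assms denomsD(1)[OF assms(3)] denoms_mult[OF assms(3,3)]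
  by (subst frac_expand[of "a \<oplus> b" s s]) (auto simp: l_distr)

text \<open>With equal denominators addition is addition of numerators (\<open>Q_add\<close>), so
  the laws of \<open>Q\<close> that involve sums reduce to those of \<open>R\<close>.\<close>

lemma common_denominator:
  assumes "A \<in> carrier Q" "B \<in> carrier Q"
  obtains a b s where "A = frac a s" "B = frac b s" "a \<in> carrier R" "b \<in> carrier R" "s \<in> denoms R"
proof -
  obtain a s where A: "A = frac a s" "a \<in> carrier R" "s \<in> denoms R" by (rule Q_cases[OF assms(1)])
  obtain b t where B: "B = frac b t" "b \<in> carrier R" "t \<in> denoms R" by (rule Q_cases[OF assms(2)])
  have "t \<otimes> s = s \<otimes> t" using denomsD(4)[OF B(3)] denomsD(1)[OF A(3)] by simp
  then have "B = frac (b \<otimes> s) (s \<otimes> t)" using frac_expand[OF B(2,3) A(3)] B(1) by simp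
  moreover have "A = frac (a \<otimes> t) (s \<otimes> t)" using frac_expand[OF A(2,3) B(3)] A(1) by simp
  ultimately show ?thesis
    using that A B denomsD(1)[OF A(3)] denomsD(1)[OF B(3)] denoms_mult[OF A(3) B(3)] by blast
qed

lemma common_denominator3:
  assumes "A \<in> carrier Q" "B \<in> carrier Q" "C \<in> carrier Q"
  obtains a b c s where "A = frac a s" "B = frac b s" "C = frac c s"
    "a \<in> carrier R" "b \<in> carrier R" "c \<in> carrier R" "s \<in> denoms R"
proof -
  obtain a b s where AB: "A = frac a s" "B = frac b s" "a \<in> carrier R" "b \<in> carrier R" "s \<in> denoms R"
    by (rule common_denominator[OF assms(1,2)])
  obtain c t where C: "C = frac c t" "c \<in> carrier R" "t \<in> denoms R" by (rule Q_cases[OF assms(3)])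
  have "t \<otimes> s = s \<otimes> t" using denomsD(4)[OF C(3)] denomsD(1)[OF AB(5)] by simp
  then have "C = frac (c \<otimes> s) (s \<otimes> t)" using frac_expand[OF C(2,3) AB(5)] C(1) by simp
  moreover have "A = frac (a \<otimes> t) (s \<otimes> t)" using frac_expand[OF AB(3,5) C(3)] AB(1) by simp
  moreover have "B = frac (b \<otimes> t) (s \<otimes> t)" using frac_expand[OF AB(4,5) C(3)] AB(2) by simp
  ultimately show ?thesis
    using that AB C denomsD(1)[OF AB(5)] denomsD(1)[OF C(3)] denoms_mult[OF AB(5) C(3)] by blast
qed

lemma Q_one: "\<one>\<^bsub>Q\<^esub> = frac \<one> \<one>" by (simp add: central_quotients_def)

lemma Q_zero: "s \<in> denoms R \<Longrightarrow> frac \<zero> s = \<zero>\<^bsub>Q\<^esub>"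
  using one_denoms denomsD(1)[of s] by (simp add: central_quotients_def frac_eq_iff)

lemma frac_eq_zero_iff:
  assumes "a \<in> carrier R" "s \<in> denoms R"
  shows "frac a s = \<zero>\<^bsub>Q\<^esub> \<longleftrightarrow> a = \<zero>"
  using assms denomsD(1)[OF assms(2)] denoms_cancel[OF assms(2,1), of \<zero>]
  by (subst Q_zero[OF assms(2), symmetric], subst frac_eq_iff) auto

lemma Q_ring: "ring Q"
proof (rule ringI)
  show "abelian_group Q"
  proof (rule abelian_groupI)
    fix x y assume x: "x \<in> carrier Q" and y: "y \<in> carrier Q"
    obtain a b s where *: "x = frac a s" "y = frac b s" "a \<in> carrier R" "b \<in> carrier R" "s \<in> denoms R"
      by (rule common_denominator[OF x y])
    show "x \<oplus>\<^bsub>Q\<^esub> y \<in> carrier Q" using * by (simp add: Q_add frac_in_Q)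
    show "x \<oplus>\<^bsub>Q\<^esub> y = y \<oplus>\<^bsub>Q\<^esub> x" using * by (simp add: Q_add a_comm)
  next
    show "\<zero>\<^bsub>Q\<^esub> \<in> carrier Q"
      using frac_in_Q[OF zero_closed one_denoms] Q_zero[OF one_denoms] by simp
  next
    fix x y z assume xyz: "x \<in> carrier Q" "y \<in> carrier Q" "z \<in> carrier Q"
    obtain a b c s where *: "x = frac a s" "y = frac b s" "z = frac c s"
      "a \<in> carrier R" "b \<in> carrier R" "c \<in> carrier R" "s \<in> denoms R"
      by (rule common_denominator3[OF xyz])
    show "x \<oplus>\<^bsub>Q\<^esub> y \<oplus>\<^bsub>Q\<^esub> z = x \<oplus>\<^bsub>Q\<^esub> (y \<oplus>\<^bsub>Q\<^esub> z)" using * by (simp add: Q_add a_assoc)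
  next
    fix x assume "x \<in> carrier Q"
    then obtain a s where *: "x = frac a s" "a \<in> carrier R" "s \<in> denoms R" by (rule Q_cases)
    have "\<zero>\<^bsub>Q\<^esub> = frac \<zero> s" using Q_zero *(3) by simp
    then show "\<zero>\<^bsub>Q\<^esub> \<oplus>\<^bsub>Q\<^esub> x = x" using * by (simp add: Q_add)
    have "frac (\<ominus> a) s \<oplus>\<^bsub>Q\<^esub> x = \<zero>\<^bsub>Q\<^esub>" using * by (simp add: Q_add Q_zero l_neg)
    then show "\<exists>y\<in>carrier Q. y \<oplus>\<^bsub>Q\<^esub> x = \<zero>\<^bsub>Q\<^esub>" using * frac_in_Q by blast
  qed
  show "Group.monoid Q"
  proof (rule Group.monoidI)
    fix x y assume x: "x \<in> carrier Q" and y: "y \<in> carrier Q"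
    obtain a s where A: "x = frac a s" "a \<in> carrier R" "s \<in> denoms R" by (rule Q_cases[OF x])
    obtain b t where B: "y = frac b t" "b \<in> carrier R" "t \<in> denoms R" by (rule Q_cases[OF y])
    show "x \<otimes>\<^bsub>Q\<^esub> y \<in> carrier Q" using A B by (simp add: Q_mult frac_in_Q denoms_mult)
    fix z assume z: "z \<in> carrier Q"
    obtain c u where C: "z = frac c u" "c \<in> carrier R" "u \<in> denoms R" by (rule Q_cases[OF z])
    show "x \<otimes>\<^bsub>Q\<^esub> y \<otimes>\<^bsub>Q\<^esub> z = x \<otimes>\<^bsub>Q\<^esub> (y \<otimes>\<^bsub>Q\<^esub> z)"
      using A B C denomsD(1)[OF A(3)] denomsD(1)[OF B(3)] denomsD(1)[OF C(3)]
      by (simp add: Q_mult denoms_mult m_assoc)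
  next
    show "\<one>\<^bsub>Q\<^esub> \<in> carrier Q" by (simp add: Q_one frac_in_Q one_denoms)
  next
    fix x assume x: "x \<in> carrier Q"
    obtain a s where A: "x = frac a s" "a \<in> carrier R" "s \<in> denoms R" by (rule Q_cases[OF x])
    show "\<one>\<^bsub>Q\<^esub> \<otimes>\<^bsub>Q\<^esub> x = x" using A one_denoms denomsD(1)[OF A(3)] by (simp add: Q_one Q_mult)
    show "x \<otimes>\<^bsub>Q\<^esub> \<one>\<^bsub>Q\<^esub> = x" using A one_denoms denomsD(1)[OF A(3)] by (simp add: Q_one Q_mult)
  qed
next
  fix x y z assume xyz: "x \<in> carrier Q" "y \<in> carrier Q" "z \<in> carrier Q"
  obtain a b s where *: "x = frac a s" "y = frac b s" "a \<in> carrier R" "b \<in> carrier R" "s \<in> denoms R"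
    by (rule common_denominator[OF xyz(1,2)])
  obtain c u where C: "z = frac c u" "c \<in> carrier R" "u \<in> denoms R" by (rule Q_cases[OF xyz(3)])
  show "(x \<oplus>\<^bsub>Q\<^esub> y) \<otimes>\<^bsub>Q\<^esub> z = x \<otimes>\<^bsub>Q\<^esub> z \<oplus>\<^bsub>Q\<^esub> y \<otimes>\<^bsub>Q\<^esub> z"
    using * C by (simp add: Q_add Q_mult denoms_mult l_distr)
  show "z \<otimes>\<^bsub>Q\<^esub> (x \<oplus>\<^bsub>Q\<^esub> y) = z \<otimes>\<^bsub>Q\<^esub> x \<oplus>\<^bsub>Q\<^esub> z \<otimes>\<^bsub>Q\<^esub> y"
    using * C by (simp add: Q_add Q_mult denoms_mult r_distr)
qed

section \<open>The field of fractions of the center and dimension over it\<close>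

abbreviation F where "F \<equiv> center_fractions R"

lemma F_I: "z \<in> ring_center R \<Longrightarrow> s \<in> denoms R \<Longrightarrow> frac z s \<in> F"
  unfolding center_fractions_def by blast

lemma F_cases:
  assumes "A \<in> F"
  obtains z s where "A = frac z s" "z \<in> ring_center R" "s \<in> denoms R"
  using assms unfolding center_fractions_def by blast

lemma F_subfield: "subfield F Q"
proof -
  interpret Q: ring Q by (rule Q_ring)
  have cr: "subcring F Q"
  proof (rule Q.subcringI)
    show "subring F Q"
    proof (rule Q.subringI)
      show "F \<subseteq> carrier Q" using frac_in_Q centerD(1) by (auto elim!: F_cases)
      show "\<one>\<^bsub>Q\<^esub> \<in> F" by (simp add: Q_one F_I one_center one_denoms)
      fix h1 h2 assume "h1 \<in> F" "h2 \<in> F"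
      then obtain z s w t where *: "h1 = frac z s" "z \<in> ring_center R" "s \<in> denoms R"
        "h2 = frac w t" "w \<in> ring_center R" "t \<in> denoms R" by (auto elim!: F_cases)
      note C = centerD(1)[OF *(2)] centerD(1)[OF *(5)]
      show "h1 \<otimes>\<^bsub>Q\<^esub> h2 \<in> F" using * C by (simp add: Q_mult F_I center_closed denoms_mult)
      show "h1 \<oplus>\<^bsub>Q\<^esub> h2 \<in> F"
        using * C by (simp add: Q_add_general F_I center_closed denoms_mult denomsD(3))
      have "frac (\<ominus> z) s \<oplus>\<^bsub>Q\<^esub> frac z s = \<zero>\<^bsub>Q\<^esub>" using * C by (simp add: Q_add Q_zero l_neg)
      then have "\<ominus>\<^bsub>Q\<^esub> h1 = frac (\<ominus> z) s"
        using * C by (metis Q.minus_equality a_inv_closed frac_in_Q)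
      then show "\<ominus>\<^bsub>Q\<^esub> h1 \<in> F" using * by (simp add: F_I center_closed)
    qed
    fix h1 h2 assume "h1 \<in> F" "h2 \<in> F"
    then obtain z s w t where *: "h1 = frac z s" "z \<in> ring_center R" "s \<in> denoms R"
      "h2 = frac w t" "w \<in> ring_center R" "t \<in> denoms R" by (auto elim!: F_cases)
    note C = centerD(1)[OF *(2)] centerD(1)[OF *(5)] denomsD(1)[OF *(3)] denomsD(1)[OF *(6)]
    show "h1 \<otimes>\<^bsub>Q\<^esub> h2 = h2 \<otimes>\<^bsub>Q\<^esub> h1"
      using * C by (simp add: Q_mult centerD(2)[OF *(2)] denomsD(4)[OF *(3)])
  qed
  show ?thesis
  proof (rule Q.subfieldI[OF cr])
    have "F - {\<zero>\<^bsub>Q\<^esub>} \<subseteq> Units (Q\<lparr>carrier := F\<rparr>)"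
    proof
      fix x assume x: "x \<in> F - {\<zero>\<^bsub>Q\<^esub>}"
      then obtain z s where *: "x = frac z s" "z \<in> ring_center R" "s \<in> denoms R"
        by (auto elim!: F_cases)
      have z: "z \<in> denoms R"
        using * x Q_zero by (auto simp: denoms_def)
      have e: "frac z s \<otimes>\<^bsub>Q\<^esub> frac s z = \<one>\<^bsub>Q\<^esub>" "frac s z \<otimes>\<^bsub>Q\<^esub> frac z s = \<one>\<^bsub>Q\<^esub>"
        using denomsD(1,4)[OF z] denomsD(1)[OF *(3)] *(3) z
        by (auto simp: Q_mult Q_one frac_eq_iff denoms_mult one_denoms)
      moreover have "frac s z \<in> F" using F_I[OF denomsD(3)[OF *(3)] z] .
      ultimately show "x \<in> Units (Q\<lparr>carrier := F\<rparr>)"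
        using * x unfolding Units_def by auto
    qed
    moreover have "\<zero>\<^bsub>Q\<^esub> \<notin> Units (Q\<lparr>carrier := F\<rparr>)"
    proof
      assume "\<zero>\<^bsub>Q\<^esub> \<in> Units (Q\<lparr>carrier := F\<rparr>)"
      then obtain y where "y \<in> F" "y \<otimes>\<^bsub>Q\<^esub> \<zero>\<^bsub>Q\<^esub> = \<one>\<^bsub>Q\<^esub>" unfolding Units_def by auto
      moreover have "F \<subseteq> carrier Q" using frac_in_Q centerD(1) by (auto elim!: F_cases)
      ultimately have "\<one>\<^bsub>Q\<^esub> = \<zero>\<^bsub>Q\<^esub>" by auto
      then show False
        using frac_eq_zero_iff[OF one_closed one_denoms] denomsD(2)[OF one_denoms] by (simp add: Q_one)
    qed
    ultimately show "Units (Q\<lparr>carrier := F\<rparr>) = F - {\<zero>\<^bsub>Q\<^esub>}"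
      unfolding Units_def by auto
  qed
qed

text \<open>Clears denominators: linear relations over \<open>F\<close> in \<open>Q\<close> become
  relations over the center in \<open>R\<close>.\<close>

lemma combine_frac:
  assumes "set zs \<subseteq> ring_center R" "set gs \<subseteq> carrier R" "s \<in> denoms R"
  shows "ring.combine Q (map (\<lambda>z. frac z s) zs) (map (\<lambda>g. frac g \<one>) gs) = frac (combine zs gs) s"
  using assms(1,2)
proof (induction zs gs rule: combine.induct)
  case (1 z zs g gs)
  have "combine zs gs \<in> carrier R" using 1 centerD(1) by (intro combine_in_carrier) auto
  then show ?case
    using 1 assms(3) one_denoms denomsD(1)[OF assms(3)] centerD(1)[of z]
    by (simp add: ring.combine.simps[OF Q_ring] Q_mult Q_add)
qed (simp_all add: ring.combine.simps[OF Q_ring] Q_zero[OF assms(3)])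

lemma F_list_common_denominator:
  assumes "set Ks \<subseteq> F"
  shows "\<exists>zs s. set zs \<subseteq> ring_center R \<and> s \<in> denoms R \<and> Ks = map (\<lambda>z. frac z s) zs"
  using assms
proof (induction Ks)
  case Nil
  then show ?case using one_denoms by (intro exI[of _ "[]"] exI[of _ \<one>]) auto
next
  case (Cons K Ks)
  then have "set Ks \<subseteq> F" by simp
  from Cons.IH[OF this]
  obtain zs s where 1: "set zs \<subseteq> ring_center R" "s \<in> denoms R" "Ks = map (\<lambda>z. frac z s) zs"
    by (elim exE conjE)
  have "K \<in> F" using Cons.prems by simp
  then obtain w t where 2: "K = frac w t" "w \<in> ring_center R" "t \<in> denoms R"
    by (rule F_cases)
  have st: "s \<otimes> t = t \<otimes> s" using denomsD(4)[OF 1(2) denomsD(1)[OF 2(3)]] .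
  have e1: "map (\<lambda>z. frac z s) zs = map (\<lambda>z. frac z (t \<otimes> s)) (map (\<lambda>z. z \<otimes> t) zs)"
    unfolding map_map
  proof (rule map_cong[OF refl])
    fix z assume "z \<in> set zs"
    then have "z \<in> carrier R" using 1 centerD(1) by blast
    from frac_expand[OF this 1(2) 2(3)]
    show "frac z s = ((\<lambda>z. frac z (t \<otimes> s)) \<circ> (\<lambda>z. z \<otimes> t)) z"
      unfolding o_def st[symmetric] .
  qed
  have e2: "K = frac (w \<otimes> s) (t \<otimes> s)" using frac_expand[OF centerD(1)[OF 2(2)] 2(3) 1(2)] unfolding 2(1) .
  have "K # Ks = map (\<lambda>z. frac z (t \<otimes> s)) ((w \<otimes> s) # map (\<lambda>z. z \<otimes> t) zs)"
    unfolding list.map(2) by (rule arg_cong2[where f = Cons, OF e2 trans[OF 1(3) e1]])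
  moreover have "set ((w \<otimes> s) # map (\<lambda>z. z \<otimes> t) zs) \<subseteq> ring_center R"
    using 1(1) center_closed(1)[OF _ denomsD(3)[OF 2(3)]] center_closed(1)[OF 2(2) denomsD(3)[OF 1(2)]] by auto
  ultimately show ?case using denoms_mult[OF 2(3) 1(2)] by (intro exI conjI)
qed

text \<open>The two conditions on \<open>gs\<close> say, after clearing denominators, that its image
  is a basis of \<open>Q\<close> over \<open>F\<close>. Dimension is unique and a natural number is
  determined by its square, so the definite description yields \<open>d\<close>.\<close>

theorem PIdeg_eqI:
  assumes gs: "set gs \<subseteq> carrier R" "length gs = d ^ 2"
    and spanning: "\<And>a. a \<in> carrier R \<Longrightarrow>
      \<exists>s zs. s \<in> denoms R \<and> set zs \<subseteq> ring_center R \<and> s \<otimes> a = combine zs gs"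
    and indep: "\<And>zs. set zs \<subseteq> ring_center R \<Longrightarrow> length zs = length gs \<Longrightarrow> combine zs gs = \<zero> \<Longrightarrow> set zs \<subseteq> {\<zero>}"
  shows "PIdeg R = d"
proof -
  interpret Q: ring Q by (rule Q_ring)
  note K = F_subfield
  let ?Us = "map (\<lambda>g. frac g \<one>) gs"
  have Us: "set ?Us \<subseteq> carrier Q" using gs(1) frac_in_Q one_denoms by auto
  have "Q.independent F ?Us"
  proof (rule Q.trivial_combine_imp_independent[OF K Us])
    fix Ks assume Ks: "set Ks \<subseteq> F" and 0: "Q.combine Ks ?Us = \<zero>\<^bsub>Q\<^esub>"
    have FQ: "F \<subseteq> carrier Q" using frac_in_Q centerD(1) by (auto elim!: F_cases)
    have F0: "\<zero>\<^bsub>Q\<^esub> \<in> F" using F_I[OF zero_center one_denoms] Q_zero[OF one_denoms] by simp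
    \<comment> \<open>\<open>combine\<close> stops at the shorter list, so a vanishing combination
      may have too many or too few coefficients. It is truncated or padded with zeros to the length
      that \<open>indep\<close> demands.\<close>
    obtain Ks' where Ks': "set (take (length ?Us) Ks) \<subseteq> set Ks'"
      "set Ks' \<subseteq> set (take (length ?Us) Ks) \<union> {\<zero>\<^bsub>Q\<^esub>}" "length Ks' = length ?Us" "Q.combine Ks' ?Us = \<zero>\<^bsub>Q\<^esub>"
      by (rule Q.combine_normalize[OF subset_trans[OF Ks FQ] Us 0])
    have "set Ks' \<subseteq> F" using Ks'(2) Ks F0 set_take_subset by fastforce
    from F_list_common_denominator[OF this]
    obtain zs s where zs: "set zs \<subseteq> ring_center R" "s \<in> denoms R" "Ks' = map (\<lambda>z. frac z s) zs"
      by (elim exE conjE)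
    have "combine zs gs \<in> carrier R" using zs gs centerD(1) by (intro combine_in_carrier) auto
    then have "combine zs gs = \<zero>"
      using Ks'(4) unfolding zs(3) combine_frac[OF zs(1) gs(1) zs(2)] by (simp add: frac_eq_zero_iff zs(2))
    moreover have "length zs = length gs" using Ks'(3) unfolding zs(3) by simp
    ultimately have "set zs \<subseteq> {\<zero>}" using indep[OF zs(1)] by simp
    then have "set Ks' \<subseteq> {\<zero>\<^bsub>Q\<^esub>}" using Q_zero[OF zs(2)] unfolding zs(3) by auto
    then show "set (take (length ?Us) Ks) \<subseteq> {\<zero>\<^bsub>Q\<^esub>}" using Ks'(1) by blast
  qed
  moreover have "Q.Span F ?Us = carrier Q"
  proof
    show "Q.Span F ?Us \<subseteq> carrier Q"
      using Q.Span_in_carrier Us subfieldE(3)[OF K] by blast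
    show "carrier Q \<subseteq> Q.Span F ?Us"
    proof
      fix A assume "A \<in> carrier Q"
      then obtain a t where A: "A = frac a t" "a \<in> carrier R" "t \<in> denoms R" by (rule Q_cases)
      obtain s zs where s: "s \<in> denoms R" "set zs \<subseteq> ring_center R" "s \<otimes> a = combine zs gs"
        using spanning[OF A(2)] by blast
      have "A = frac (a \<otimes> s) (t \<otimes> s)" using frac_expand[OF A(2,3) s(1)] unfolding A(1) .
      also have "a \<otimes> s = combine zs gs" using s(3) denomsD(4)[OF s(1) A(2)] by simp
      finally have "A = Q.combine (map (\<lambda>z. frac z (t \<otimes> s)) zs) ?Us"
        using combine_frac[OF s(2) gs(1) denoms_mult[OF A(3) s(1)]] by (simp only:)
      moreover have "set (map (\<lambda>z. frac z (t \<otimes> s)) zs) \<subseteq> F"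
        using s(2) denoms_mult[OF A(3) s(1)] F_I by auto
      ultimately show "A \<in> Q.Span F ?Us"
        unfolding Q.Span_eq_combine_set[OF K Us] by blast
    qed
  qed
  ultimately have dim: "Q.dimension (d ^ 2) F (carrier Q)"
    using Q.dimensionI[OF K] gs(2) by fastforce
  show ?thesis
    unfolding PIdeg_def
  proof (rule the_equality)
    show "Q.dimension (d ^ 2) F (carrier Q)" by (rule dim)
    fix d' assume "Q.dimension (d' ^ 2) F (carrier Q)"
    then have "d' ^ 2 = d ^ 2" using Q.dimension_is_inj[OF K _ dim] by simp
    then show "d' = d" by (metis power2_eq_iff_nonneg zero_le)
  qed
qed

end

section \<open>Alternating forms over the integers modulo r\<close>

locale alternating_form = Modules.module sc
  for sc :: "int \<Rightarrow> 'g::ab_group_add \<Rightarrow> 'g" +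
  fixes w :: "'g \<Rightarrow> 'g \<Rightarrow> int" and r :: nat
  assumes w_add: "w (x + y) z = w x z + w y z"
    and w_sc: "w (sc k x) z = k * w x z"
    and w_skew: "w x y = - w y x"
    and r_pos: "r > 0"
begin

lemma w_add_right: "w z (x + y) = w z x + w z y"
  using w_add[of x y z] w_skew[of z] by simp

lemma w_sc_right: "w z (sc k x) = k * w z x"
  using w_sc[of k x z] w_skew[of z] by simp

lemma w_zero: "w 0 z = 0" "w z 0 = 0"
  using w_add[of 0 0 z] w_add_right[of z 0 0] by simp_all

lemma w_minus: "w (- x) z = - w x z" "w z (- x) = - w z x"
  using w_add[of x "- x" z] w_add_right[of z x "- x"] w_zero by simp_all

lemma w_diff: "w (x - y) z = w x z - w y z" "w z (x - y) = w z x - w z y"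
  using w_add[of x "- y" z] w_add_right[of z x "- y"] w_minus by simp_all

lemma w_sum: "w (sum f A) z = (\<Sum>i\<in>A. w (f i) z)" "w z (sum f A) = (\<Sum>i\<in>A. w z (f i))"
  by (induction A rule: infinite_finite_induct) (simp_all add: w_zero w_add w_add_right)

lemma w_self: "w x x = 0"
  using w_skew[of x x] by simp

lemma w_span_zero:
  assumes "\<And>s. s \<in> S \<Longrightarrow> w u s = 0" "x \<in> span S"
  shows "w u x = 0"
  using assms(2)
  by (induction rule: span_induct_alt) (simp_all add: w_zero w_add_right w_sc_right assms(1))

text \<open>\<open>D\<close> is the index in \<open>H\<close> of the radical of the form reduced modulo \<open>r\<close>, expressed by a
  system of representatives.\<close>

definition radical_index :: "'g set \<Rightarrow> nat \<Rightarrow> bool" where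
  "radical_index H D \<longleftrightarrow> (\<exists>R. finite R \<and> card R = D \<and> R \<subseteq> H \<and>
     (\<forall>v\<in>H. \<exists>!g. g \<in> R \<and> (\<forall>x\<in>H. int r dvd w v x - w g x)))"

lemma radical_index_empty: "radical_index (span {}) 1"
  unfolding radical_index_def by (intro exI[of _ "{0}"]) auto

text \<open>The \<open>z\<close>-component of either argument contributes nothing to the form, so a
  system of representatives for \<open>span S\<close> also serves the larger span.\<close>

lemma radical_index_insert_radical:
  assumes z: "w z z = 0" "\<And>s. s \<in> S \<Longrightarrow> w z s = 0"
    and D: "radical_index (span S) D"
  shows "radical_index (span (insert z S)) D"
proof -
  obtain R where R0: "finite R" "card R = D" "R \<subseteq> span S"
    "\<forall>v\<in>span S. \<exists>!g. g \<in> R \<and> (\<forall>x\<in>span S. int r dvd w v x - w g x)"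
    using D unfolding radical_index_def by (elim exE conjE)
  note R = R0(1-3) bspec[OF R0(4)]
  have sub: "span S \<subseteq> span (insert z S)" by (rule span_mono) auto
  have zs: "w z s = 0" "w s z = 0" if "s \<in> span S" for s
    using w_span_zero[OF z(2) that] w_skew[of s z] by auto
  have key: "(\<forall>x\<in>span (insert z S). int r dvd w v x - w g x) \<longleftrightarrow>
      (\<forall>x\<in>span S. int r dvd w s x - w g x)"
    if v: "v = sc k z + s" "s \<in> span S" and g: "g \<in> span S" for v k s g
  proof -
    have e1: "w v x = w v y" "w g x = w g y" if "x = sc l z + y" "y \<in> span S" for x l y
      using that v g zs by (simp_all add: w_add w_add_right w_sc w_sc_right z(1))
    have e2: "w v x = w s x" if "x \<in> span S" for x
      using that v zs by (simp add: w_add w_sc)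
    show ?thesis
    proof (intro iffI ballI)
      fix x assume "\<forall>x\<in>span (insert z S). int r dvd w v x - w g x" "x \<in> span S"
      then show "int r dvd w s x - w g x" using e2 sub by (metis subsetD)
    next
      fix x assume a: "\<forall>x\<in>span S. int r dvd w s x - w g x" and "x \<in> span (insert z S)"
      then obtain k where k: "x - sc k z \<in> span S" unfolding span_breakdown_eq by blast
      have x: "x = sc k z + (x - sc k z)" by simp
      show "int r dvd w v x - w g x"
        unfolding e1(1)[OF x k] e1(2)[OF x k] e2[OF k] using a k by blast
    qed
  qed
  show ?thesis
    unfolding radical_index_def
  proof (intro exI[of _ R] conjI ballI)
    show "finite R" "card R = D" "R \<subseteq> span (insert z S)" using R sub by auto
    fix v assume "v \<in> span (insert z S)"
    then obtain k where "v - sc k z \<in> span S" unfolding span_breakdown_eq by blast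
    then obtain s where s: "v = sc k z + s" "s \<in> span S" by (metis add.commute diff_add_cancel)
    show "\<exists>!g. g \<in> R \<and> (\<forall>x\<in>span (insert z S). int r dvd w v x - w g x)"
    proof -
      have "(g \<in> R \<and> (\<forall>x\<in>span (insert z S). int r dvd w v x - w g x)) \<longleftrightarrow>
          (g \<in> R \<and> (\<forall>x\<in>span S. int r dvd w s x - w g x))" for g
        using key[OF s, of g] R(3) by blast
      then show ?thesis using R(4)[OF s(2)] by (simp only:)
    qed
  qed
qed

text \<open>After division by the gcd, \<open>h\<close> becomes a unit modulo the remaining divisor
  of \<open>r\<close>.\<close>

lemma dvd_mult_iff_div_gcd: "int r dvd h * k \<longleftrightarrow> int (r div nat (gcd h (int r))) dvd k"
proof -
  define d where "d = gcd h (int r)"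
  have d: "d > 0" using r_pos by (simp add: d_def)
  define h' where "h' = h div d"
  define r' where "r' = int r div d"
  have h: "h = d * h'" and r': "int r = d * r'" by (simp_all add: h'_def r'_def d_def)
  have "coprime h' r'"
    using r_pos unfolding h'_def r'_def d_def by (intro div_gcd_coprime) auto
  then have "int r dvd h * k \<longleftrightarrow> r' dvd k"
    unfolding h r' using d by (simp add: mult.assoc coprime_commute coprime_dvd_mult_right_iff)
  moreover have "int (r div nat d) = r'"
    using d r' by (simp add: zdiv_int)
  ultimately show ?thesis by (simp add: d_def)
qed

text \<open>In coordinates a u + b v + s the form is h (a b' - b a') + w s s'. Congruence modulo
  \<open>r\<close> against all vectors therefore decouples into the class of \<open>s\<close> and
  the classes of \<open>a\<close> and \<open>b\<close> modulo m = r / gcd(h, r), which multiplies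
  the index by m^2.\<close>

lemma radical_index_insert_hyperbolic:
  assumes u: "\<And>s. s \<in> S \<Longrightarrow> w u s = 0" and v: "\<And>s. s \<in> S \<Longrightarrow> w v s = 0"
    and h: "w u v = h"
    and D: "radical_index (span S) (d ^ 2)"
  shows "radical_index (span (insert u (insert v S))) ((r div nat (gcd h (int r)) * d) ^ 2)"
proof -
  define m where "m = r div nat (gcd h (int r))"
  have m: "m > 0"
  proof -
    have "gcd h (int r) dvd int r" by simp
    then have "nat (gcd h (int r)) dvd r" by (metis gcd_ge_0_int int_dvd_int_iff int_nat_eq)
    then show ?thesis unfolding m_def using r_pos by (simp add: div_greater_zero_iff dvd_imp_le r_pos)
  qed
  obtain R where R0: "finite R" "card R = d ^ 2" "R \<subseteq> span S"
    "\<forall>x\<in>span S. \<exists>!g. g \<in> R \<and> (\<forall>y\<in>span S. int r dvd w x y - w g y)"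
    using D unfolding radical_index_def by (elim exE conjE)
  note R = R0(1-3) bspec[OF R0(4)]
  define H where "H = span (insert u (insert v S))"
  define e where "e = (\<lambda>(a, b, s). sc a u + sc b v + s)"
  have us: "w u s = 0" "w s u = 0" if "s \<in> span S" for s
    using w_span_zero[OF u that] w_skew[of s u] by auto
  have vs: "w v s = 0" "w s v = 0" if "s \<in> span S" for s
    using w_span_zero[OF v that] w_skew[of s v] by auto
  have vu: "w v u = - h" using h w_skew[of v u] by simp
  have we: "w (e (a, b, s)) (e (a', b', s')) = h * (a * b' - b * a') + w s s'"
    if "s \<in> span S" "s' \<in> span S" for a b s a' b' s'
    using that us vs vu h
    by (simp add: e_def w_add w_add_right w_sc w_sc_right w_self algebra_simps)
  have H: "x \<in> H \<longleftrightarrow> (\<exists>a b s. s \<in> span S \<and> x = e (a, b, s))" for x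
  proof
    assume "x \<in> H"
    then obtain a b where "x - sc a u - sc b v \<in> span S"
      unfolding H_def span_breakdown_eq by blast
    moreover have "x = e (a, b, x - sc a u - sc b v)" by (simp add: e_def)
    ultimately show "\<exists>a b s. s \<in> span S \<and> x = e (a, b, s)" by blast
  next
    assume "\<exists>a b s. s \<in> span S \<and> x = e (a, b, s)"
    then obtain a b s where s: "s \<in> span S" and x: "x = e (a, b, s)" by blast
    have "x - sc a u - sc b v = s" unfolding x e_def by simp
    then show "x \<in> H" unfolding H_def span_breakdown_eq using s by metis
  qed
  have key: "(\<forall>x\<in>H. int r dvd w (e (a, b, s)) x - w (e (a', b', s')) x) \<longleftrightarrow>
      int m dvd a - a' \<and> int m dvd b - b' \<and> (\<forall>x\<in>span S. int r dvd w s x - w s' x)"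
    (is "?l = ?r") if s: "s \<in> span S" "s' \<in> span S" for a b s a' b' s'
  proof
    assume l: ?l
    have 0: "0 \<in> span S" by (rule span_zero)
    \<comment> \<open>Pairing with \<open>v\<close>, with \<open>u\<close> and with the vectors of
      \<open>span S\<close> isolates the three coordinates.\<close>
    have "int r dvd h * (a - a')"
      using l[rule_format, of "e (0, 1, 0)"] H we[OF s(1) 0] we[OF s(2) 0] 0
      by (auto simp: w_zero algebra_simps)
    moreover have "int r dvd h * (b' - b)"
      using l[rule_format, of "e (1, 0, 0)"] H we[OF s(1) 0] we[OF s(2) 0] 0
      by (auto simp: w_zero algebra_simps)
    moreover have "int r dvd w s x - w s' x" if "x \<in> span S" for x
      using l[rule_format, of "e (0, 0, x)"] H we[OF s(1) that] we[OF s(2) that] that by auto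
    ultimately show ?r
      unfolding m_def dvd_mult_iff_div_gcd by (metis dvd_diff_commute)
  next
    assume rr: ?r
    show ?l
    proof
      fix x assume "x \<in> H"
      then obtain a'' b'' s'' where x: "s'' \<in> span S" "x = e (a'', b'', s'')" using H by blast
      have "w (e (a, b, s)) x - w (e (a', b', s')) x =
          (h * (a - a')) * b'' - (h * (b - b')) * a'' + (w s s'' - w s' s'')"
        unfolding x(2) we[OF s(1) x(1)] we[OF s(2) x(1)] by (simp add: algebra_simps)
      moreover have "int r dvd h * (a - a')" "int r dvd h * (b - b')"
        using rr unfolding m_def dvd_mult_iff_div_gcd by auto
      moreover have "int r dvd w s s'' - w s' s''" using rr x(1) by blast
      ultimately show "int r dvd w (e (a, b, s)) x - w (e (a', b', s')) x" by simp
    qed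
  qed
  define I where "I = {0..<int m} \<times> {0..<int m} \<times> R"
  have small: "a = a'" if "a \<in> {0..<int m}" "a' \<in> {0..<int m}" "int m dvd a - a'" for a a' :: int
    using that by (metis atLeastLessThan_iff mod_eq_dvd_iff mod_pos_pos_trivial)
  \<comment> \<open>Distinctness of the representatives is read off the form itself: equal pairings
    force equal coordinates in the range below \<open>m\<close>. This gives injectivity of
    \<open>e\<close> on \<open>I\<close> as well.\<close>
  have uniq: "p = p'" if p: "p \<in> I" "p' \<in> I" and eq: "\<forall>x\<in>H. int r dvd w (e p) x - w (e p') x" for p p'
  proof -
    obtain a b s where ps: "p = (a, b, s)" by (cases p)
    obtain a' b' s' where ps': "p' = (a', b', s')" by (cases p')
    have s: "s \<in> R" "s' \<in> R" using p ps ps' by (auto simp: I_def)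
    then have "s \<in> span S" "s' \<in> span S" using R(3) by auto
    note k = eq[unfolded ps ps' key[OF this]]
    have "a = a'" "b = b'" using p k small unfolding ps ps' I_def by auto
    moreover have "s = s'"
    proof -
      have "\<forall>y\<in>span S. int r dvd w s y - w s y" by simp
      then show ?thesis using R(4)[OF \<open>s \<in> span S\<close>] s conjunct2[OF conjunct2[OF k]] by (elim ex1E) blast
    qed
    ultimately show ?thesis using ps ps' by simp
  qed
  have inj: "inj_on e I" by (rule inj_onI, rule uniq) auto
  have "radical_index H ((m * d) ^ 2)"
    unfolding radical_index_def
  proof (intro exI[of _ "e ` I"] conjI ballI)
    show "finite (e ` I)" unfolding I_def using R(1) by simp
    show "card (e ` I) = (m * d) ^ 2"
      by (simp only: card_image[OF inj]) (simp add: I_def card_cartesian_product R(2) power2_eq_square)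
    show "e ` I \<subseteq> H"
    proof
      fix x assume "x \<in> e ` I"
      then show "x \<in> H" unfolding H I_def using R(3) by blast
    qed
    fix x assume "x \<in> H"
    then obtain a b s where s: "s \<in> span S" and x: "x = e (a, b, s)" using H by blast
    obtain g where g: "g \<in> R" "\<forall>y\<in>span S. int r dvd w s y - w g y"
      using R(4)[OF s] by (elim ex1E conjE)
    define p where "p = (a mod int m, b mod int m, g)"
    have p: "p \<in> I" using m g(1) by (simp add: p_def I_def)
    have xp: "\<forall>y\<in>H. int r dvd w x y - w (e p) y"
      unfolding x p_def key[OF s subsetD[OF R(3) g(1)]] using g(2) by (simp add: mod_eq_dvd_iff[symmetric])
    show "\<exists>!g. g \<in> e ` I \<and> (\<forall>y\<in>H. int r dvd w x y - w g y)"
    proof (rule ex1I[of _ "e p"])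
      show "e p \<in> e ` I \<and> (\<forall>y\<in>H. int r dvd w x y - w (e p) y)" using p xp by blast
      fix g' assume g': "g' \<in> e ` I \<and> (\<forall>y\<in>H. int r dvd w x y - w g' y)"
      then obtain p' where p': "p' \<in> I" "g' = e p'" by blast
      have "int r dvd w (e p') y - w (e p) y" if "y \<in> H" for y
        using dvd_diff[OF bspec[OF xp that] bspec[OF conjunct2[OF g'] that]] p'(2) by simp
      then show "g' = e p" using uniq[OF p'(1) p] p'(2) by blast
    qed
  qed
  then show ?thesis by (simp add: H_def m_def)
qed

end

text \<open>Over the integers, the form with \<open>w (W i) (V j) = 2 \<delta>\<^sub>i\<^sub>j\<close> and \<open>w (V i) (V j) = -1\<close> for \<open>i < j\<close>
  on \<open>Suc (Suc m)\<close> pairs is the orthogonal sum of two hyperbolic planes with values \<open>-1\<close> and \<open>4\<close>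
  and of the same form on \<open>m\<close> pairs. A plane with value \<open>h\<close> contributes the factor \<open>r / gcd h r\<close>.\<close>

fun block_degree :: "nat \<Rightarrow> nat \<Rightarrow> nat" where
  "block_degree r 0 = 1"
| "block_degree r (Suc 0) = r div gcd 2 r"
| "block_degree r (Suc (Suc m)) = r * (r div gcd 4 r * block_degree r m)"

context alternating_form
begin

lemma span_eqI: "A \<subseteq> span B \<Longrightarrow> B \<subseteq> span A \<Longrightarrow> span A = span B"
  by (metis span_minimal subset_antisym subspace_span)

lemma radical_index_pairs:
  assumes "\<And>i j. i < m \<Longrightarrow> j < m \<Longrightarrow> w (W i) (W j) = 0"
    and "\<And>i j. i < m \<Longrightarrow> j < m \<Longrightarrow> w (W i) (V j) = (if i = j then 2 else 0)"
    and "\<And>i j. i < j \<Longrightarrow> j < m \<Longrightarrow> w (V i) (V j) = -1"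
  shows "radical_index (span (W ` {..<m} \<union> V ` {..<m})) (block_degree r m ^ 2)"
  using assms
proof (induction m arbitrary: W V rule: induct_nat_012)
  case 0
  then show ?case using radical_index_empty by simp
next
  case 1
  have "radical_index (span (insert (W 0) (insert (V 0) {}))) ((r div nat (gcd 2 (int r)) * 1) ^ 2)"
    by (rule radical_index_insert_hyperbolic) (use 1 radical_index_empty in auto)
  moreover have "nat (gcd 2 (int r)) = gcd 2 r" by (metis gcd_int_int_eq nat_int of_nat_numeral)
  ultimately show ?case by (simp add: lessThan_Suc insert_commute)
next
  case (ge2 m)
  note WW = ge2.prems(1) and WY = ge2.prems(2) and YY = ge2.prems(3)
  have YV': "w (V j) (V i) = 1" if "i < j" "j < Suc (Suc m)" for i j
    using YY[OF that] w_skew[of "V j"] by simp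
  have YW: "w (V j) (W i) = (if i = j then -2 else 0)" if "i < Suc (Suc m)" "j < Suc (Suc m)" for i j
    using WY[OF that] w_skew[of "V j"] by simp
  define W' where "W' = (\<lambda>j. W (Suc (Suc j)))"
  define V' where "V' = (\<lambda>j. V (Suc (Suc j)) + V 0 - V 1)"
  define T where "T = (\<Sum>j<m. W' j)"
  \<comment> \<open>\<open>V'\<close>, \<open>U1\<close>, \<open>U2\<close> are the projections of \<open>V\<close>, \<open>W 0\<close>, \<open>W 1\<close> orthogonal to the plane
    of \<open>V 0\<close>, \<open>V 1\<close>, corrected by \<open>T\<close> so that the last two become orthogonal to the remaining pairs.\<close>
  define U1 where "U1 = W 0 - sc 2 (V 1) - T"
  define U2 where "U2 = W 1 + sc 2 (V 0) + T"
  note ws = w_add w_add_right w_diff w_sc w_sc_right w_sum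
  have TT: "w T T = 0" by (rule w_self)
  have T0: "w T (W i) = 0" "w (W i) T = 0" if "i < Suc (Suc m)" for i
    using that by (auto simp: T_def W'_def ws WW)
  have TY: "w T (V 0) = 0" "w T (V (Suc 0)) = 0" "w (V 0) T = 0" "w (V (Suc 0)) T = 0"
    by (auto simp: T_def W'_def ws WY YW)
  have TY2: "w T (V (Suc (Suc j))) = 2" if "j < m" for j
    using that by (simp add: T_def W'_def ws WY)
  let ?S = "W' ` {..<m} \<union> V' ` {..<m}"
  have IH: "radical_index (span ?S) (block_degree r m ^ 2)"
    by (rule ge2.IH(1)) (auto simp: W'_def V'_def ws WW WY YW YY YV' w_self)
  have 1: "radical_index (span (insert U1 (insert U2 ?S))) ((r div nat (gcd 4 (int r)) * block_degree r m) ^ 2)"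
  proof (rule radical_index_insert_hyperbolic[OF _ _ _ IH])
    \<comment> \<open>The value is 4 + 4 - 4: \<open>W 0\<close> against 2 \<open>V 0\<close>, then
      -2 \<open>V 1\<close> against \<open>W 1\<close>, then -2 \<open>V 1\<close> against 2
      \<open>V 0\<close>. The terms with \<open>T\<close> vanish.\<close>
    show "w U1 U2 = 4"
      by (simp add: U1_def U2_def ws TT T0 TY WW WY YW YY YV' w_self)
    show "w U1 s = 0" if "s \<in> ?S" for s
      using that by (auto simp: U1_def W'_def V'_def ws T0 TY TY2 WW WY YW YY YV' w_self)
    show "w U2 s = 0" if "s \<in> ?S" for s
      using that by (auto simp: U2_def W'_def V'_def ws T0 TY TY2 WW WY YW YY YV' w_self)
  qed
  let ?S2 = "insert U1 (insert U2 ?S)"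
  have 2: "radical_index (span (insert (V 0) (insert (V 1) ?S2)))
    ((r div nat (gcd (-1) (int r)) * (r div nat (gcd 4 (int r)) * block_degree r m)) ^ 2)"
  proof (rule radical_index_insert_hyperbolic[OF _ _ _ 1])
    show "w (V 0) (V 1) = -1" by (simp add: YY)
    show "w (V 0) s = 0" if "s \<in> ?S2" for s
      using that by (auto simp: U1_def U2_def W'_def V'_def ws TY WW WY YW YY YV' w_self)
    show "w (V 1) s = 0" if "s \<in> ?S2" for s
      using that by (auto simp: U1_def U2_def W'_def V'_def ws TY WW WY YW YY YV' w_self)
  qed
  have g4: "nat (gcd 4 (int r)) = gcd 4 r" by (metis gcd_int_int_eq nat_int of_nat_numeral)
  let ?A = "insert (V 0) (insert (V 1) ?S2)"
  let ?B = "W ` {..<Suc (Suc m)} \<union> V ` {..<Suc (Suc m)}"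
  \<comment> \<open>The change of generators can be inverted over the integers, so the computed
    index is that of the original lattice.\<close>
  have "span ?A = span ?B"
  proof (rule span_eqI)
    have b: "W i \<in> span ?B" "V i \<in> span ?B" if "i < Suc (Suc m)" for i
      using that by (auto intro!: span_base)
    have T: "T \<in> span ?B" unfolding T_def W'_def by (rule span_sum) (use b in auto)
    show "?A \<subseteq> span ?B"
      using b T by (auto simp: U1_def U2_def W'_def V'_def intro!: span_add span_diff span_scale)
    have y: "V 0 \<in> span ?A" "V 1 \<in> span ?A" by (auto intro!: span_base)
    have a: "W' j \<in> span ?A" "V' j \<in> span ?A" if "j < m" for j
      using that by (auto intro!: span_base)
    have u: "U1 \<in> span ?A" "U2 \<in> span ?A" by (auto intro!: span_base)
    have T': "T \<in> span ?A" unfolding T_def by (rule span_sum) (use a in auto)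
    have "W 0 = U1 + sc 2 (V 1) + T" "W 1 = U2 - sc 2 (V 0) - T" by (auto simp: U1_def U2_def)
    then have w: "W 0 \<in> span ?A" "W 1 \<in> span ?A"
      using u y T' by (metis span_add span_diff span_scale)+
    have "V (Suc (Suc j)) = V' j - V 0 + V 1" for j by (simp add: V'_def)
    then have y': "V (Suc (Suc j)) \<in> span ?A" if "j < m" for j
      using a[OF that] y by (metis span_add span_diff)
    have w': "W (Suc (Suc j)) \<in> span ?A" if "j < m" for j
      using a[OF that] by (simp add: W'_def)
    have "W i \<in> span ?A \<and> V i \<in> span ?A" if "i < Suc (Suc m)" for i
    proof -
      consider "i = 0" | "i = 1" | j where "i = Suc (Suc j)" "j < m"
        using \<open>i < Suc (Suc m)\<close> by (metis One_nat_def Suc_less_eq not0_implies_Suc)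
      then show ?thesis using w w' y y' by cases auto
    qed
    then show "?B \<subseteq> span ?A" by blast
  qed
  then show ?case using 2 g4 by simp
qed

text \<open>The configuration of the exponent lattice: \<open>V 0\<close> has no dual partner
  \<open>W 0\<close>, and a radical vector \<open>Z\<close> is present instead. In the splitting of
  \<open>radical_index_pairs\<close> the vector \<open>U1\<close> is then missing, so its partner
  \<open>U\<close> becomes a second radical vector and the plane of value 4 disappears, leaving the
  factor \<open>r\<close> of the plane of \<open>V 0\<close> and \<open>V 1\<close>.\<close>

lemma radical_index_unpaired:
  assumes WW: "\<And>i j. 0 < i \<Longrightarrow> 0 < j \<Longrightarrow> i < Suc (Suc m) \<Longrightarrow> j < Suc (Suc m) \<Longrightarrow> w (W i) (W j) = 0"
    and WY: "\<And>i j. 0 < i \<Longrightarrow> i < Suc (Suc m) \<Longrightarrow> j < Suc (Suc m) \<Longrightarrow> w (W i) (V j) = (if i = j then 2 else 0)"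
    and YY: "\<And>i j. i < j \<Longrightarrow> j < Suc (Suc m) \<Longrightarrow> w (V i) (V j) = -1"
    and Z: "\<And>x. x \<in> W ` {0<..<Suc (Suc m)} \<union> V ` {..<Suc (Suc m)} \<Longrightarrow> w Z x = 0"
  shows "radical_index (span (insert Z (W ` {0<..<Suc (Suc m)} \<union> V ` {..<Suc (Suc m)})))
    ((r * block_degree r m) ^ 2)"
proof -
  have YV': "w (V j) (V i) = 1" if "i < j" "j < Suc (Suc m)" for i j
    using YY[OF that] w_skew[of "V j"] by simp
  have YW: "w (V j) (W i) = (if i = j then -2 else 0)" if "0 < i" "i < Suc (Suc m)" "j < Suc (Suc m)" for i j
    using WY[OF that] w_skew[of "V j"] by simp
  define W' where "W' = (\<lambda>j. W (Suc (Suc j)))"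
  define V' where "V' = (\<lambda>j. V (Suc (Suc j)) + V 0 - V 1)"
  define T where "T = (\<Sum>j<m. W' j)"
  define U where "U = W 1 + sc 2 (V 0) + T"
  note ws = w_add w_add_right w_diff w_sc w_sc_right w_sum
  have T0: "w T (W i) = 0" "w (W i) T = 0" if "0 < i" "i < Suc (Suc m)" for i
    using that by (auto simp: T_def W'_def ws WW)
  have TY: "w T (V 0) = 0" "w T (V (Suc 0)) = 0" "w (V 0) T = 0" "w (V (Suc 0)) T = 0"
    by (auto simp: T_def W'_def ws WY YW)
  have TY2: "w T (V (Suc (Suc j))) = 2" if "j < m" for j
    using that by (simp add: T_def W'_def ws WY)
  let ?S = "W' ` {..<m} \<union> V' ` {..<m}"
  have IH: "radical_index (span ?S) (block_degree r m ^ 2)"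
    by (rule radical_index_pairs) (auto simp: W'_def V'_def ws WW WY YW YY YV' w_self)
  have 1: "radical_index (span (insert U ?S)) (block_degree r m ^ 2)"
  proof (rule radical_index_insert_radical[OF w_self _ IH])
    show "w U s = 0" if "s \<in> ?S" for s
      using that by (auto simp: U_def W'_def V'_def ws T0 TY TY2 WW WY YW YY YV' w_self)
  qed
  let ?S2 = "insert U ?S"
  have 2: "radical_index (span (insert (V 0) (insert (V 1) ?S2)))
    ((r div nat (gcd (-1) (int r)) * block_degree r m) ^ 2)"
  proof (rule radical_index_insert_hyperbolic[OF _ _ _ 1])
    show "w (V 0) (V 1) = -1" by (simp add: YY)
    show "w (V 0) s = 0" if "s \<in> ?S2" for s
      using that by (auto simp: U_def W'_def V'_def ws TY WW WY YW YY YV' w_self)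
    show "w (V 1) s = 0" if "s \<in> ?S2" for s
      using that by (auto simp: U_def W'_def V'_def ws TY WW WY YW YY YV' w_self)
  qed
  let ?A = "insert (V 0) (insert (V 1) ?S2)"
  let ?B = "W ` {0<..<Suc (Suc m)} \<union> V ` {..<Suc (Suc m)}"
  have AB: "?A \<subseteq> span ?B"
  proof -
    have b: "0 < i \<longrightarrow> W i \<in> span ?B" "V i \<in> span ?B" if "i < Suc (Suc m)" for i
      using that by (auto intro!: span_base)
    have T: "T \<in> span ?B" unfolding T_def W'_def by (rule span_sum) (use b in auto)
    show ?thesis
      using b T by (auto simp: U_def W'_def V'_def intro!: span_add span_diff span_scale)
  qed
  have BA: "?B \<subseteq> span ?A"
  proof -
    have y: "V 0 \<in> span ?A" "V 1 \<in> span ?A" by (auto intro!: span_base)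
    have a: "W' j \<in> span ?A" "V' j \<in> span ?A" if "j < m" for j
      using that by (auto intro!: span_base)
    have u: "U \<in> span ?A" by (auto intro!: span_base)
    have T': "T \<in> span ?A" unfolding T_def by (rule span_sum) (use a in auto)
    have "W 1 = U - sc 2 (V 0) - T" by (auto simp: U_def)
    then have w: "W 1 \<in> span ?A"
      using u y T' by (metis span_add span_diff span_scale)
    have "V (Suc (Suc j)) = V' j - V 0 + V 1" for j by (simp add: V'_def)
    then have y': "V (Suc (Suc j)) \<in> span ?A" if "j < m" for j
      using a[OF that] y by (metis span_add span_diff)
    have w': "W (Suc (Suc j)) \<in> span ?A" if "j < m" for j
      using a[OF that] by (simp add: W'_def)
    have "(0 < i \<longrightarrow> W i \<in> span ?A) \<and> V i \<in> span ?A" if "i < Suc (Suc m)" for i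
    proof -
      consider "i = 0" | "i = 1" | j where "i = Suc (Suc j)" "j < m"
        using \<open>i < Suc (Suc m)\<close> by (metis One_nat_def Suc_less_eq not0_implies_Suc)
      then show ?thesis using w w' y y' by cases auto
    qed
    then show ?thesis by auto
  qed
  have "span ?A = span ?B" by (rule span_eqI[OF AB BA])
  then have 3: "radical_index (span ?B) ((r * block_degree r m) ^ 2)" using 2 by simp
  show ?thesis
    by (rule radical_index_insert_radical[OF w_self _ 3]) (use Z in auto)
qed

end

section \<open>Closed forms of the block degree according to \<open>r\<close> modulo 4\<close>

lemma block_degree_odd: "odd r \<Longrightarrow> block_degree r m = r ^ m"
proof (induction r m rule: block_degree.induct)
  case (2 r)
  have "coprime 2 r" using 2 by simp
  then show ?case by simp
next
  case (3 r m)
  have "coprime 2 r" using 3 by simp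
  then have "coprime (2 ^ 2) r" by (subst coprime_power_left_iff) simp
  then have "gcd 4 r = 1" by simp
  then show ?case using 3 by simp
qed auto

text \<open>Here gcd(4, r) = gcd(2, r) = 2, so every plane of value 4 or 2 loses one factor 2. There
  is one such plane for every two pairs and one for a leftover pair, which makes
  \<open>Suc m div 2\<close> in all.\<close>

lemma block_degree_singly_even:
  assumes "even r" "\<not> 4 dvd r"
  shows "block_degree r m * 2 ^ (Suc m div 2) = r ^ m"
  using assms
proof (induction r m rule: block_degree.induct)
  case (3 r m)
  obtain t where t: "r = 2 * t" using 3 by blast
  have "odd t" using 3 t by auto
  then have "coprime 2 t" by simp
  then have "gcd (2 * 2) (2 * t) = 2 * 1" unfolding gcd_mult_distrib_nat[symmetric] by simp
  then have "gcd 4 r = 2" using t by simp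
  then show ?case using 3 t by (simp add: algebra_simps)
qed auto

text \<open>Two pairs lose the factor 4 and a leftover pair the factor 2, that is, a factor 2 per
  pair.\<close>

lemma block_degree_doubly_even:
  assumes "4 dvd r"
  shows "block_degree r m * 2 ^ m = r ^ m"
  using assms
proof (induction r m rule: block_degree.induct)
  case (2 r)
  have "gcd 2 r = 2" using 2 by (metis dvd_trans gcd_nat.absorb1 even_numeral num.distinct(1))
  then show ?case using 2 by auto
next
  case (3 r m)
  obtain t where t: "r = 4 * t" using 3 by blast
  then have "gcd 4 r = 4" by simp
  then show ?case using 3 t by (simp add: algebra_simps)
qed auto

section \<open>Quantum tori\<close>

lemma poly_mapping_single_induct [case_names zero add]:
  assumes "P 0" "\<And>k c f. P f \<Longrightarrow> P (Poly_Mapping.single k c + f)"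
  shows "P (f :: 'a \<Rightarrow>\<^sub>0 'b::comm_monoid_add)"
proof (induction f rule: update_induct)
  case const
  then show ?case using assms(1) by simp
next
  case (update f k c)
  have "Poly_Mapping.update k c f = Poly_Mapping.single k c + f"
    using update by (intro poly_mapping_eqI)
      (auto simp: lookup_update lookup_add lookup_single when_def in_keys_iff)
  then show ?case using assms(2) update by simp
qed

lemma sum_single_keys: "(\<Sum>k\<in>Poly_Mapping.keys f. Poly_Mapping.single k (Poly_Mapping.lookup f k)) = f"
  by (intro poly_mapping_eqI)
    (auto simp: lookup_sum lookup_single when_def sum.delta in_keys_iff)

text \<open>The twisted group algebra with basis \<open>E u\<close> and product \<open>E u \<star> E v = q\<^bsup>\<beta> u v\<^esup> E (u + v)\<close>, realised on
  the type of finitely supported functions, whose own product \<open>*\<close> plays no role here.\<close>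

locale quantum_torus =
  fixes \<beta> :: "'g::linordered_ab_group_add \<Rightarrow> 'g \<Rightarrow> int" and q :: "'k::field"
  assumes form_add: "\<beta> (u + u') v = \<beta> u v + \<beta> u' v" "\<beta> v (u + u') = \<beta> v u + \<beta> v u'"
    and q_nonzero [simp]: "q \<noteq> 0"
begin

lemma form_zero [simp]: "\<beta> 0 v = 0" "\<beta> v 0 = 0"
  using form_add(1)[of 0 0 v] form_add(2)[of v 0 0] by simp_all

lemma form_minus: "\<beta> (- u) v = - \<beta> u v" "\<beta> v (- u) = - \<beta> v u"
  using form_add(1)[of u "- u" v] form_add(2)[of v u "- u"] by simp_all

lemma form_diff: "\<beta> (u - u') v = \<beta> u v - \<beta> u' v" "\<beta> v (u - u') = \<beta> v u - \<beta> v u'"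
  using form_add(1)[of u "- u'" v] form_add(2)[of v u "- u'"] by (simp_all add: form_minus)

definition tmult :: "('g \<Rightarrow>\<^sub>0 'k) \<Rightarrow> ('g \<Rightarrow>\<^sub>0 'k) \<Rightarrow> ('g \<Rightarrow>\<^sub>0 'k)" (infixl \<open>\<star>\<close> 70) where
  "f \<star> g = (\<Sum>u\<in>Poly_Mapping.keys f. \<Sum>v\<in>Poly_Mapping.keys g.
     Poly_Mapping.single (u + v) (Poly_Mapping.lookup f u * Poly_Mapping.lookup g v * q powi \<beta> u v))"

abbreviation E where "E u \<equiv> Poly_Mapping.single u (1::'k)"

text \<open>The support of a sum may be smaller than the union of the supports. Summing over a
  common finite superset makes additivity a termwise statement.\<close>

lemma tmult_superset:
  assumes "finite U" "Poly_Mapping.keys f \<subseteq> U" "finite V" "Poly_Mapping.keys g \<subseteq> V"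
  shows "f \<star> g = (\<Sum>u\<in>U. \<Sum>v\<in>V.
     Poly_Mapping.single (u + v) (Poly_Mapping.lookup f u * Poly_Mapping.lookup g v * q powi \<beta> u v))"
proof -
  have "(\<Sum>u\<in>U. \<Sum>v\<in>V. Poly_Mapping.single (u + v) (Poly_Mapping.lookup f u * Poly_Mapping.lookup g v * q powi \<beta> u v))
    = (\<Sum>u\<in>Poly_Mapping.keys f. \<Sum>v\<in>V. Poly_Mapping.single (u + v) (Poly_Mapping.lookup f u * Poly_Mapping.lookup g v * q powi \<beta> u v))"
    using assms by (intro sum.mono_neutral_right) (auto simp: in_keys_iff)
  also have "\<dots> = f \<star> g"
    unfolding tmult_def using assms
    by (intro sum.cong refl sum.mono_neutral_right) (auto simp: in_keys_iff)
  finally show ?thesis by simp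
qed

lemma tmult_add_left: "(f + f') \<star> g = f \<star> g + f' \<star> g"
proof -
  let ?U = "Poly_Mapping.keys f \<union> Poly_Mapping.keys f'"
  have s: "Poly_Mapping.keys (f + f') \<subseteq> ?U" by (rule keys_add)
  show ?thesis
    using s by (subst (1 2 3) tmult_superset[where U = ?U and V = "Poly_Mapping.keys g"])
      (auto simp: lookup_add sum.distrib[symmetric] single_add[symmetric] algebra_simps)
qed

lemma tmult_add_right: "g \<star> (f + f') = g \<star> f + g \<star> f'"
proof -
  let ?U = "Poly_Mapping.keys f \<union> Poly_Mapping.keys f'"
  have s: "Poly_Mapping.keys (f + f') \<subseteq> ?U" by (rule keys_add)
  show ?thesis
    using s by (subst (1 2 3) tmult_superset[where V = ?U and U = "Poly_Mapping.keys g"])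
      (auto simp: lookup_add sum.distrib[symmetric] single_add[symmetric] algebra_simps)
qed

lemma tmult_zero [simp]: "0 \<star> f = 0" "f \<star> 0 = 0"
  by (simp_all add: tmult_def)

lemma tmult_minus: "(- f) \<star> g = - (f \<star> g)" "f \<star> (- g) = - (f \<star> g)"
  using tmult_add_left[of f "- f" g] tmult_add_right[of f g "- g"]
  by (simp_all add: eq_neg_iff_add_eq_0 add.commute)

lemma tmult_diff: "(f - f') \<star> g = f \<star> g - f' \<star> g" "g \<star> (f - f') = g \<star> f - g \<star> f'"
  using tmult_add_left[of f "- f'" g] tmult_add_right[of g f "- f'"] by (simp_all add: tmult_minus)

lemma tmult_sum: "sum f A \<star> g = (\<Sum>a\<in>A. f a \<star> g)" "g \<star> sum f A = (\<Sum>a\<in>A. g \<star> f a)"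
  by (induction A rule: infinite_finite_induct) (simp_all add: tmult_add_left tmult_add_right)

lemma tmult_single: "Poly_Mapping.single u a \<star> Poly_Mapping.single v b = Poly_Mapping.single (u + v) (a * b * q powi \<beta> u v)"
  by (subst tmult_superset[of "{u}" _ "{v}"]) auto

text \<open>By additivity only monomials matter, and biadditivity of the form gives the exponent
  \<beta> u v + \<beta> u w + \<beta> v w for both bracketings.\<close>

lemma tmult_assoc: "f \<star> g \<star> h = f \<star> (g \<star> h)"
proof (induction f rule: poly_mapping_single_induct)
  case (add u a f)
  have "Poly_Mapping.single u a \<star> g \<star> h = Poly_Mapping.single u a \<star> (g \<star> h)"
  proof (induction g rule: poly_mapping_single_induct)
    case (add v b g)
    have "Poly_Mapping.single u a \<star> Poly_Mapping.single v b \<star> h = Poly_Mapping.single u a \<star> (Poly_Mapping.single v b \<star> h)"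
    proof (induction h rule: poly_mapping_single_induct)
      case (add w c h)
      then show ?case
        using q_nonzero by (simp add: tmult_add_right tmult_single form_add power_int_add algebra_simps)
    qed simp
    then show ?case using add by (simp add: tmult_add_left tmult_add_right)
  qed simp
  then show ?case using add by (simp add: tmult_add_left)
qed simp

lemma tmult_one [simp]: "1 \<star> f = f" "f \<star> 1 = f"
  unfolding single_one[symmetric]
  by (induction f rule: poly_mapping_single_induct)
    (simp_all add: tmult_add_right tmult_add_left tmult_single del: single_one)

lemma tmult_scalar_right: "f \<star> Poly_Mapping.single 0 c = Poly_Mapping.single 0 c \<star> f"
  by (induction f rule: poly_mapping_single_induct)
    (simp_all add: tmult_add_right tmult_add_left tmult_single algebra_simps)

lemma lookup_tmult_single_left:
  "Poly_Mapping.lookup (Poly_Mapping.single u a \<star> f) v = a * Poly_Mapping.lookup f (v - u) * q powi \<beta> u (v - u)"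
  by (induction f rule: poly_mapping_single_induct)
    (auto simp: tmult_add_right tmult_single lookup_add lookup_single when_def algebra_simps)

lemma lookup_tmult_single_right:
  "Poly_Mapping.lookup (f \<star> Poly_Mapping.single u a) v = Poly_Mapping.lookup f (v - u) * a * q powi \<beta> (v - u) u"
  by (induction f rule: poly_mapping_single_induct)
    (auto simp: tmult_add_left tmult_single lookup_add lookup_single when_def algebra_simps)

lemma keys_tmult: "Poly_Mapping.keys (f \<star> g) \<subseteq> {u + v | u v. u \<in> Poly_Mapping.keys f \<and> v \<in> Poly_Mapping.keys g}"
proof
  fix x assume "x \<in> Poly_Mapping.keys (f \<star> g)"
  then obtain u where "u \<in> Poly_Mapping.keys f" "x \<in> Poly_Mapping.keys (\<Sum>v\<in>Poly_Mapping.keys g.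
     Poly_Mapping.single (u + v) (Poly_Mapping.lookup f u * Poly_Mapping.lookup g v * q powi \<beta> u v))"
    unfolding tmult_def using keys_sum by fast
  moreover from this(2) obtain v where "v \<in> Poly_Mapping.keys g"
    "x \<in> Poly_Mapping.keys (Poly_Mapping.single (u + v) (Poly_Mapping.lookup f u * Poly_Mapping.lookup g v * q powi \<beta> u v))"
    using keys_sum by fast
  ultimately show "x \<in> {u + v | u v. u \<in> Poly_Mapping.keys f \<and> v \<in> Poly_Mapping.keys g}"
    by (auto split: if_splits)
qed

definition lowest :: "('g \<Rightarrow>\<^sub>0 'k) \<Rightarrow> 'g \<Rightarrow> bool" where
  "lowest f u \<longleftrightarrow> u \<in> Poly_Mapping.keys f \<and> (\<forall>v\<in>Poly_Mapping.keys f. u \<le> v)"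

text \<open>In an ordered group the sum of the two minima is attained by no other pair, so its
  coefficient is a product of nonzero factors and cannot be cancelled.\<close>

lemma lowest_tmult:
  assumes "lowest f u" "lowest g v"
  shows "lowest (f \<star> g) (u + v)"
proof -
  have eq: "Poly_Mapping.lookup (Poly_Mapping.single (u' + v') c) (u + v) = (if u' = u \<and> v' = v then c else 0)"
    if "u' \<in> Poly_Mapping.keys f" "v' \<in> Poly_Mapping.keys g" for u' v' and c :: 'k
  proof -
    have "u \<le> u'" "v \<le> v'" using that assms by (auto simp: lowest_def)
    then have "u' + v' = u + v \<longleftrightarrow> u' = u \<and> v' = v" by (metis add_less_le_mono add_le_less_mono order_le_less less_irrefl)
    then show ?thesis by (simp add: lookup_single when_def)
  qed
  have uv: "u \<in> Poly_Mapping.keys f" "v \<in> Poly_Mapping.keys g" using assms by (auto simp: lowest_def)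
  have "Poly_Mapping.lookup (f \<star> g) (u + v) = (\<Sum>u'\<in>Poly_Mapping.keys f. \<Sum>v'\<in>Poly_Mapping.keys g.
      if u' = u \<and> v' = v then Poly_Mapping.lookup f u' * Poly_Mapping.lookup g v' * q powi \<beta> u' v' else 0)"
    unfolding tmult_def lookup_sum by (intro sum.cong refl eq)
  also have "\<dots> = (\<Sum>u'\<in>Poly_Mapping.keys f. if u' = u then \<Sum>v'\<in>Poly_Mapping.keys g.
      if v' = v then Poly_Mapping.lookup f u' * Poly_Mapping.lookup g v' * q powi \<beta> u' v' else 0 else 0)"
    by (intro sum.cong refl) auto
  also have "\<dots> = Poly_Mapping.lookup f u * Poly_Mapping.lookup g v * q powi \<beta> u v"
    using uv by simp
  finally have "Poly_Mapping.lookup (f \<star> g) (u + v) \<noteq> 0" using uv by (simp add: in_keys_iff)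
  moreover have "u + v \<le> w" if "w \<in> Poly_Mapping.keys (f \<star> g)" for w
    using subsetD[OF keys_tmult that] assms by (auto simp: lowest_def intro: add_mono)
  ultimately show ?thesis by (auto simp: lowest_def in_keys_iff)
qed

lemma lowest_exists:
  assumes "f \<noteq> 0"
  shows "\<exists>u. lowest f u"
proof -
  have "Poly_Mapping.keys f \<noteq> {}" using assms by simp
  then have "lowest f (Min (Poly_Mapping.keys f))" by (simp add: lowest_def)
  then show ?thesis by blast
qed

lemma tmult_eq_zero_iff: "f \<star> g = 0 \<longleftrightarrow> f = 0 \<or> g = 0"
proof -
  have "f \<star> g \<noteq> 0" if "f \<noteq> 0" "g \<noteq> 0"
    using lowest_exists[OF that(1)] lowest_exists[OF that(2)] lowest_tmult
    by (metis keys_zero empty_iff lowest_def)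
  then show ?thesis by auto
qed

lemma tmult_commute:
  assumes "\<And>u v. u \<in> Poly_Mapping.keys f \<Longrightarrow> v \<in> Poly_Mapping.keys g \<Longrightarrow> q powi \<beta> u v = q powi \<beta> v u"
  shows "f \<star> g = g \<star> f"
proof -
  have "f \<star> g = (\<Sum>v\<in>Poly_Mapping.keys g. \<Sum>u\<in>Poly_Mapping.keys f.
     Poly_Mapping.single (u + v) (Poly_Mapping.lookup f u * Poly_Mapping.lookup g v * q powi \<beta> u v))"
    unfolding tmult_def by (rule sum.swap)
  also have "\<dots> = g \<star> f"
    unfolding tmult_def using assms by (intro sum.cong refl) (simp add: algebra_simps)
  finally show ?thesis .
qed

text \<open>Multiplication by a monomial only translates and rescales the terms, so both sides can
  be compared at the single exponent \<open>u + v\<close>. This is the partial converse of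
  \<open>tmult_commute\<close> that determines the center.\<close>

lemma commutes_with_monomialD:
  assumes "f \<star> E v = E v \<star> f" "u \<in> Poly_Mapping.keys f"
  shows "q powi \<beta> u v = q powi \<beta> v u"
proof -
  have "Poly_Mapping.lookup (f \<star> E v) (u + v) = Poly_Mapping.lookup (E v \<star> f) (u + v)"
    using assms(1) by simp
  then show ?thesis
    using assms(2) by (simp add: lookup_tmult_single_left lookup_tmult_single_right in_keys_iff)
qed

definition torus_ring :: "('g \<Rightarrow>\<^sub>0 'k) ring" where
  "torus_ring = \<lparr>carrier = UNIV, monoid.mult = (\<star>), one = 1, zero = 0, add = (+)\<rparr>"

lemma torus_ring_simps [simp]:
  "carrier torus_ring = UNIV" "monoid.mult torus_ring = (\<star>)" "one torus_ring = 1"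
  "zero torus_ring = 0" "add torus_ring = (+)"
  by (simp_all add: torus_ring_def)

lemma torus_ring: "ring torus_ring"
proof (rule ringI)
  show "abelian_group torus_ring"
  proof (rule abelian_groupI)
    fix x :: "'g \<Rightarrow>\<^sub>0 'k"
    show "\<exists>y\<in>carrier torus_ring. y \<oplus>\<^bsub>torus_ring\<^esub> x = \<zero>\<^bsub>torus_ring\<^esub>"
      by (intro bexI[of _ "- x"]) simp_all
  qed (simp_all add: algebra_simps)
  show "Group.monoid torus_ring"
    by (rule Group.monoidI) (simp_all add: tmult_assoc)
qed (simp_all add: tmult_add_left tmult_add_right)

lemma torus_ring_finsum: "finite A \<Longrightarrow> finsum torus_ring f A = sum f A"
proof (induction A rule: finite_induct)
  case empty
  interpret ring torus_ring by (rule torus_ring)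
  show ?case by simp
next
  case (insert a A)
  interpret ring torus_ring by (rule torus_ring)
  show ?case using insert by (subst finsum_insert) auto
qed

lemma torus_ring_minus: "\<ominus>\<^bsub>torus_ring\<^esub> x = - x"
proof -
  interpret ring torus_ring by (rule torus_ring)
  show ?thesis by (rule minus_equality) simp_all
qed

end

section \<open>The standard identity in a quantum torus\<close>

definition standard_poly :: "nat \<Rightarrow> (nat fmon \<Rightarrow>\<^sub>0 int)" where
  "standard_poly m = (\<Sum>p | p permutes {..<m}. Poly_Mapping.single (Word (map p [0..<m])) (sign p))"

lemma permutes_word_inj: "inj_on (\<lambda>p. Word (map p [0..<m])) {p. p permutes {..<m}}"
proof (rule inj_onI)
  fix p p' :: "nat \<Rightarrow> nat"
  assume p: "p \<in> {p. p permutes {..<m}}" "p' \<in> {p. p permutes {..<m}}"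
    and eq: "Word (map p [0..<m]) = Word (map p' [0..<m])"
  have "p i = p' i" for i
  proof (cases "i < m")
    case True
    then show ?thesis using eq by simp
  next
    case False
    then show ?thesis using p by (metis lessThan_iff mem_Collect_eq permutes_not_in)
  qed
  then show "p = p'" by blast
qed

lemma lookup_standard_poly:
  assumes "p permutes {..<m}"
  shows "Poly_Mapping.lookup (standard_poly m) (Word (map p [0..<m])) = sign p"
proof -
  have "Poly_Mapping.lookup (standard_poly m) (Word (map p [0..<m]))
      = (\<Sum>p' | p' permutes {..<m}. if p' = p then sign p' else 0)"
    unfolding standard_poly_def lookup_sum
    using inj_onD[OF permutes_word_inj] assms
    by (intro sum.cong refl) (auto simp: lookup_single when_def)
  then show ?thesis using assms finite_permutations[of "{..<m}"] by simp
qed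

lemma sign_nonzero: "sign p \<noteq> 0"
  by (simp add: sign_def)

lemma keys_standard_poly:
  "Poly_Mapping.keys (standard_poly m) = (\<lambda>p. Word (map p [0..<m])) ` {p. p permutes {..<m}}"
proof
  show "Poly_Mapping.keys (standard_poly m) \<subseteq> (\<lambda>p. Word (map p [0..<m])) ` {p. p permutes {..<m}}"
  proof
    fix w assume w: "w \<in> Poly_Mapping.keys (standard_poly m)"
    have "w \<in> (\<Union>p\<in>{p. p permutes {..<m}}. Poly_Mapping.keys (Poly_Mapping.single (Word (map p [0..<m])) (sign p)))"
      using w unfolding standard_poly_def by (rule subsetD[OF keys_sum])
    then show "w \<in> (\<lambda>p. Word (map p [0..<m])) ` {p. p permutes {..<m}}"
      by (auto split: if_splits)
  qed
qed (auto simp: in_keys_iff lookup_standard_poly sign_nonzero)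

lemma monic_standard_poly: "monic_ncpoly (standard_poly m)"
  unfolding monic_ncpoly_def
proof (intro exI conjI ballI)
  show "Poly_Mapping.lookup (standard_poly m) (Word (map id [0..<m])) = 1"
    using lookup_standard_poly[OF permutes_id] by simp
qed (auto simp: keys_standard_poly)

context quantum_torus
begin

definition tprod :: "('g \<Rightarrow>\<^sub>0 'k) list \<Rightarrow> ('g \<Rightarrow>\<^sub>0 'k)" where
  "tprod xs = foldr (\<star>) xs 1"

lemma tprod_simps [simp]: "tprod [] = 1" "tprod (x # xs) = x \<star> tprod xs"
  by (simp_all add: tprod_def)

lemma tprod_append: "tprod (xs @ ys) = tprod xs \<star> tprod ys"
  by (induction xs) (simp_all add: tmult_assoc)

lemma tprod_commute:
  assumes "\<And>x. x \<in> set xs \<Longrightarrow> y \<star> x = x \<star> y"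
  shows "y \<star> tprod xs = tprod xs \<star> y"
  using assms
proof (induction xs)
  case (Cons x xs)
  have "y \<star> (x \<star> tprod xs) = x \<star> (y \<star> tprod xs)"
    using Cons.prems[of x] by (simp flip: tmult_assoc)
  then show ?case using Cons by (simp add: tmult_assoc)
qed simp

lemma tprod_mset_cong:
  assumes "\<And>x y. x \<in> set xs \<Longrightarrow> y \<in> set xs \<Longrightarrow> x \<star> y = y \<star> x" "mset xs = mset ys"
  shows "tprod xs = tprod ys"
  using assms
proof (induction xs arbitrary: ys)
  case (Cons x xs)
  have "x \<in> set ys" using Cons.prems(2) by (metis list.set_intros(1) set_mset_mset)
  then obtain y1 y2 where ys: "ys = y1 @ x # y2" by (meson split_list)
  have m: "mset xs = mset (y1 @ y2)" using Cons.prems(2) ys by simp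
  have s: "set xs = set (y1 @ y2)" by (rule mset_eq_setD[OF m])
  have "tprod ys = x \<star> tprod (y1 @ y2)"
  proof -
    have "x \<star> tprod y1 = tprod y1 \<star> x"
      by (rule tprod_commute) (use Cons.prems(1) s in auto)
    then show ?thesis unfolding ys by (simp add: tprod_append flip: tmult_assoc)
  qed
  moreover have "tprod xs = tprod (y1 @ y2)" using Cons.IH[OF _ m] Cons.prems(1) by simp
  ultimately show ?case by simp
qed simp

lemma tprod_map_tmult:
  assumes "\<And>i j. i \<in> set is \<Longrightarrow> j \<in> set is \<Longrightarrow> Z i \<star> y j = y j \<star> Z i"
  shows "tprod (map (\<lambda>i. Z i \<star> y i) is) = tprod (map Z is) \<star> tprod (map y is)"
  using assms
proof (induction "is")
  case (Cons a "is")
  have "y a \<star> tprod (map Z is) = tprod (map Z is) \<star> y a"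
    by (rule tprod_commute) (use Cons.prems in auto)
  then have "y a \<star> (tprod (map Z is) \<star> tprod (map y is)) = tprod (map Z is) \<star> (y a \<star> tprod (map y is))"
    by (simp flip: tmult_assoc)
  moreover have "tprod (map (\<lambda>i. Z i \<star> y i) is) = tprod (map Z is) \<star> tprod (map y is)"
    by (rule Cons.IH) (use Cons.prems in auto)
  ultimately show ?case by (simp add: tmult_assoc)
qed simp

text \<open>Each index occurs exactly once in the word of a permutation, so its product is linear in
  every single argument.\<close>

lemma tprod_slot:
  assumes "distinct is" "k \<in> set is"
  shows "\<exists>A B. \<forall>z. tprod (map (f(k := z)) is) = A \<star> (z \<star> B)"
proof -
  obtain i1 i2 where i: "is = i1 @ k # i2" using assms(2) by (meson split_list)
  have k: "k \<notin> set i1" "k \<notin> set i2" using assms(1) i by auto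
  have "map (f(k := z)) is = map f i1 @ z # map f i2" for z
    unfolding i using k by simp
  then have "\<forall>z. tprod (map (f(k := z)) is) = tprod (map f i1) \<star> (z \<star> tprod (map f i2))"
    by (simp add: tprod_append)
  then show ?thesis by blast
qed

text \<open>The value of \<open>standard_poly m\<close> at \<open>f\<close>, as
  \<open>eval_poly_standard\<close> confirms.\<close>

definition alternating :: "nat \<Rightarrow> (nat \<Rightarrow> ('g \<Rightarrow>\<^sub>0 'k)) \<Rightarrow> ('g \<Rightarrow>\<^sub>0 'k)" where
  "alternating m f = (\<Sum>p | p permutes {..<m}.
     if evenperm p then tprod (map f (map p [0..<m])) else - tprod (map f (map p [0..<m])))"

lemma alternating_cong:
  assumes "\<And>i. i < m \<Longrightarrow> f i = g i"
  shows "alternating m f = alternating m g"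
proof -
  have "map f (map p [0..<m]) = map g (map p [0..<m])" if "p permutes {..<m}" for p
    using permutes_in_image[OF that] assms by auto
  then show ?thesis unfolding alternating_def by (intro sum.cong refl) (simp del: map_map map_eq_conv)
qed

lemma alternating_add:
  assumes "k < m"
  shows "alternating m (f(k := x + y)) = alternating m (f(k := x)) + alternating m (f(k := y))"
proof -
  have "tprod (map (f(k := x + y)) (map p [0..<m])) =
      tprod (map (f(k := x)) (map p [0..<m])) + tprod (map (f(k := y)) (map p [0..<m]))"
    if "p permutes {..<m}" for p
  proof -
    have "distinct (map p [0..<m])"
      using permutes_inj_on[OF that] by (simp add: distinct_map)
    moreover have "k \<in> set (map p [0..<m])"
      using permutes_image[OF that] assms by (auto simp: atLeast0LessThan)
    ultimately obtain A B where "\<forall>z. tprod (map (f(k := z)) (map p [0..<m])) = A \<star> (z \<star> B)"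
      using tprod_slot[of "map p [0..<m]" k f] by blast
    then show ?thesis by (simp only: tmult_add_left tmult_add_right)
  qed
  then show ?thesis
    unfolding alternating_def sum.distrib[symmetric] by (intro sum.cong refl) simp
qed

lemma alternating_zero:
  assumes "k < m"
  shows "alternating m (f(k := 0)) = 0"
  using alternating_add[OF assms, of f 0 0] unfolding add_0_left by (metis add_cancel_right_left)

lemma alternating_sum:
  assumes "k < m" "finite A"
  shows "alternating m (f(k := sum g A)) = (\<Sum>a\<in>A. alternating m (f(k := g a)))"
  using assms(2)
proof induction
  case empty
  show ?case unfolding sum.empty by (rule alternating_zero[OF assms(1)])
next
  case (insert a A)
  show ?case unfolding sum.insert[OF insert(1,2)] alternating_add[OF assms(1)] insert(3) ..
qed

text \<open>Composition with the transposition of \<open>a\<close> and \<open>b\<close> matches odd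
  with even permutations that have the same product. Cancelling matched terms, instead of deriving
  that twice the sum vanishes, is also valid in characteristic 2.\<close>

lemma alternating_repeated:
  assumes ab: "a < m" "b < m" "a \<noteq> b" and eq: "f a = f b"
  shows "alternating m f = 0"
proof -
  define t where "t = (\<lambda>p. tprod (map f (map p [0..<m])))"
  define P where "P = {p. p permutes {..<m}}"
  have fin: "finite P" unfolding P_def by (rule finite_permutations) simp
  let ?\<tau> = "transpose a b"
  have tau: "?\<tau> permutes {..<m}" using ab by (intro permutes_swap_id) auto
  have tt: "t (?\<tau> \<circ> p) = t p" for p
  proof -
    have "f \<circ> (?\<tau> \<circ> p) = f \<circ> p" using eq by (auto simp: fun_eq_iff transpose_def)
    then show ?thesis by (simp add: t_def)
  qed
  have ev: "evenperm (?\<tau> \<circ> p) \<longleftrightarrow> \<not> evenperm p" if "p \<in> P" for p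
    using that ab(3) permutes_imp_permutation[of "{..<m}" p] permutation_swap_id[of a b]
    by (simp add: P_def evenperm_comp evenperm_swap)
  have "(\<Sum>p\<in>P \<inter> - {p. evenperm p}. t p) = (\<Sum>p\<in>P \<inter> {p. evenperm p}. t (?\<tau> \<circ> p))"
  proof (rule sum.reindex_bij_witness[where i = "\<lambda>p. ?\<tau> \<circ> p" and j = "\<lambda>p. ?\<tau> \<circ> p"])
    have c: "?\<tau> \<circ> (?\<tau> \<circ> p) = p" for p :: "nat \<Rightarrow> nat" by (simp add: fun_eq_iff)
    have "?\<tau> \<circ> p \<in> P" if "p \<in> P" for p
      using that permutes_compose[OF _ tau] by (simp add: P_def)
    then have m: "p \<in> P \<Longrightarrow> ?\<tau> \<circ> p \<in> P \<and> (evenperm (?\<tau> \<circ> p) \<longleftrightarrow> \<not> evenperm p)" for p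
      using ev by blast
    show "?\<tau> \<circ> (?\<tau> \<circ> p) = p" if "p \<in> P \<inter> - {p. evenperm p}" for p by (rule c)
    show "?\<tau> \<circ> p \<in> P \<inter> {p. evenperm p}" if "p \<in> P \<inter> - {p. evenperm p}" for p
      using that m[of p] by blast
    show "?\<tau> \<circ> (?\<tau> \<circ> p) = p" if "p \<in> P \<inter> {p. evenperm p}" for p by (rule c)
    show "?\<tau> \<circ> p \<in> P \<inter> - {p. evenperm p}" if "p \<in> P \<inter> {p. evenperm p}" for p
      using that m[of p] by blast
    show "t (?\<tau> \<circ> (?\<tau> \<circ> p)) = t p" for p by (simp only: c)
  qed
  then have "(\<Sum>p\<in>P. if evenperm p then t p else - t p) = 0"
    unfolding sum.If_cases[OF fin] by (simp add: tt sum_negf)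
  then show ?thesis unfolding alternating_def t_def P_def .
qed

text \<open>The factors \<open>Z i\<close> can be moved to the front of every word and, since they
  commute with each other, reordered there. The prefactor is thus the same for all
  permutations.\<close>

lemma alternating_central_factors:
  assumes "\<And>i j. i < m \<Longrightarrow> j < m \<Longrightarrow> Z i \<star> y j = y j \<star> Z i"
    and "\<And>i j. i < m \<Longrightarrow> j < m \<Longrightarrow> Z i \<star> Z j = Z j \<star> Z i"
  shows "alternating m (\<lambda>i. Z i \<star> y i) = tprod (map Z [0..<m]) \<star> alternating m y"
proof -
  have "tprod (map (\<lambda>i. Z i \<star> y i) (map p [0..<m])) = tprod (map Z [0..<m]) \<star> tprod (map y (map p [0..<m]))"
    if p: "p permutes {..<m}" for p
  proof -
    have lt: "p i < m" if "i < m" for i using permutes_in_image[OF p, of i] that by simp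
    have "tprod (map (\<lambda>i. Z i \<star> y i) (map p [0..<m])) = tprod (map Z (map p [0..<m])) \<star> tprod (map y (map p [0..<m]))"
      by (rule tprod_map_tmult) (use assms(1) lt in auto)
    moreover have "tprod (map Z [0..<m]) = tprod (map Z (map p [0..<m]))"
    proof (rule tprod_mset_cong)
      have "mset (map p [0..<m]) = mset [0..<m]"
        using permutes_image_mset[OF p] by (simp add: atLeast0LessThan)
      then show "mset (map Z [0..<m]) = mset (map Z (map p [0..<m]))" by (simp only: mset_map)
    qed (use assms(2) in auto)
    ultimately show ?thesis by simp
  qed
  then show ?thesis
    unfolding alternating_def tmult_sum by (intro sum.cong refl) (simp add: tmult_minus)
qed

text \<open>By multilinearity it suffices to insert monomials. There are more of them than classes,
  so two share a class and differ by a monomial that commutes with everything supported on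
  \<open>K\<close>. Once this is factored out, two arguments agree and the alternating sum
  vanishes.\<close>

lemma standard_identity:
  assumes K: "\<And>u v. u \<in> K \<Longrightarrow> v \<in> K \<Longrightarrow> u - v \<in> K" "0 \<in> K"
    and cl: "finite (cl ` K)" "card (cl ` K) < m"
    and cen: "\<And>u v x. u \<in> K \<Longrightarrow> v \<in> K \<Longrightarrow> x \<in> K \<Longrightarrow> cl u = cl v \<Longrightarrow> q powi \<beta> (u - v) x = q powi \<beta> x (u - v)"
    and f: "\<And>i. i < m \<Longrightarrow> Poly_Mapping.keys (f i) \<subseteq> K"
  shows "alternating m f = 0"
proof -
  have monomial: "alternating m f = 0"
    if f: "\<And>i. i < m \<Longrightarrow> \<exists>u\<in>K. \<exists>c. f i = Poly_Mapping.single u c" for f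
  proof -
    have "\<forall>i\<in>{..<m}. \<exists>u c. u \<in> K \<and> f i = Poly_Mapping.single u c"
    proof
      fix i assume "i \<in> {..<m}"
      then have "i < m" by simp
      from f[OF this] show "\<exists>u c. u \<in> K \<and> f i = Poly_Mapping.single u c" by (elim bexE exE) (intro exI conjI)
    qed
    from bchoice[OF this] obtain u
      where "\<forall>i\<in>{..<m}. \<exists>c. u i \<in> K \<and> f i = Poly_Mapping.single (u i) c" by (rule exE)
    from bchoice[OF this] obtain c
      where "\<forall>i\<in>{..<m}. u i \<in> K \<and> f i = Poly_Mapping.single (u i) (c i)" by (rule exE)
    then have u: "\<And>i. i < m \<Longrightarrow> u i \<in> K" "\<And>i. i < m \<Longrightarrow> f i = Poly_Mapping.single (u i) (c i)"
      by simp_all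
    have "\<not> inj_on (\<lambda>i. cl (u i)) {..<m}"
    proof
      assume "inj_on (\<lambda>i. cl (u i)) {..<m}"
      then have "card ((\<lambda>i. cl (u i)) ` {..<m}) = m" by (simp add: card_image)
      have "(\<lambda>i. cl (u i)) ` {..<m} \<subseteq> cl ` K" using u(1) by blast
      from card_mono[OF cl(1) this] show False
        using cl(2) \<open>card ((\<lambda>i. cl (u i)) ` {..<m}) = m\<close> by linarith
    qed
    then obtain a b where ab: "a < m" "b < m" "a \<noteq> b" "cl (u a) = cl (u b)"
      unfolding inj_on_def by auto
    \<comment> \<open>The argument \<open>a\<close> receives the exponent of the argument
      \<open>b\<close>. \<open>Z i\<close> carries the difference, so it is a scalar for
      \<open>i \<noteq> a\<close>; its power of \<open>q\<close> undoes the twist of the product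
      \<open>Z i \<star> E (v i)\<close>.\<close>
    define v where "v = u(a := u b)"
    define Z where "Z = (\<lambda>i. Poly_Mapping.single (u i - v i) (c i * q powi - \<beta> (u i - v i) (v i)))"
    have v: "v i \<in> K" "u i - v i \<in> K" "u i - v i = 0 \<or> u i - v i = u a - u b" if "i < m" for i
      using that ab u(1) K by (auto simp: v_def)
    have c: "q powi \<beta> (u i - v i) x = q powi \<beta> x (u i - v i)" if "i < m" "x \<in> K" for i x
      using v(3)[OF that(1)] cen[OF u(1)[OF ab(1)] u(1)[OF ab(2)] that(2) ab(4)] by auto
    have "f i = Z i \<star> E (v i)" if "i < m" for i
      using u(2)[OF that] by (simp add: Z_def tmult_single power_int_minus mult.assoc)
    then have "alternating m f = alternating m (\<lambda>i. Z i \<star> E (v i))"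
      by (rule alternating_cong)
    also have "\<dots> = tprod (map Z [0..<m]) \<star> alternating m (\<lambda>i. E (v i))"
    proof (rule alternating_central_factors)
      fix i j assume ij: "i < m" "j < m"
      show "Z i \<star> E (v j) = E (v j) \<star> Z i"
        by (rule tmult_commute) (use c[OF ij(1)] v(1)[OF ij(2)] in \<open>auto simp: Z_def split: if_splits\<close>)
      show "Z i \<star> Z j = Z j \<star> Z i"
        by (rule tmult_commute) (use c[OF ij(1)] v(2)[OF ij(2)] in \<open>auto simp: Z_def split: if_splits\<close>)
    qed
    also have "alternating m (\<lambda>i. E (v i)) = 0"
      by (rule alternating_repeated[OF ab(1-3)]) (simp add: v_def ab(3))
    finally show ?thesis by simp
  qed
  \<comment> \<open>Induction on the number \<open>k\<close> of leading arguments that may still be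
    general: the last of them is expanded into its terms.\<close>
  have "alternating m f = 0" if "k \<le> m" "\<And>i. i < m \<Longrightarrow> Poly_Mapping.keys (f i) \<subseteq> K"
    "\<And>i. k \<le> i \<Longrightarrow> i < m \<Longrightarrow> \<exists>u\<in>K. \<exists>c. f i = Poly_Mapping.single u c" for k f
    using that
  proof (induction k arbitrary: f)
    case 0
    then show ?case using monomial by simp
  next
    case (Suc k)
    have k: "k < m" using Suc.prems(1) by simp
    have "alternating m (f(k := Poly_Mapping.single u (Poly_Mapping.lookup (f k) u))) = 0"
      if "u \<in> Poly_Mapping.keys (f k)" for u
    proof (rule Suc.IH)
      have uK: "u \<in> K" using that Suc.prems(2)[OF k] by auto
      show "k \<le> m" using k by simp
      show "Poly_Mapping.keys ((f(k := Poly_Mapping.single u (Poly_Mapping.lookup (f k) u))) i) \<subseteq> K" if "i < m" for i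
        using Suc.prems(2)[OF that] uK by auto
      show "\<exists>u'\<in>K. \<exists>c. (f(k := Poly_Mapping.single u (Poly_Mapping.lookup (f k) u))) i = Poly_Mapping.single u' c"
        if "k \<le> i" "i < m" for i
        using Suc.prems(3)[of i] that uK by (cases "i = k") auto
    qed
    then have "alternating m (f(k := \<Sum>u\<in>Poly_Mapping.keys (f k). Poly_Mapping.single u (Poly_Mapping.lookup (f k) u))) = 0"
      unfolding alternating_sum[OF k finite_keys] by (intro sum.neutral) blast
    then show ?case by (simp add: sum_single_keys)
  qed
  from this[of m f] f show ?thesis by simp
qed

lemma eval_poly_standard: "eval_poly torus_ring \<rho> (standard_poly m) = alternating m \<rho>"
proof -
  interpret R: ring torus_ring by (rule torus_ring)
  have w: "eval_word torus_ring \<rho> (Word xs) = tprod (map \<rho> xs)" for xs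
    by (induction xs) (simp_all add: eval_word_def)
  have "eval_poly torus_ring \<rho> (standard_poly m) =
    (\<Sum>w\<in>Poly_Mapping.keys (standard_poly m). [Poly_Mapping.lookup (standard_poly m) w] \<cdot>\<^bsub>torus_ring\<^esub> eval_word torus_ring \<rho> w)"
    unfolding eval_poly_def by (rule torus_ring_finsum) simp
  also have "\<dots> = (\<Sum>p | p permutes {..<m}. [sign p] \<cdot>\<^bsub>torus_ring\<^esub> tprod (map \<rho> (map p [0..<m])))"
    unfolding keys_standard_poly
    by (subst sum.reindex[OF permutes_word_inj])
      (auto intro!: sum.cong simp: lookup_standard_poly w simp del: map_map)
  also have "\<dots> = alternating m \<rho>"
    unfolding alternating_def
  proof (intro sum.cong refl)
    fix p
    have "add_pow torus_ring (1::int) x = x" for x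
      using R.add.int_pow_1 by simp
    moreover have "add_pow torus_ring (- 1::int) x = - x" for x
      using R.add.int_pow_neg[of x 1] R.add.int_pow_1[of x] torus_ring_minus by simp
    ultimately show "[sign p] \<cdot>\<^bsub>torus_ring\<^esub> tprod (map \<rho> (map p [0..<m])) =
      (if evenperm p then tprod (map \<rho> (map p [0..<m])) else - tprod (map \<rho> (map p [0..<m])))"
      by (simp add: sign_def)
  qed
  finally show ?thesis .
qed

end

text \<open>Serves to pull a polynomial identity of the torus back along an injective
  homomorphism.\<close>

lemma hom_eval_poly:
  assumes "ring R" "ring S" "h \<in> ring_hom R S" "range \<rho> \<subseteq> carrier R"
  shows "eval_poly R \<rho> f \<in> carrier R \<and> h (eval_poly R \<rho> f) = eval_poly S (h \<circ> \<rho>) f"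
proof -
  interpret h: ring_hom_ring R S h using assms by (intro ring_hom_ringI2)
  have w: "eval_word R \<rho> v \<in> carrier R \<and> h (eval_word R \<rho> v) = eval_word S (h \<circ> \<rho>) v" for v
  proof -
    have "foldr (\<lambda>i a. \<rho> i \<otimes>\<^bsub>R\<^esub> a) xs \<one>\<^bsub>R\<^esub> \<in> carrier R \<and>
      h (foldr (\<lambda>i a. \<rho> i \<otimes>\<^bsub>R\<^esub> a) xs \<one>\<^bsub>R\<^esub>) = foldr (\<lambda>i a. (h \<circ> \<rho>) i \<otimes>\<^bsub>S\<^esub> a) xs \<one>\<^bsub>S\<^esub>" for xs
    proof (induction xs)
      case (Cons a xs)
      have "\<rho> a \<in> carrier R" using assms(4) by auto
      then show ?case using Cons by simp
    qed simp
    then show ?thesis by (simp add: eval_word_def)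
  qed
  have t: "[k] \<cdot>\<^bsub>R\<^esub> x \<in> carrier R \<and> h ([k] \<cdot>\<^bsub>R\<^esub> x) = [k] \<cdot>\<^bsub>S\<^esub> h x" if "x \<in> carrier R" for k :: int and x
    using that group_hom.hom_int_pow[OF h.a_group_hom, of x k] h.R.add.int_pow_closed[of x k]
    by (simp add: add_pow_def)
  let ?g = "\<lambda>w. [Poly_Mapping.lookup f w] \<cdot>\<^bsub>R\<^esub> eval_word R \<rho> w"
  have "?g w \<in> carrier R" for w
    using t w by blast
  then have g: "?g \<in> A \<rightarrow> carrier R" for A
    by blast
  have "h \<circ> ?g = (\<lambda>w. [Poly_Mapping.lookup f w] \<cdot>\<^bsub>S\<^esub> eval_word S (h \<circ> \<rho>) w)"
  proof
    fix v
    have "h (?g v) = [Poly_Mapping.lookup f v] \<cdot>\<^bsub>S\<^esub> h (eval_word R \<rho> v)"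
      using t[OF conjunct1[OF w[of v]]] by blast
    then show "(h \<circ> ?g) v = [Poly_Mapping.lookup f v] \<cdot>\<^bsub>S\<^esub> eval_word S (h \<circ> \<rho>) v"
      unfolding conjunct2[OF w[of v]] o_apply .
  qed
  then show ?thesis
    unfolding eval_poly_def using h.hom_finsum[OF g] h.R.finsum_closed[OF g] by simp
qed

section \<open>Ideals of the free algebra\<close>

lemma plus_fmon_simps [simp]: "Word xs + Word ys = Word (xs @ ys)" "letters (u + v) = letters u @ letters v" "letters 0 = []"
  by (simp_all add: plus_fmon_def zero_fmon_def)

lemma free_algebra_simps [simp]:
  "monoid.mult (free_algebra G) = (*)" "one (free_algebra G) = 1"
  "zero (free_algebra G) = 0" "add (free_algebra G) = (+)"
  "f \<in> carrier (free_algebra G) \<longleftrightarrow> (\<forall>w \<in> Poly_Mapping.keys f. set (letters w) \<subseteq> G)"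
  by (simp_all add: free_algebra_def)

lemma free_algebra_ring: "ring (free_algebra G :: ('a fmon \<Rightarrow>\<^sub>0 'k::ring_1) ring)"
proof (rule ringI)
  show "abelian_group (free_algebra G :: ('a fmon \<Rightarrow>\<^sub>0 'k) ring)"
  proof (rule abelian_groupI)
    fix x y :: "'a fmon \<Rightarrow>\<^sub>0 'k"
    assume x: "x \<in> carrier (free_algebra G)" and y: "y \<in> carrier (free_algebra G)"
    show "x \<oplus>\<^bsub>free_algebra G\<^esub> y \<in> carrier (free_algebra G)"
      using x y keys_add[of x y] by fastforce
    show "\<exists>y\<in>carrier (free_algebra G). y \<oplus>\<^bsub>free_algebra G\<^esub> x = \<zero>\<^bsub>free_algebra G\<^esub>"
      using x by (intro bexI[of _ "- x"]) (auto simp: in_keys_iff)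
  qed (simp_all add: algebra_simps)
  show "Group.monoid (free_algebra G :: ('a fmon \<Rightarrow>\<^sub>0 'k) ring)"
  proof (rule Group.monoidI)
    fix x y :: "'a fmon \<Rightarrow>\<^sub>0 'k"
    assume x: "x \<in> carrier (free_algebra G)" and y: "y \<in> carrier (free_algebra G)"
    show "x \<otimes>\<^bsub>free_algebra G\<^esub> y \<in> carrier (free_algebra G)"
      using x y keys_mult[of x y] by fastforce
  qed (simp_all add: mult.assoc)
qed (simp_all add: algebra_simps)

abbreviation word :: "'a list \<Rightarrow> ('a fmon \<Rightarrow>\<^sub>0 'k::ring_1)" where
  "word xs \<equiv> Poly_Mapping.single (Word xs) 1"

lemma scalar_times_single: "scalar c * Poly_Mapping.single w a = Poly_Mapping.single w (c * a)"
  by (simp add: scalar_def mult_single)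

lemma scalar_mult: "scalar a * scalar b = scalar (a * b)"
  by (simp add: scalar_def mult_single)

lemma scalar_one: "scalar 1 = 1"
  by (simp add: scalar_def)

lemma scalar_commute: "f * scalar c = scalar (c :: 'k :: comm_ring_1) * f"
  by (induction f rule: poly_mapping_single_induct)
    (simp_all add: distrib_left distrib_right scalar_def mult_single mult.commute)

lemma word_times_word: "word xs * word ys = word (xs @ ys)"
  by (simp add: mult_single)

lemma var_times_var: "var a * var b = word [a, b]"
  by (simp add: var_def mult_single)

context quantum_torus
begin

definition lift :: "('a \<Rightarrow> ('g \<Rightarrow>\<^sub>0 'k)) \<Rightarrow> ('a fmon \<Rightarrow>\<^sub>0 'k) \<Rightarrow> ('g \<Rightarrow>\<^sub>0 'k)" where
  "lift g f = (\<Sum>w\<in>Poly_Mapping.keys f.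
     Poly_Mapping.single 0 (Poly_Mapping.lookup f w) \<star> tprod (map g (letters w)))"

lemma lift_superset:
  assumes "finite W" "Poly_Mapping.keys f \<subseteq> W"
  shows "lift g f = (\<Sum>w\<in>W. Poly_Mapping.single 0 (Poly_Mapping.lookup f w) \<star> tprod (map g (letters w)))"
  unfolding lift_def using assms by (intro sum.mono_neutral_left) (auto simp: in_keys_iff)

lemma lift_add: "lift g (f + f') = lift g f + lift g f'"
proof -
  let ?W = "Poly_Mapping.keys f \<union> Poly_Mapping.keys f'"
  have "Poly_Mapping.keys (f + f') \<subseteq> ?W" by (rule keys_add)
  then show ?thesis
    by (subst (1 2 3) lift_superset[where W = ?W])
      (auto simp: lookup_add single_add tmult_add_left sum.distrib)
qed

lemma lift_zero [simp]: "lift g 0 = 0"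
  by (simp add: lift_def)

lemma lift_minus: "lift g (- f) = - lift g f"
  using lift_add[of g f "- f"] by (simp add: eq_neg_iff_add_eq_0 add.commute)

lemma lift_diff: "lift g (f - f') = lift g f - lift g f'"
  using lift_add[of g f "- f'"] by (simp add: lift_minus)

lemma lift_sum: "lift g (sum f A) = (\<Sum>a\<in>A. lift g (f a))"
  by (induction A rule: infinite_finite_induct) (simp_all add: lift_add)

lemma lift_single: "lift g (Poly_Mapping.single w c) = Poly_Mapping.single 0 c \<star> tprod (map g (letters w))"
  by (subst lift_superset[of "{w}"]) auto

lemma lift_var: "lift g (var a) = g a"
  by (simp add: var_def lift_single)

lemma lift_scalar: "lift g (scalar c) = Poly_Mapping.single 0 c"
  by (simp add: scalar_def lift_single)

lemma lift_mult: "lift g (f * h) = lift g f \<star> lift g h"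
proof (induction f rule: poly_mapping_single_induct)
  case (add w a f)
  have "lift g (Poly_Mapping.single w a * h) = lift g (Poly_Mapping.single w a) \<star> lift g h"
  proof (induction h rule: poly_mapping_single_induct)
    case (add v b h)
    have "Poly_Mapping.single 0 a \<star> (tprod (map g (letters w)) \<star> (Poly_Mapping.single 0 b \<star> tprod (map g (letters v))))
      = Poly_Mapping.single 0 a \<star> ((tprod (map g (letters w)) \<star> Poly_Mapping.single 0 b) \<star> tprod (map g (letters v)))"
      by (simp add: tmult_assoc)
    also have "\<dots> = (Poly_Mapping.single 0 a \<star> Poly_Mapping.single 0 b) \<star> (tprod (map g (letters w)) \<star> tprod (map g (letters v)))"
      unfolding tmult_scalar_right[of "tprod (map g (letters w))" b] by (simp add: tmult_assoc)
    finally have "lift g (Poly_Mapping.single w a * Poly_Mapping.single v b)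
      = lift g (Poly_Mapping.single w a) \<star> lift g (Poly_Mapping.single v b)"
      by (simp add: mult_single lift_single tprod_append tmult_assoc tmult_single)
    then show ?case using add by (simp add: distrib_left lift_add tmult_add_right)
  qed simp
  then show ?case using add by (simp add: distrib_right lift_add tmult_add_left)
qed simp

lemma lift_ring_hom: "lift g \<in> ring_hom (free_algebra G) torus_ring"
proof (rule ring_hom_memI)
  have "lift g 1 = 1" unfolding scalar_one[symmetric] lift_scalar by simp
  then show "lift g \<one>\<^bsub>free_algebra G\<^esub> = \<one>\<^bsub>torus_ring\<^esub>" by simp
qed (simp_all add: lift_mult lift_add)

text \<open>Reduces a q-commutation relation between sums of monomials to the constancy of the
  commutation form on their supports.\<close>

lemma tmult_quasi_commute:
  assumes "\<And>u v. u \<in> Poly_Mapping.keys f \<Longrightarrow> v \<in> Poly_Mapping.keys g \<Longrightarrow> \<beta> u v - \<beta> v u = k"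
  shows "f \<star> g = Poly_Mapping.single 0 (q powi k) \<star> (g \<star> f)"
proof -
  have "f \<star> g = (\<Sum>v\<in>Poly_Mapping.keys g. \<Sum>u\<in>Poly_Mapping.keys f.
     Poly_Mapping.single (u + v) (Poly_Mapping.lookup f u * Poly_Mapping.lookup g v * q powi \<beta> u v))"
    unfolding tmult_def by (rule sum.swap)
  also have "\<dots> = (\<Sum>v\<in>Poly_Mapping.keys g. \<Sum>u\<in>Poly_Mapping.keys f. Poly_Mapping.single 0 (q powi k) \<star>
     Poly_Mapping.single (v + u) (Poly_Mapping.lookup g v * Poly_Mapping.lookup f u * q powi \<beta> v u))"
  proof (intro sum.cong refl)
    fix u v assume "v \<in> Poly_Mapping.keys g" "u \<in> Poly_Mapping.keys f"
    then have "\<beta> u v = k + \<beta> v u" using assms by fastforce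
    then have "q powi \<beta> u v = q powi k * q powi \<beta> v u" by (simp add: power_int_add)
    then show "Poly_Mapping.single (u + v) (Poly_Mapping.lookup f u * Poly_Mapping.lookup g v * q powi \<beta> u v) =
      Poly_Mapping.single 0 (q powi k) \<star>
      Poly_Mapping.single (v + u) (Poly_Mapping.lookup g v * Poly_Mapping.lookup f u * q powi \<beta> v u)"
      by (simp add: tmult_single add.commute mult.commute mult.left_commute)
  qed
  also have "\<dots> = Poly_Mapping.single 0 (q powi k) \<star> (g \<star> f)"
    unfolding tmult_def[of g f] tmult_sum ..
  finally show ?thesis .
qed

end

lemma sum_single_mult_left:
  "f * g = (\<Sum>w\<in>Poly_Mapping.keys g. scalar (Poly_Mapping.lookup g w) * (f * Poly_Mapping.single w (1 :: 'k :: comm_ring_1)))"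
proof -
  have "f * g = (\<Sum>w\<in>Poly_Mapping.keys g. f * (scalar (Poly_Mapping.lookup g w) * Poly_Mapping.single w 1))"
    unfolding sum_distrib_left[symmetric] by (simp add: scalar_times_single sum_single_keys)
  then show ?thesis by (simp add: mult.assoc[symmetric] scalar_commute)
qed

section \<open>Spanning and reordering words modulo an ideal\<close>

locale free_ideal =
  fixes G :: "'a set" and I :: "('a fmon \<Rightarrow>\<^sub>0 'k::field) set"
  assumes ideal: "ideal I (free_algebra G)"
begin

abbreviation FA where "FA \<equiv> carrier (free_algebra G :: ('a fmon \<Rightarrow>\<^sub>0 'k) ring)"

lemma FA_closed:
  "f \<in> FA \<Longrightarrow> g \<in> FA \<Longrightarrow> f + g \<in> FA" "f \<in> FA \<Longrightarrow> g \<in> FA \<Longrightarrow> f * g \<in> FA"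
  "f \<in> FA \<Longrightarrow> - f \<in> FA" "f \<in> FA \<Longrightarrow> g \<in> FA \<Longrightarrow> f - g \<in> FA" "scalar c \<in> FA"
  "set xs \<subseteq> G \<Longrightarrow> Poly_Mapping.single (Word xs) c \<in> FA" "0 \<in> FA"
proof -
  interpret R: ring "free_algebra G :: ('a fmon \<Rightarrow>\<^sub>0 'k) ring" by (rule free_algebra_ring)
  show a: "f \<in> FA \<Longrightarrow> g \<in> FA \<Longrightarrow> f + g \<in> FA" for f g using R.a_closed[of f g] by (simp only: free_algebra_simps(4))
  show "f \<in> FA \<Longrightarrow> g \<in> FA \<Longrightarrow> f * g \<in> FA" using R.m_closed[of f g] by (simp only: free_algebra_simps(1))
  show m: "f \<in> FA \<Longrightarrow> - f \<in> FA" for f by (auto simp: in_keys_iff)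
  show "f \<in> FA \<Longrightarrow> g \<in> FA \<Longrightarrow> f - g \<in> FA" using a[OF _ m, of f g] by (simp only: diff_conv_add_uminus)
  show "scalar c \<in> FA" by (auto simp: scalar_def)
qed auto

lemma I_zero: "0 \<in> I"
  using additive_subgroup.zero_closed[OF ideal.axioms(1)[OF ideal]] by simp

lemma I_add: "f \<in> I \<Longrightarrow> g \<in> I \<Longrightarrow> f + g \<in> I"
  using additive_subgroup.a_closed[OF ideal.axioms(1)[OF ideal], of f g] by simp

lemma I_mult: "f \<in> I \<Longrightarrow> g \<in> FA \<Longrightarrow> g * f \<in> I" "f \<in> I \<Longrightarrow> g \<in> FA \<Longrightarrow> f * g \<in> I"
  using ideal.I_l_closed[OF ideal, of f g] ideal.I_r_closed[OF ideal, of f g] by (simp_all del: free_algebra_simps(5))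

lemma I_scalar: "f \<in> I \<Longrightarrow> scalar c * f \<in> I"
  using I_mult(1) FA_closed(5) by blast

definition spanned_by :: "'a fmon set \<Rightarrow> ('a fmon \<Rightarrow>\<^sub>0 'k) set" where
  "spanned_by W = {f. \<exists>g. Poly_Mapping.keys g \<subseteq> W \<and> f - g \<in> I}"

lemma spanned_byI: "Poly_Mapping.keys g \<subseteq> W \<Longrightarrow> f - g \<in> I \<Longrightarrow> f \<in> spanned_by W"
  unfolding spanned_by_def by blast

lemma spanned_by_word: "w \<in> W \<Longrightarrow> Poly_Mapping.single w c \<in> spanned_by W"
  by (rule spanned_byI[of "Poly_Mapping.single w c"]) (auto simp: I_zero)

lemma spanned_by_zero: "0 \<in> spanned_by W"
  by (rule spanned_byI[of 0]) (auto simp: I_zero)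

lemma spanned_by_add:
  assumes "f \<in> spanned_by W" "f' \<in> spanned_by W"
  shows "f + f' \<in> spanned_by W"
proof -
  obtain g g' where g: "Poly_Mapping.keys g \<subseteq> W" "f - g \<in> I" "Poly_Mapping.keys g' \<subseteq> W" "f' - g' \<in> I"
    using assms unfolding spanned_by_def by blast
  have "(f - g) + (f' - g') = (f + f') - (g + g')" by simp
  then have "(f + f') - (g + g') \<in> I" using I_add[OF g(2,4)] by (simp only:)
  then show ?thesis using keys_add[of g g'] g(1,3) by (intro spanned_byI[of "g + g'"]) auto
qed

lemma spanned_by_scalar:
  assumes "f \<in> spanned_by W"
  shows "scalar c * f \<in> spanned_by W"
proof -
  obtain g where g: "Poly_Mapping.keys g \<subseteq> W" "f - g \<in> I"
    using assms unfolding spanned_by_def by blast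
  have "Poly_Mapping.keys (scalar c * g) \<subseteq> Poly_Mapping.keys g"
    using keys_mult[of "scalar c" g] by (auto simp: scalar_def split: if_splits)
  then have "Poly_Mapping.keys (scalar c * g) \<subseteq> W" using g(1) by (rule subset_trans)
  moreover have "scalar c * f - scalar c * g \<in> I"
    using I_scalar[OF g(2)] by (simp only: right_diff_distrib)
  ultimately show ?thesis by (rule spanned_byI)
qed

lemma spanned_by_sum: "(\<And>a. a \<in> A \<Longrightarrow> f a \<in> spanned_by W) \<Longrightarrow> sum f A \<in> spanned_by W"
  by (induction A rule: infinite_finite_induct) (simp_all add: spanned_by_zero spanned_by_add)

lemma spanned_by_cong:
  assumes "f' \<in> spanned_by W" "f - f' \<in> I"
  shows "f \<in> spanned_by W"
proof -
  obtain g where g: "Poly_Mapping.keys g \<subseteq> W" "f' - g \<in> I"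
    using assms unfolding spanned_by_def by blast
  have "f - g = (f - f') + (f' - g)" by simp
  then have "f - g \<in> I" using I_add[OF assms(2) g(2)] by (simp only:)
  then show ?thesis using g(1) by (intro spanned_byI)
qed

lemma spanned_by_mult:
  assumes "f \<in> spanned_by W" "h \<in> FA"
    and "\<And>w. w \<in> W \<Longrightarrow> h * Poly_Mapping.single w 1 \<in> spanned_by W'"
  shows "h * f \<in> spanned_by W'"
proof -
  obtain g where g: "Poly_Mapping.keys g \<subseteq> W" "f - g \<in> I"
    using assms(1) unfolding spanned_by_def by blast
  have "h * g \<in> spanned_by W'"
    unfolding sum_single_mult_left[of h g]
    using g(1) assms(3) by (intro spanned_by_sum spanned_by_scalar) auto
  moreover have "h * f - h * g \<in> I" using I_mult(1)[OF g(2) assms(2)] by (simp add: right_diff_distrib)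
  ultimately show ?thesis by (rule spanned_by_cong)
qed

lemma spanned_by_trans:
  assumes "f \<in> spanned_by W" "\<And>w. w \<in> W \<Longrightarrow> Poly_Mapping.single w 1 \<in> spanned_by W'"
  shows "f \<in> spanned_by W'"
  using spanned_by_mult[OF assms(1), of 1 W'] assms(2) by (simp add: free_algebra_def zero_fmon_def)

text \<open>The span modulo the ideal contains 1 and is stable under left multiplication by the
  generators, hence contains every word.\<close>

lemma spanned_by_all:
  assumes W: "Word [] \<in> W"
    and step: "\<And>a w. a \<in> G \<Longrightarrow> w \<in> W \<Longrightarrow> var a * Poly_Mapping.single w 1 \<in> spanned_by W"
    and f: "f \<in> FA"
  shows "f \<in> spanned_by W"
proof -
  have words: "word xs \<in> spanned_by W" if "set xs \<subseteq> G" for xs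
    using that
  proof (induction xs)
    case Nil
    then show ?case using spanned_by_word[OF W] by simp
  next
    case (Cons a xs)
    have "var a * word xs \<in> spanned_by W"
      by (rule spanned_by_mult[OF Cons.IH _ step]) (use Cons.prems in \<open>auto simp: var_def\<close>)
    then show ?case by (simp add: var_def word_times_word)
  qed
  have "f = (\<Sum>w\<in>Poly_Mapping.keys f. scalar (Poly_Mapping.lookup f w) * Poly_Mapping.single w 1)"
    by (simp add: scalar_times_single sum_single_keys)
  moreover have "\<dots> \<in> spanned_by W"
  proof (intro spanned_by_sum spanned_by_scalar)
    fix w assume "w \<in> Poly_Mapping.keys f"
    then have "set (letters w) \<subseteq> G" using f by simp
    from words[OF this] show "Poly_Mapping.single w 1 \<in> spanned_by W" by simp
  qed
  ultimately show ?thesis by simp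
qed

text \<open>The scalar may vanish, so symmetry is not built in. Rewriting a word into the span of
  another one only uses this direction; swaps that occur in both orders are handled by
  \<open>proportional_swap\<close>.\<close>

definition proportional :: "'a list \<Rightarrow> 'a list \<Rightarrow> bool" where
  "proportional xs ys \<longleftrightarrow> (\<exists>c. word xs - scalar c * word ys \<in> I)"

lemma proportional_refl: "proportional xs xs"
  unfolding proportional_def by (intro exI[of _ 1]) (simp add: scalar_one I_zero)

lemma proportional_trans:
  assumes "proportional xs ys" "proportional ys zs"
  shows "proportional xs zs"
proof -
  obtain c d where "word xs - scalar c * word ys \<in> I" "word ys - scalar d * word zs \<in> I"
    using assms unfolding proportional_def by blast
  then have "(word xs - scalar c * word ys) + scalar c * (word ys - scalar d * word zs) \<in> I"
    using I_add I_scalar by blast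
  also have "(word xs - scalar c * word ys) + scalar c * (word ys - scalar d * word zs) = word xs - scalar (c * d) * word zs"
    by (simp add: algebra_simps flip: scalar_mult)
  finally show ?thesis unfolding proportional_def by blast
qed

lemma proportional_context:
  assumes "proportional xs ys" "set us \<subseteq> G" "set vs \<subseteq> G"
  shows "proportional (us @ xs @ vs) (us @ ys @ vs)"
proof -
  obtain c where "word xs - scalar c * word ys \<in> I" using assms(1) unfolding proportional_def by blast
  then have "word us * ((word xs - scalar c * word ys) * word vs) \<in> I"
    using I_mult FA_closed(6) assms(2,3) by blast
  also have "word us * ((word xs - scalar c * word ys) * word vs) =
      word (us @ xs @ vs) - scalar c * word (us @ ys @ vs)"
    by (simp add: algebra_simps scalar_def mult_single)
  finally show ?thesis unfolding proportional_def by blast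
qed

text \<open>Insertion sort, where each exchange of neighbours is the assumed swap placed into the
  surrounding word.\<close>

lemma proportional_sort:
  fixes g :: "nat \<Rightarrow> 'a"
  assumes swap: "\<And>i j. i \<in> A \<Longrightarrow> j \<in> A \<Longrightarrow> proportional [g i, g j] [g j, g i]"
    and g: "g ` A \<subseteq> G" and "set xs \<subseteq> A"
  shows "proportional (map g xs) (map g (sort xs))"
  using assms(3)
proof (induction xs)
  case (Cons x xs)
  have ins: "proportional (map g (x # s)) (map g (insort x s))" if "set s \<subseteq> A" for s
    using that
  proof (induction s)
    case (Cons y s)
    have x: "x \<in> A" using \<open>set (x # xs) \<subseteq> A\<close> by simp
    show ?case
    proof (cases "x \<le> y")
      case False
      have "proportional ([] @ [g x, g y] @ map g s) ([] @ [g y, g x] @ map g s)"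
        by (rule proportional_context[OF swap]) (use x g Cons.prems in auto)
      moreover have "proportional ([g y] @ map g (x # s) @ []) ([g y] @ map g (insort x s) @ [])"
        by (rule proportional_context[OF Cons.IH]) (use g Cons.prems in auto)
      ultimately show ?thesis using False by (auto intro: proportional_trans)
    qed (simp add: proportional_refl)
  qed (simp add: proportional_refl)
  have "proportional ([g x] @ map g xs @ []) ([g x] @ map g (sort xs) @ [])"
    by (rule proportional_context[OF Cons.IH]) (use g Cons.prems in auto)
  moreover have "proportional (map g (x # sort xs)) (map g (insort x (sort xs)))"
    by (rule ins) (use Cons.prems in auto)
  ultimately show ?case by (auto intro: proportional_trans)
qed (simp add: proportional_refl)

lemma proportional_swap:
  assumes "c \<noteq> 0" "var a * var b - scalar c * (var b * var a) \<in> I"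
  shows "proportional [a, b] [b, a]" "proportional [b, a] [a, b]"
proof -
  have 1: "word [a, b] - scalar c * word [b, a] \<in> I" using assms(2) by (simp add: var_times_var)
  then show "proportional [a, b] [b, a]" unfolding proportional_def by blast
  have "word [b, a] - scalar (inverse c) * word [a, b] = scalar (- inverse c) * (word [a, b] - scalar c * word [b, a])"
    using assms(1) by (simp add: right_diff_distrib scalar_def mult_single single_uminus)
  then show "proportional [b, a] [a, b]" unfolding proportional_def using I_scalar[OF 1] by metis
qed

lemma proportional_spanned_by:
  assumes "proportional xs ys" "Word ys \<in> W"
  shows "word xs \<in> spanned_by W"
proof -
  obtain c where c: "word xs - scalar c * word ys \<in> I" using assms(1) unfolding proportional_def by blast
  show ?thesis
    by (rule spanned_by_cong[OF spanned_by_scalar[OF spanned_by_word[OF assms(2)]] c])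
qed

end

section \<open>Quantum Euclidean space in a quantum torus\<close>

text \<open>An exponent \<open>v\<close> stands for the monomial in which \<open>y\<^sub>i\<close> has exponent \<open>v (n + i)\<close> and
  \<open>\<Omega>\<^sub>i = (1 - q\<^sup>-\<^sup>2) (y\<^sub>1 x\<^sub>1 + \<dots> + y\<^sub>i x\<^sub>i)\<close> has exponent \<open>v i\<close>, for \<open>1 \<le> i \<le> n\<close>. For \<open>i < j\<close> one has
  \<open>y\<^sub>i y\<^sub>j = q\<^sup>-\<^sup>1 y\<^sub>j y\<^sub>i\<close> and \<open>\<Omega>\<^sub>i y\<^sub>j = q\<^sup>-\<^sup>2 y\<^sub>j \<Omega>\<^sub>i\<close>; all other pairs commute.\<close>

definition euclid_form :: "nat \<Rightarrow> (nat \<Rightarrow>\<^sub>0 int) \<Rightarrow> (nat \<Rightarrow>\<^sub>0 int) \<Rightarrow> int" where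
  "euclid_form n u v = - (\<Sum>j = 1..n. (\<Sum>i = 1..<j. Poly_Mapping.lookup u (n + i) + 2 * Poly_Mapping.lookup u i)
     * Poly_Mapping.lookup v (n + j))"

locale quantum_euclid =
  fixes n :: nat and q :: "'k::field"
  assumes q0: "q \<noteq> 0" and q2: "q ^ 2 \<noteq> 1"

sublocale quantum_euclid \<subseteq> quantum_torus "euclid_form n" q
proof
  show "euclid_form n (u + u') v = euclid_form n u v + euclid_form n u' v"
    "euclid_form n v (u + u') = euclid_form n v u + euclid_form n v u'" for u u' v
    by (simp_all add: euclid_form_def lookup_add sum.distrib distrib_left distrib_right algebra_simps)
qed (rule q0)

context quantum_euclid
begin

notation tmult (infixl \<open>\<star>\<close> 70)

definition yv :: "nat \<Rightarrow> (nat \<Rightarrow>\<^sub>0 int)" where "yv i = Poly_Mapping.single (n + i) 1"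
definition ov :: "nat \<Rightarrow> (nat \<Rightarrow>\<^sub>0 int)" where "ov i = Poly_Mapping.single i 1"

abbreviation \<beta> where "\<beta> \<equiv> euclid_form n"

lemma lookup_yv: "Poly_Mapping.lookup (yv i) k = (if k = n + i then 1 else 0)"
  by (auto simp: yv_def lookup_single when_def)

lemma lookup_ov: "Poly_Mapping.lookup (ov i) k = (if k = i then 1 else 0)"
  by (auto simp: ov_def lookup_single when_def)

lemma form_yv:
  assumes "j \<in> {1..n}"
  shows "\<beta> u (yv j) = - (\<Sum>i = 1..<j. Poly_Mapping.lookup u (n + i) + 2 * Poly_Mapping.lookup u i)"
proof -
  have "\<beta> u (yv j) = - (\<Sum>j' = 1..n. if j' = j
      then \<Sum>i = 1..<j. Poly_Mapping.lookup u (n + i) + 2 * Poly_Mapping.lookup u i else 0)"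
    unfolding euclid_form_def yv_def
    by (intro arg_cong[of _ _ uminus] sum.cong refl) (auto simp: lookup_single when_def)
  then show ?thesis using assms by simp
qed

lemma form_ov_right: "i \<in> {1..n} \<Longrightarrow> \<beta> u (ov i) = 0"
  unfolding euclid_form_def ov_def by (auto simp: lookup_single when_def intro!: sum.neutral)

lemma form_yv_yv:
  assumes "i \<in> {1..n}" "j \<in> {1..n}"
  shows "\<beta> (yv i) (yv j) = (if i < j then -1 else 0)"
proof -
  have "\<beta> (yv i) (yv j) = - (\<Sum>i' = 1..<j. if i' = i then 1 else 0)"
    unfolding form_yv[OF assms(2)] using assms
    by (intro arg_cong[of _ _ uminus] sum.cong refl) (auto simp: lookup_yv)
  then show ?thesis using assms by simp
qed

lemma form_ov_yv:
  assumes "i \<in> {1..n}" "j \<in> {1..n}"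
  shows "\<beta> (ov i) (yv j) = (if i < j then -2 else 0)"
proof -
  have "\<beta> (ov i) (yv j) = - (\<Sum>i' = 1..<j. if i' = i then 2 else 0)"
    unfolding form_yv[OF assms(2)] using assms
    by (intro arg_cong[of _ _ uminus] sum.cong refl) (auto simp: lookup_ov)
  then show ?thesis using assms by simp
qed

lemmas form_values = form_ov_right form_yv_yv form_ov_yv form_add form_diff form_minus

text \<open>The common value of the coefficients \<open>q l - p l\<close> in the diagonal relations.
  It is invertible because \<open>q ^ 2 \<noteq> 1\<close>, so each x_i can be solved for.\<close>

definition cc :: 'k where "cc = 1 - inverse (q ^ 2)"

lemma cc_nonzero: "cc \<noteq> 0"
  using q2 q0 by (simp add: cc_def field_simps)

text \<open>At 0 it is the empty sum, not a monomial, so that the differences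
  \<open>Om i - Om (i - 1)\<close> telescope from \<open>i = 1\<close> on.\<close>

definition Om :: "nat \<Rightarrow> ((nat \<Rightarrow>\<^sub>0 int) \<Rightarrow>\<^sub>0 'k)" where
  "Om l = (if l = 0 then 0 else E (ov l))"

text \<open>The image of \<open>x\<^sub>i\<close> is forced by \<open>\<Omega>\<^sub>i - \<Omega>\<^sub>i\<^sub>-\<^sub>1 = (1 - q\<^sup>-\<^sup>2) y\<^sub>i x\<^sub>i\<close>.\<close>

fun img :: "gen \<Rightarrow> ((nat \<Rightarrow>\<^sub>0 int) \<Rightarrow>\<^sub>0 'k)" where
  "img (Y i) = E (yv i)"
| "img (X i) = Poly_Mapping.single 0 (inverse cc) \<star> (E (- yv i) \<star> (Om i - Om (i - 1)))"

lemma img_X: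
  assumes "i \<in> {1..n}"
  shows "img (X i) = Poly_Mapping.single (ov i - yv i) (inverse cc)
    - (if i = 1 then 0 else Poly_Mapping.single (ov (i - 1) - yv i) (inverse cc))"
proof (cases "i = 1")
  case False
  then have "i - 1 \<in> {1..n}" using assms by auto
  from form_ov_right[OF this] form_ov_right[OF assms] show ?thesis
    using assms False by (simp add: Om_def tmult_diff tmult_single form_minus)
qed (use assms in \<open>simp add: Om_def tmult_single form_values\<close>)

lemma keys_img_X:
  assumes "i \<in> {1..n}" "u \<in> Poly_Mapping.keys (img (X i))"
  shows "\<exists>a. a \<in> {1..n} \<and> (a = i \<or> a + 1 = i) \<and> u = ov a - yv i"
proof (cases "u = ov i - yv i")
  case False
  then have "i \<noteq> 1 \<and> u = ov (i - 1) - yv i"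
    using assms unfolding img_X[OF assms(1)]
    by (auto simp: in_keys_iff lookup_minus lookup_single when_def split: if_splits)
  then show ?thesis using assms(1) by (intro exI[of _ "i - 1"]) auto
qed (use assms in auto)

lemma keys_img_Y: "u \<in> Poly_Mapping.keys (img (Y i)) \<Longrightarrow> u = yv i"
  by simp

text \<open>In the lexicographic order the smallest index is the most significant one. Hence the
  lowest term of the image of \<open>x\<^sub>i\<close> is the one containing \<open>\<Omega>\<^sub>i\<close>, not \<open>\<Omega>\<^sub>i\<^sub>-\<^sub>1\<close>.\<close>

lemma ov_less: "i < j \<Longrightarrow> ov j < ov i"
  unfolding less_poly_mapping.rep_eq less_fun_def
  by (intro exI[of _ i]) (auto simp: lookup_ov)

fun gv :: "gen \<Rightarrow> (nat \<Rightarrow>\<^sub>0 int)" where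
  "gv (Y i) = yv i"
| "gv (X i) = ov i - yv i"

lemma lowest_img:
  assumes "g \<in> K_gens n"
  shows "lowest (img g) (gv g)"
proof (cases g)
  case (X i)
  then have i: "i \<in> {1..n}" using assms by (auto simp: K_gens_def)
  have "ov i \<noteq> ov (i - 1)" using i ov_less[of "i - 1" i] by auto
  then have "gv g \<in> Poly_Mapping.keys (img g)"
    unfolding X img_X[OF i] using cc_nonzero
    by (simp add: in_keys_iff lookup_minus lookup_single when_def)
  moreover have "gv g \<le> u" if "u \<in> Poly_Mapping.keys (img g)" for u
    using keys_img_X[OF i, of u] that ov_less unfolding X by (auto intro: less_imp_le)
  ultimately show ?thesis by (simp add: lowest_def)
qed (simp add: lowest_def)

section \<open>The defining relations hold in the torus\<close>

abbreviation rels where "rels \<equiv> K_relations n (\<lambda>i. inverse (q ^ 2)) (\<lambda>i. 1)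
  (\<lambda>i j. if i < j then inverse q else if i = j then 1 else q)"

text \<open>The image of x_i has the exponents \<open>ov a - yv i\<close> with \<open>a\<close>
  equal to \<open>i\<close> or \<open>i - 1\<close>. For distinct indices the commutation form takes
  the same value on both, so x_i commutes up to one power of \<open>q\<close>. Against y_i itself
  the two values differ, which is the source of the inhomogeneous relation in
  \<open>img_X_Y\<close>.\<close>

lemma commutation_relations:
  assumes "i \<in> {1..n}" "j \<in> {1..n}"
  shows "img (Y i) \<star> img (Y j) =
      Poly_Mapping.single 0 (if i < j then inverse q else if i = j then 1 else q) \<star> (img (Y j) \<star> img (Y i))"
    and "i < j \<Longrightarrow> img (X i) \<star> img (X j) = Poly_Mapping.single 0 q \<star> (img (X j) \<star> img (X i))"
    and "i \<noteq> j \<Longrightarrow> img (X i) \<star> img (Y j) = Poly_Mapping.single 0 (inverse q) \<star> (img (Y j) \<star> img (X i))"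
proof -
  show "img (Y i) \<star> img (Y j) =
      Poly_Mapping.single 0 (if i < j then inverse q else if i = j then 1 else q) \<star> (img (Y j) \<star> img (Y i))"
    using tmult_quasi_commute[of "img (Y i)" "img (Y j)" "if i < j then -1 else if i = j then 0 else 1"]
      assms by (auto simp: form_values power_int_minus)
  show "img (X i) \<star> img (X j) = Poly_Mapping.single 0 q \<star> (img (X j) \<star> img (X i))" if "i < j"
  proof -
    have "\<beta> u v - \<beta> v u = 1"
      if uv: "u \<in> Poly_Mapping.keys (img (X i))" "v \<in> Poly_Mapping.keys (img (X j))" for u v
    proof -
      obtain a b where ab: "a \<in> {1..n}" "a = i \<or> a + 1 = i" "u = ov a - yv i"
          "b \<in> {1..n}" "b = j \<or> b + 1 = j" "v = ov b - yv j"
        using keys_img_X[OF assms(1) uv(1)] keys_img_X[OF assms(2) uv(2)] by blast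
      \<comment> \<open>The extreme case \<open>b = j - 1\<close> can reach \<open>i\<close> but not
        fall below it, so the shift of either index does not change the form.\<close>
      then have "a < j" "\<not> b < i" using \<open>i < j\<close> by auto
      then show ?thesis using ab(1,4) assms \<open>i < j\<close> unfolding ab(3,6) by (simp add: form_values)
    qed
    then have "img (X i) \<star> img (X j) = Poly_Mapping.single 0 (q powi 1) \<star> (img (X j) \<star> img (X i))"
      by (rule tmult_quasi_commute)
    then show ?thesis unfolding power_int_1_right .
  qed
  show "img (X i) \<star> img (Y j) = Poly_Mapping.single 0 (inverse q) \<star> (img (Y j) \<star> img (X i))" if "i \<noteq> j"
  proof -
    have "\<beta> u v - \<beta> v u = -1"
      if uv: "u \<in> Poly_Mapping.keys (img (X i))" "v \<in> Poly_Mapping.keys (img (Y j))" for u v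
    proof -
      obtain a where ab: "a \<in> {1..n}" "a = i \<or> a + 1 = i" "u = ov a - yv i"
        using keys_img_X[OF assms(1) uv(1)] by blast
      have v: "v = yv j" using keys_img_Y uv(2) by blast
      have "a < j \<longleftrightarrow> i < j" using ab(2) \<open>i \<noteq> j\<close> by auto
      then show ?thesis using ab(1) assms \<open>i \<noteq> j\<close> unfolding ab(3) v by (simp add: form_values)
    qed
    then have "img (X i) \<star> img (Y j) = Poly_Mapping.single 0 (q powi -1) \<star> (img (Y j) \<star> img (X i))"
      by (rule tmult_quasi_commute)
    then show ?thesis unfolding power_int_minus power_int_1_right .
  qed
qed

lemma img_Y_X:
  assumes "i \<in> {1..n}"
  shows "img (Y i) \<star> img (X i) = Poly_Mapping.single 0 (inverse cc) \<star> (Om i - Om (i - 1))"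
proof -
  have "img (Y i) \<star> img (X i) = Poly_Mapping.single 0 (inverse cc) \<star> ((E (yv i) \<star> E (- yv i)) \<star> (Om i - Om (i - 1)))"
    by (simp only: img.simps tmult_assoc[symmetric] tmult_scalar_right)
  also have "E (yv i) \<star> E (- yv i) = 1"
    using assms by (simp add: tmult_single form_values)
  finally show ?thesis by simp
qed

lemma sum_img_Y_X:
  assumes "i \<le> Suc n"
  shows "(\<Sum>l = 1..<i. Poly_Mapping.single 0 cc \<star> (img (Y l) \<star> img (X l))) = Om (i - 1)"
proof -
  have "(\<Sum>l = 1..<i. Poly_Mapping.single 0 cc \<star> (img (Y l) \<star> img (X l))) = (\<Sum>l = 1..<i. Om l - Om (l - 1))"
  proof (intro sum.cong refl)
    fix l assume "l \<in> {1..<i}"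
    then have l: "l \<in> {1..n}" using assms by auto
    show "Poly_Mapping.single 0 cc \<star> (img (Y l) \<star> img (X l)) = Om l - Om (l - 1)"
      unfolding img_Y_X[OF l] using cc_nonzero by (simp add: tmult_single flip: tmult_assoc)
  qed
  also have "\<dots> = Om (i - 1)"
    by (induction i) (auto simp: Om_def)
  finally show ?thesis .
qed

text \<open>Omega_i commutes with y_i, while Omega_(i-1) acquires the factor q^(-2). The defect is
  therefore \<open>1 - inverse (q ^ 2)\<close> times Omega_(i-1), divided by \<open>cc\<close>,
  which leaves Omega_(i-1), the sum that occurs in the diagonal relation.\<close>

lemma img_X_Y:
  assumes "i \<in> {1..n}"
  shows "img (X i) \<star> img (Y i) = img (Y i) \<star> img (X i) + Om (i - 1)"
proof -
  have i0: "i \<noteq> 0" "i = 1 \<or> i - 1 \<in> {1..n}" using assms by auto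
  have 1: "Om i \<star> E (yv i) = E (yv i) \<star> Om i"
    using assms i0 by (simp add: Om_def tmult_single form_values add.commute)
  have 2: "Om (i - 1) \<star> E (yv i) = E (yv i) \<star> (Poly_Mapping.single 0 (inverse (q ^ 2)) \<star> Om (i - 1))"
    using assms i0 by (auto simp: Om_def tmult_single form_values add.commute power_int_minus)
  have 3: "E (- yv i) \<star> (E (yv i) \<star> f) = f" for f
    using assms by (simp add: tmult_single form_values flip: tmult_assoc)
  have "img (X i) \<star> img (Y i) =
      Poly_Mapping.single 0 (inverse cc) \<star> (Om i - Poly_Mapping.single 0 (inverse (q ^ 2)) \<star> Om (i - 1))"
    by (simp only: img.simps tmult_assoc tmult_diff 1 2 3)
  also have "\<dots> = img (Y i) \<star> img (X i) +
      (Poly_Mapping.single 0 (inverse cc) \<star> Om (i - 1) -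
       Poly_Mapping.single 0 (inverse cc) \<star> (Poly_Mapping.single 0 (inverse (q ^ 2)) \<star> Om (i - 1)))"
    unfolding img_Y_X[OF assms] tmult_diff by simp
  also have "Poly_Mapping.single 0 (inverse cc) \<star> Om (i - 1) -
       Poly_Mapping.single 0 (inverse cc) \<star> (Poly_Mapping.single 0 (inverse (q ^ 2)) \<star> Om (i - 1)) =
      Poly_Mapping.single 0 (inverse cc * cc) \<star> Om (i - 1)"
    unfolding cc_def
    by (simp add: tmult_single right_diff_distrib single_diff flip: tmult_assoc tmult_diff)
  also have "\<dots> = Om (i - 1)" using cc_nonzero by simp
  finally show ?thesis .
qed

lemma lift_relations:
  assumes "f \<in> rels"
  shows "lift img f = 0"
proof -
  have s: "inverse (inverse (q\<^sup>2)) * inverse q = q" "inverse (q\<^sup>2) * q = inverse q"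
    using q0 by (simp_all add: power2_eq_square field_simps)
  note l = lift_diff lift_mult lift_scalar lift_var lift_add lift_sum
  let ?\<gamma> = "\<lambda>i j. if i < j then inverse q else if i = j then 1 else q"
  consider (yy) i j where "f = var (Y i) * var (Y j) - scalar (?\<gamma> i j) * (var (Y j) * var (Y i))"
        "i \<in> {1..n}" "j \<in> {1..n}"
    | (xx) i j where "f = var (X i) * var (X j) - scalar (1 * inverse (inverse (q\<^sup>2)) * ?\<gamma> i j) * (var (X j) * var (X i))"
        "i \<in> {1..n}" "j \<in> {1..n}" "i < j"
    | (xy) i j where "f = var (X i) * var (Y j) - scalar (inverse (q\<^sup>2) * ?\<gamma> j i) * (var (Y j) * var (X i))"
        "i \<in> {1..n}" "j \<in> {1..n}" "i < j"
    | (xy') i j where "f = var (X i) * var (Y j) - scalar (1 * ?\<gamma> j i) * (var (Y j) * var (X i))"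
        "i \<in> {1..n}" "j \<in> {1..n}" "i > j"
    | (diag) i where "f = var (X i) * var (Y i) - (scalar 1 * (var (Y i) * var (X i))
         + (\<Sum>l = 1..<i. scalar (1 - inverse (q\<^sup>2)) * (var (Y l) * var (X l))))" "i \<in> {1..n}"
    using assms unfolding K_relations_def Let_def by (elim UnE CollectE exE conjE) blast+
  then show ?thesis
  proof cases
    case (yy i j)
    show ?thesis unfolding yy(1) l commutation_relations(1)[OF yy(2,3)] by simp
  next
    case (xx i j)
    have g: "1 * inverse (inverse (q\<^sup>2)) * ?\<gamma> i j = q" using xx(4) s by simp
    show ?thesis unfolding xx(1) g l commutation_relations(2)[OF xx(2-4)] by simp
  next
    case (xy i j)
    then have g: "inverse (q\<^sup>2) * ?\<gamma> j i = inverse q" "i \<noteq> j" using s by simp_all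
    show ?thesis unfolding xy(1) g(1) l commutation_relations(3)[OF xy(2,3) g(2)] by simp
  next
    case (xy' i j)
    then have g: "1 * ?\<gamma> j i = inverse q" "i \<noteq> j" by simp_all
    show ?thesis unfolding xy'(1) g(1) l commutation_relations(3)[OF xy'(2,3) g(2)] by simp
  next
    case (diag i)
    then have "i \<le> Suc n" by simp
    show ?thesis
      unfolding diag(1) cc_def[symmetric] l img_X_Y[OF diag(2)] sum_img_Y_X[OF \<open>i \<le> Suc n\<close>] by simp
  qed
qed

text \<open>For these parameters q^2 q^(-1) = q, and the mixed coefficients q^(-2) q for
  \<open>i < j\<close> and q^(-1) for \<open>i > j\<close> coincide, so two families of relations
  merge into one.\<close>

lemma relations:
  assumes "i \<in> {1..n}" "j \<in> {1..n}"
  shows "var (Y i) * var (Y j) -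
      scalar (if i < j then inverse q else if i = j then 1 else q) * (var (Y j) * var (Y i)) \<in> rels"
    and "i < j \<Longrightarrow> var (X i) * var (X j) - scalar q * (var (X j) * var (X i)) \<in> rels"
    and "i \<noteq> j \<Longrightarrow> var (X i) * var (Y j) - scalar (inverse q) * (var (Y j) * var (X i)) \<in> rels"
    and "var (X i) * var (Y i) - (scalar 1 * (var (Y i) * var (X i))
         + (\<Sum>l = 1..<i. scalar cc * (var (Y l) * var (X l)))) \<in> rels"
proof -
  have s: "q = 1 * inverse (inverse (q\<^sup>2)) * inverse q" "inverse q = inverse (q\<^sup>2) * q"
    using q0 by (simp_all add: power2_eq_square field_simps)
  show "var (Y i) * var (Y j) -
      scalar (if i < j then inverse q else if i = j then 1 else q) * (var (Y j) * var (Y i)) \<in> rels"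
    using assms unfolding K_relations_def Let_def by blast
  show "var (X i) * var (X j) - scalar q * (var (X j) * var (X i)) \<in> rels" if "i < j"
  proof -
    have "var (X i) * var (X j) - scalar (1 * inverse (inverse (q\<^sup>2)) *
      (if i < j then inverse q else if i = j then 1 else q)) * (var (X j) * var (X i)) \<in> rels"
      using assms that unfolding K_relations_def Let_def by blast
    then show ?thesis using that s(1) by simp
  qed
  show "var (X i) * var (Y j) - scalar (inverse q) * (var (Y j) * var (X i)) \<in> rels" if "i \<noteq> j"
  proof (cases "i < j")
    case True
    have "var (X i) * var (Y j) - scalar (inverse (q\<^sup>2) *
      (if j < i then inverse q else if j = i then 1 else q)) * (var (Y j) * var (X i)) \<in> rels"
      using assms True unfolding K_relations_def Let_def by blast
    then show ?thesis using True s(2) by simp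
  next
    case False
    then have "i > j" using that by simp
    then have "var (X i) * var (Y j) - scalar (1 *
      (if j < i then inverse q else if j = i then 1 else q)) * (var (Y j) * var (X i)) \<in> rels"
      using assms unfolding K_relations_def Let_def by blast
    then show ?thesis using \<open>i > j\<close> by simp
  qed
  show "var (X i) * var (Y i) - (scalar 1 * (var (Y i) * var (X i))
         + (\<Sum>l = 1..<i. scalar cc * (var (Y l) * var (X l)))) \<in> rels"
    using assms unfolding K_relations_def Let_def cc_def by blast
qed

end

section \<open>Normal words\<close>

context quantum_euclid
begin

abbreviation FR :: "(gen fmon \<Rightarrow>\<^sub>0 'k) ring" where "FR \<equiv> free_algebra (K_gens n)"

definition rel_ideal :: "(gen fmon \<Rightarrow>\<^sub>0 'k) set" where "rel_ideal = Idl\<^bsub>FR\<^esub> rels"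

lemma K_gens_iff: "X i \<in> K_gens n \<longleftrightarrow> i \<in> {1..n}" "Y i \<in> K_gens n \<longleftrightarrow> i \<in> {1..n}"
  by (auto simp: K_gens_def)

lemma rels_carrier: "rels \<subseteq> carrier FR"
proof -
  interpret R: ring FR by (rule free_algebra_ring)
  \<comment> \<open>The zero ideal only gives access to the closure facts about the free algebra;
    the ideal of the relations cannot be used before its generators are known to lie in the
    carrier.\<close>
  interpret Z: free_ideal "K_gens n" "{0 :: gen fmon \<Rightarrow>\<^sub>0 'k}"
    using R.zeroideal by (intro free_ideal.intro) (simp del: free_algebra_simps(5))
  have v: "var a \<in> carrier FR" if "a \<in> K_gens n" for a
    using that by (simp add: var_def)
  have s: "sum f A \<in> carrier FR" if "\<And>a. a \<in> A \<Longrightarrow> f a \<in> carrier FR" for f and A :: "nat set"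
    using that by (induction A rule: infinite_finite_induct) (simp_all add: Z.FA_closed del: free_algebra_simps(5))
  show ?thesis
    unfolding K_relations_def Let_def
    by (auto intro!: Z.FA_closed v s simp: K_gens_iff simp del: free_algebra_simps(5))
qed

lemma rel_ideal: "ideal rel_ideal FR"
  unfolding rel_ideal_def by (rule ring.genideal_ideal[OF free_algebra_ring rels_carrier])

lemma rels_rel_ideal: "f \<in> rels \<Longrightarrow> f \<in> rel_ideal"
  unfolding rel_ideal_def using ring.genideal_self[OF free_algebra_ring rels_carrier] by blast

end

sublocale quantum_euclid \<subseteq> FI: free_ideal "K_gens n" rel_ideal
  by (rule free_ideal.intro[OF rel_ideal])

context quantum_euclid
begin

definition yx_words :: "gen fmon set" where
  "yx_words = {Word (map Y is @ map X js) | is js. set is \<subseteq> {1..n} \<and> set js \<subseteq> {1..n}}"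

lemma yx_wordsI: "set is \<subseteq> {1..n} \<Longrightarrow> set js \<subseteq> {1..n} \<Longrightarrow> Word (map Y is @ map X js) \<in> yx_words"
  unfolding yx_words_def by blast

lemma var_FA: "a \<in> K_gens n \<Longrightarrow> var a \<in> carrier FR"
  by (simp add: var_def)

lemma Y_step:
  assumes "i \<in> {1..n}" "w \<in> yx_words"
  shows "var (Y i) * Poly_Mapping.single w 1 \<in> FI.spanned_by yx_words"
proof -
  obtain "is" js where w: "w = Word (map Y is @ map X js)" "set is \<subseteq> {1..n}" "set js \<subseteq> {1..n}"
    using assms(2) unfolding yx_words_def by blast
  have "var (Y i) * Poly_Mapping.single w 1 = Poly_Mapping.single (Word (map Y (i # is) @ map X js)) (1 :: 'k)"
    by (simp add: w var_def mult_single)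
  also have "\<dots> \<in> FI.spanned_by yx_words"
    by (rule FI.spanned_by_word, rule yx_wordsI) (use assms w in auto)
  finally show ?thesis .
qed

lemma Y_mult: "i \<in> {1..n} \<Longrightarrow> f \<in> FI.spanned_by yx_words \<Longrightarrow> var (Y i) * f \<in> FI.spanned_by yx_words"
  by (rule FI.spanned_by_mult[OF _ var_FA Y_step]) (simp_all add: K_gens_iff)

text \<open>Every term produced by moving \<open>x\<^sub>j\<close> past \<open>y\<^sub>i\<close> is some \<open>y\<^sub>l x\<^sub>l\<close> followed by the shorter rest of the word,
  so induction on the number of \<open>y\<close>'s suffices as long as these need not be sorted.\<close>

lemma X_step:
  assumes "set js \<subseteq> {1..n}" "set is \<subseteq> {1..n}" "j \<in> {1..n}"
  shows "var (X j) * word (map Y is @ map X js) \<in> FI.spanned_by yx_words"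
  using assms(2,3)
proof (induction "is" arbitrary: j)
  case Nil
  have "var (X j) * word (map Y [] @ map X js) = Poly_Mapping.single (Word (map Y [] @ map X (j # js))) (1::'k)"
    by (simp add: var_def mult_single)
  also have "\<dots> \<in> FI.spanned_by yx_words"
    by (rule FI.spanned_by_word, rule yx_wordsI) (use assms(1) Nil in auto)
  finally show ?case .
next
  case (Cons i "is")
  let ?w = "word (map Y is @ map X js) :: gen fmon \<Rightarrow>\<^sub>0 'k"
  have i: "i \<in> {1..n}" and iss: "set is \<subseteq> {1..n}" using Cons.prems by auto
  have w: "?w \<in> carrier FR"
    by (rule FI.FA_closed(6)) (use iss assms(1) in \<open>auto simp: K_gens_def\<close>)
  have e: "word (map Y (i # is) @ map X js) = var (Y i) * ?w"
    by (simp add: var_def mult_single)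
  have IH: "var (X l) * ?w \<in> FI.spanned_by yx_words" if "l \<in> {1..n}" for l
    by (rule Cons.IH[OF iss that])
  show ?case
  proof (cases "i = j")
    case False
    have "(var (X j) * var (Y i) - scalar (inverse q) * (var (Y i) * var (X j))) * ?w \<in> rel_ideal"
      by (rule FI.I_mult(2)[OF rels_rel_ideal[OF relations(3)[OF Cons.prems(2) i]] w]) (use False in simp)
    then have "var (X j) * (var (Y i) * ?w) - scalar (inverse q) * (var (Y i) * (var (X j) * ?w)) \<in> rel_ideal"
      by (simp add: left_diff_distrib mult.assoc)
    then show ?thesis
      unfolding e by (rule FI.spanned_by_cong[rotated]) (intro FI.spanned_by_scalar Y_mult IH i Cons.prems)
  next
    case True
    let ?s = "scalar 1 * (var (Y j) * var (X j)) + (\<Sum>l = 1..<j. scalar cc * (var (Y l) * var (X l)))"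
    have "(var (X j) * var (Y j) - ?s) * ?w \<in> rel_ideal"
      by (rule FI.I_mult(2)[OF rels_rel_ideal[OF relations(4)[OF Cons.prems(2) i]] w])
    moreover have "(var (X j) * var (Y j) - ?s) * ?w = var (X j) * (var (Y j) * ?w) -
        (scalar 1 * (var (Y j) * (var (X j) * ?w)) + (\<Sum>l = 1..<j. scalar cc * (var (Y l) * (var (X l) * ?w))))"
      by (simp add: left_diff_distrib distrib_right sum_distrib_right mult.assoc)
    ultimately have r: "var (X j) * (var (Y j) * ?w) -
        (scalar 1 * (var (Y j) * (var (X j) * ?w)) + (\<Sum>l = 1..<j. scalar cc * (var (Y l) * (var (X l) * ?w)))) \<in> rel_ideal"
      by (simp only:)
    have "scalar 1 * (var (Y j) * (var (X j) * ?w)) + (\<Sum>l = 1..<j. scalar cc * (var (Y l) * (var (X l) * ?w)))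
        \<in> FI.spanned_by yx_words"
      by (intro FI.spanned_by_add FI.spanned_by_sum FI.spanned_by_scalar Y_mult IH) (use Cons.prems in auto)
    from FI.spanned_by_cong[OF this r] show ?thesis unfolding e unfolding True .
  qed
qed

lemma spanned_by_yx_words:
  assumes "f \<in> carrier FR"
  shows "f \<in> FI.spanned_by yx_words"
proof (rule FI.spanned_by_all[OF _ _ assms])
  show "Word [] \<in> yx_words" using yx_wordsI[of "[]" "[]"] by simp
  fix a w assume a: "a \<in> K_gens n" and w: "w \<in> yx_words"
  obtain "is" js where w': "w = Word (map Y is @ map X js)" "set is \<subseteq> {1..n}" "set js \<subseteq> {1..n}"
    using w unfolding yx_words_def by blast
  show "var a * Poly_Mapping.single w 1 \<in> FI.spanned_by yx_words"
  proof (cases a)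
    case (X j)
    then show ?thesis using X_step[OF w'(3,2)] a w'(1) K_gens_iff by simp
  next
    case (Y i)
    then show ?thesis using Y_step[OF _ w] a K_gens_iff by simp
  qed
qed

definition normal_words :: "gen fmon set" where
  "normal_words = {Word (map Y is @ map X js) | is js.
     set is \<subseteq> {1..n} \<and> set js \<subseteq> {1..n} \<and> sorted is \<and> sorted js}"

lemma swap_Y: "i \<in> {1..n} \<Longrightarrow> j \<in> {1..n} \<Longrightarrow> FI.proportional [Y i, Y j] [Y j, Y i]"
  by (rule FI.proportional_swap(1)[OF _ rels_rel_ideal[OF relations(1)]]) (use q0 in auto)

lemma swap_X:
  assumes "i \<in> {1..n}" "j \<in> {1..n}"
  shows "FI.proportional [X i, X j] [X j, X i]"
proof (cases i j rule: linorder_cases)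
  case less
  show ?thesis by (rule FI.proportional_swap(1)[OF q0 rels_rel_ideal[OF relations(2)[OF assms less]]])
next
  case greater
  show ?thesis by (rule FI.proportional_swap(2)[OF q0 rels_rel_ideal[OF relations(2)[OF assms(2,1) greater]]])
qed (simp add: FI.proportional_refl)

lemma spanned_by_normal_words:
  assumes "f \<in> carrier FR"
  shows "f \<in> FI.spanned_by normal_words"
proof (rule FI.spanned_by_trans[OF spanned_by_yx_words[OF assms]])
  fix w assume "w \<in> yx_words"
  then obtain "is" js where w: "w = Word (map Y is @ map X js)" and s: "set is \<subseteq> {1..n}" "set js \<subseteq> {1..n}"
    unfolding yx_words_def by blast
  have "FI.proportional (map Y is) (map Y (sort is))"
    by (rule FI.proportional_sort[OF swap_Y _ s(1)]) (auto simp: K_gens_iff)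
  from FI.proportional_context[OF this, of "[]" "map X js"]
  have "FI.proportional (map Y is @ map X js) (map Y (sort is) @ map X js)"
    using s by (auto simp: K_gens_def)
  moreover have "FI.proportional (map X js) (map X (sort js))"
    by (rule FI.proportional_sort[OF swap_X _ s(2)]) (auto simp: K_gens_iff)
  from FI.proportional_context[OF this, of "map Y (sort is)" "[]"]
  have "FI.proportional (map Y (sort is) @ map X js) (map Y (sort is) @ map X (sort js))"
    using s by (auto simp: K_gens_def)
  ultimately have "FI.proportional (map Y is @ map X js) (map Y (sort is) @ map X (sort js))"
    by (rule FI.proportional_trans)
  moreover have "Word (map Y (sort is) @ map X (sort js)) \<in> normal_words"
    unfolding normal_words_def
    by (intro CollectI exI[of _ "sort is"] exI[of _ "sort js"]) (use s in auto)
  ultimately show "Poly_Mapping.single w 1 \<in> FI.spanned_by normal_words"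
    unfolding w by (rule FI.proportional_spanned_by)
qed

section \<open>Lowest terms separate the normal words\<close>

definition weight :: "gen fmon \<Rightarrow> (nat \<Rightarrow>\<^sub>0 int)" where
  "weight w = sum_list (map gv (letters w))"

text \<open>Lowest exponents add under multiplication. Thus \<open>weight w\<close> is the lowest
  exponent in the image of a word \<open>w\<close> in the generators.\<close>

lemma lowest_word:
  assumes "set gs \<subseteq> K_gens n"
  shows "lowest (tprod (map img gs)) (sum_list (map gv gs))"
  using assms
proof (induction gs)
  case Nil
  show ?case by (simp add: lowest_def)
next
  case (Cons g gs)
  then show ?case using lowest_tmult[OF lowest_img] by simp
qed

lemma lookup_sum_list: "Poly_Mapping.lookup (sum_list xs) k = sum_list (map (\<lambda>x. Poly_Mapping.lookup x k) xs)"
  by (induction xs) (simp_all add: lookup_add)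

lemma weight_word:
  assumes "set is \<subseteq> {1..n}" "set js \<subseteq> {1..n}" "i \<in> {1..n}"
  shows "Poly_Mapping.lookup (weight (Word (map Y is @ map X js))) i = int (count_list js i)"
    and "Poly_Mapping.lookup (weight (Word (map Y is @ map X js))) (n + i) = int (count_list is i) - int (count_list js i)"
proof -
  have 1: "(\<Sum>x\<leftarrow>is. Poly_Mapping.lookup (yv x) i) = 0"
    using assms(1,3) by (induction "is") (auto simp: lookup_yv)
  have 2: "(\<Sum>x\<leftarrow>is. Poly_Mapping.lookup (yv x) (n + i)) = int (count_list is i)"
    by (induction "is") (auto simp: lookup_yv)
  have 3: "(\<Sum>x\<leftarrow>js. Poly_Mapping.lookup (ov x - yv x) i) = int (count_list js i)"
    using assms(2,3) by (induction js) (auto simp: lookup_yv lookup_ov lookup_minus)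
  have 4: "(\<Sum>x\<leftarrow>js. Poly_Mapping.lookup (ov x - yv x) (n + i)) = - int (count_list js i)"
    using assms(2,3) by (induction js) (auto simp: lookup_yv lookup_ov lookup_minus)
  show "Poly_Mapping.lookup (weight (Word (map Y is @ map X js))) i = int (count_list js i)"
    using 1 3 by (simp add: weight_def lookup_sum_list lookup_add o_def)
  show "Poly_Mapping.lookup (weight (Word (map Y is @ map X js))) (n + i) = int (count_list is i) - int (count_list js i)"
    using 2 4 by (simp add: weight_def lookup_sum_list lookup_add o_def)
qed

lemma sorted_eq_of_counts:
  fixes xs ys :: "nat list"
  assumes "sorted xs" "sorted ys" "set xs \<subseteq> A" "set ys \<subseteq> A" "\<And>i. i \<in> A \<Longrightarrow> count_list xs i = count_list ys i"
  shows "xs = ys"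
proof -
  have "count_list xs i = count_list ys i" for i
    using assms(3-5) by (cases "i \<in> A") (metis, metis count_list_0_iff subsetD)
  then have "mset xs = mset ys" by (simp add: multiset_eq_iff count_mset)
  then show ?thesis using assms(1,2) by (metis properties_for_sort sorted_sort_id)
qed

text \<open>The coordinate \<open>i\<close> counts the occurrences of x_i, and the coordinate
  \<open>n + i\<close> those of y_i minus those of x_i. A sorted word is determined by these
  multiplicities.\<close>

lemma weight_inj: "inj_on weight normal_words"
proof (rule inj_onI)
  fix w w' assume "w \<in> normal_words" "w' \<in> normal_words" and eq: "weight w = weight w'"
  then obtain "is" js is' js' where w: "w = Word (map Y is @ map X js)" "w' = Word (map Y is' @ map X js')"
    and s: "set is \<subseteq> {1..n}" "set js \<subseteq> {1..n}" "set is' \<subseteq> {1..n}" "set js' \<subseteq> {1..n}"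
    and so: "sorted is" "sorted js" "sorted is'" "sorted js'"
    unfolding normal_words_def by blast
  have x: "count_list js i = count_list js' i" if "i \<in> {1..n}" for i
    using weight_word(1)[OF s(1,2) that] weight_word(1)[OF s(3,4) that] eq w by simp
  have y: "count_list is i = count_list is' i" if "i \<in> {1..n}" for i
    using weight_word(2)[OF s(1,2) that] weight_word(2)[OF s(3,4) that] eq w x[OF that] by simp
  show "w = w'" unfolding w
    using sorted_eq_of_counts[OF so(2,4) s(2,4) x] sorted_eq_of_counts[OF so(1,3) s(1,3) y] by simp
qed

text \<open>Among the words of \<open>g\<close> the one of least weight contributes a lowest term
  that no other word can reach, so it survives in the image.\<close>

lemma normal_words_independent:
  assumes g: "Poly_Mapping.keys g \<subseteq> normal_words" and 0: "lift img g = 0"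
  shows "g = 0"
proof (rule ccontr)
  assume "g \<noteq> 0"
  let ?K = "Poly_Mapping.keys g"
  have ne: "weight ` ?K \<noteq> {}" using \<open>g \<noteq> 0\<close> by simp
  then have "Min (weight ` ?K) \<in> weight ` ?K" by (intro Min_in) auto
  then obtain w0 where w0: "w0 \<in> ?K" "weight w0 = Min (weight ` ?K)" by auto
  have min: "weight w0 \<le> weight w" if "w \<in> ?K" for w
    unfolding w0(2) using that by (intro Min_le) auto
  have low: "lowest (tprod (map img (letters w))) (weight w)" if "w \<in> ?K" for w
  proof -
    have "w \<in> normal_words" using that g by blast
    then obtain "is" js where "w = Word (map Y is @ map X js)" "set is \<subseteq> {1..n}" "set js \<subseteq> {1..n}"
      unfolding normal_words_def by blast
    then have "set (letters w) \<subseteq> K_gens n"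
      unfolding K_gens_def by simp (meson image_mono le_supI1 le_supI2)
    then show ?thesis unfolding weight_def by (rule lowest_word)
  qed
  have "Poly_Mapping.lookup (lift img g) (weight w0) =
    (\<Sum>w\<in>?K. Poly_Mapping.lookup g w * Poly_Mapping.lookup (tprod (map img (letters w))) (weight w0))"
    unfolding lift_def lookup_sum by (simp add: lookup_tmult_single_left)
  also have "\<dots> = (\<Sum>w\<in>?K. if w = w0 then Poly_Mapping.lookup g w0 * Poly_Mapping.lookup (tprod (map img (letters w0))) (weight w0) else 0)"
  proof (intro sum.cong refl)
    fix w assume w: "w \<in> ?K"
    have "Poly_Mapping.lookup (tprod (map img (letters w))) (weight w0) = 0" if "w \<noteq> w0"
    proof -
      have "weight w \<noteq> weight w0" using inj_onD[OF weight_inj] w w0(1) g that by blast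
      then have "\<not> weight w \<le> weight w0" using min[OF w] by auto
      then show ?thesis using low[OF w] unfolding lowest_def by (auto simp: in_keys_iff)
    qed
    then show "Poly_Mapping.lookup g w * Poly_Mapping.lookup (tprod (map img (letters w))) (weight w0) =
      (if w = w0 then Poly_Mapping.lookup g w0 * Poly_Mapping.lookup (tprod (map img (letters w0))) (weight w0) else 0)"
      by simp
  qed
  also have "\<dots> = Poly_Mapping.lookup g w0 * Poly_Mapping.lookup (tprod (map img (letters w0))) (weight w0)"
    using w0(1) by simp
  also have "\<dots> \<noteq> 0" using w0(1) low[OF w0(1)] by (auto simp: lowest_def in_keys_iff)
  finally show False using 0 by simp
qed

sublocale \<Phi>: ring_hom_ring FR torus_ring "lift img"
  using free_algebra_ring torus_ring lift_ring_hom by (intro ring_hom_ringI2)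

text \<open>For the nontrivial inclusion an element of the kernel is reduced to normal words; the
  reduced form has image zero as well, so it is zero by independence.\<close>

lemma kernel: "a_kernel FR torus_ring (lift img) = rel_ideal"
proof
  have "rels \<subseteq> a_kernel FR torus_ring (lift img)"
    using lift_relations rels_carrier unfolding a_kernel_def' by (auto simp del: free_algebra_simps(5))
  then show "rel_ideal \<subseteq> a_kernel FR torus_ring (lift img)"
    unfolding rel_ideal_def by (rule ring.genideal_minimal[OF free_algebra_ring \<Phi>.kernel_is_ideal])
  show "a_kernel FR torus_ring (lift img) \<subseteq> rel_ideal"
  proof
    fix f assume "f \<in> a_kernel FR torus_ring (lift img)"
    then have f: "f \<in> carrier FR" "lift img f = 0"
      unfolding a_kernel_def' by (auto simp del: free_algebra_simps(5))
    obtain g where g: "Poly_Mapping.keys g \<subseteq> normal_words" "f - g \<in> rel_ideal"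
      using spanned_by_normal_words[OF f(1)] unfolding FI.spanned_by_def by blast
    have "lift img (f - g) = 0"
      using subsetD[OF \<open>rel_ideal \<subseteq> a_kernel FR torus_ring (lift img)\<close> g(2)] unfolding a_kernel_def' by auto
    then have "lift img g = 0" using f(2) by (simp add: lift_diff)
    then have "g = 0" by (rule normal_words_independent[OF g(1)])
    then show "f \<in> rel_ideal" using g(2) by simp
  qed
qed

lemma quantum_euclidean_eq: "quantum_euclidean n q = FR Quot (a_kernel FR torus_ring (lift img))"
  unfolding kernel rel_ideal_def quantum_euclidean_def K_algebra_def ..

end

section \<open>The exponent lattice\<close>

locale quantum_euclid_root = quantum_euclid n q for n and q :: "'k::field" +
  fixes r :: nat
  assumes n2: "n \<ge> 2" and root: "primitive_root_of_unity r q"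
begin

notation tmult (infixl \<open>\<star>\<close> 70)

lemma r_pos: "r > 0"
  using root by (simp add: primitive_root_of_unity_def)

lemma q_powi_eq_one: "q powi k = 1 \<longleftrightarrow> int r dvd k"
proof -
  have qr: "q ^ r = 1" and min: "\<And>m. 0 < m \<Longrightarrow> m < r \<Longrightarrow> q ^ m \<noteq> 1"
    using root by (auto simp: primitive_root_of_unity_def)
  define a where "a = k div int r"
  define b where "b = k mod int r"
  have k: "k = int r * a + b" by (simp add: a_def b_def)
  have b: "b \<ge> 0" "b < int r" using r_pos by (simp_all add: b_def)
  have "q powi (int r * a + b) = q powi (int r * a) * q powi b"
    by (rule power_int_add) (simp add: q0)
  also have "q powi (int r * a) = 1" by (simp add: power_int_mult qr)
  finally have 1: "q powi k = q ^ nat b"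
    using b(1) by (simp add: k power_int_def)
  show ?thesis
  proof
    assume k1: "q powi k = 1"
    have "nat b < r" using b by (simp add: nat_less_iff)
    then have "\<not> 0 < nat b"
      using k1 1 min[of "nat b"] by metis
    then have "b = 0" using b by linarith
    then show "int r dvd k" using k by simp
  next
    assume "int r dvd k"
    then have "b = 0" by (simp add: b_def)
    then show "q powi k = 1" using 1 by simp
  qed
qed

abbreviation commform :: "(nat \<Rightarrow>\<^sub>0 int) \<Rightarrow> (nat \<Rightarrow>\<^sub>0 int) \<Rightarrow> int" where
  "commform u v \<equiv> \<beta> u v - \<beta> v u"

lemma powi_eq_iff: "q powi \<beta> u v = q powi \<beta> v u \<longleftrightarrow> int r dvd commform u v"
  unfolding q_powi_eq_one[symmetric] using q0 by (simp add: power_int_diff)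

lemma form_cmul: "\<beta> (frag_cmul k u) v = k * \<beta> u v" "\<beta> v (frag_cmul k u) = k * \<beta> v u"
  by (simp_all add: euclid_form_def sum_distrib_left algebra_simps)

sublocale AF: alternating_form frag_cmul commform r
proof
  show "frag_cmul a (x + y) = frag_cmul a x + frag_cmul a y" for a and x y :: "nat \<Rightarrow>\<^sub>0 int"
    by (rule frag_cmul_distrib2)
  show "frag_cmul (a + b) x = frag_cmul a x + frag_cmul b x" for a b and x :: "nat \<Rightarrow>\<^sub>0 int"
    by (rule frag_cmul_distrib)
  show "commform (x + y) z = commform x z + commform y z" for x y z
    by (simp add: form_add)
  show "commform (frag_cmul k x) z = k * commform x z" for k x z
    by (simp add: form_cmul algebra_simps)
qed (simp_all add: r_pos)

definition H :: "(nat \<Rightarrow>\<^sub>0 int) set" where "H = {v. Poly_Mapping.keys v \<subseteq> {1..2 * n}}"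

lemma H_iff: "v \<in> H \<longleftrightarrow> (\<forall>k. k \<notin> {1..2 * n} \<longrightarrow> Poly_Mapping.lookup v k = 0)"
  unfolding H_def by (auto simp: in_keys_iff subset_iff)

lemma H_closed: "0 \<in> H" "u \<in> H \<Longrightarrow> v \<in> H \<Longrightarrow> u + v \<in> H" "u \<in> H \<Longrightarrow> v \<in> H \<Longrightarrow> u - v \<in> H"
  "u \<in> H \<Longrightarrow> - u \<in> H" "u \<in> H \<Longrightarrow> frag_cmul k u \<in> H"
  by (simp_all add: H_iff lookup_add lookup_minus)

lemma H_yv_ov: "i \<in> {1..n} \<Longrightarrow> yv i \<in> H" "i \<in> {1..n} \<Longrightarrow> ov i \<in> H"
  by (auto simp: H_iff lookup_yv lookup_ov)

lemma H_expand: "v \<in> H \<Longrightarrow> v = (\<Sum>i\<in>{1..2 * n}. frag_cmul (Poly_Mapping.lookup v i) (Poly_Mapping.single i 1))"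
  by (intro poly_mapping_eqI)
    (auto simp: lookup_sum lookup_single when_def H_iff if_distrib[of "(*) _"] sum.delta sum.delta' cong: if_cong)

lemma basis_vector: "i \<in> {1..2 * n} \<Longrightarrow> \<exists>j\<in>{1..n}. Poly_Mapping.single i 1 = yv j \<or> Poly_Mapping.single i 1 = ov j"
proof (cases "i \<le> n")
  case False
  assume "i \<in> {1..2 * n}"
  then show ?thesis using False by (intro bexI[of _ "i - n"]) (auto simp: yv_def)
qed (auto simp: ov_def)

text \<open>By \<open>powi_eq_iff\<close> these are the exponents in \<open>H\<close> whose
  monomials commute with all monomials with exponents in \<open>H\<close>.\<close>

definition L :: "(nat \<Rightarrow>\<^sub>0 int) set" where "L = {v \<in> H. \<forall>x\<in>H. int r dvd commform v x}"

lemma L_closed: "u \<in> L \<Longrightarrow> v \<in> L \<Longrightarrow> u + v \<in> L" "u \<in> L \<Longrightarrow> v \<in> L \<Longrightarrow> u - v \<in> L"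
proof -
  assume u: "u \<in> L" and v: "v \<in> L"
  have "int r dvd commform (u + v) x" "int r dvd commform (u - v) x" if "x \<in> H" for x
    using u v that unfolding L_def AF.w_add AF.w_diff by auto
  then show "u + v \<in> L" "u - v \<in> L" using u v H_closed unfolding L_def by auto
qed

lemma L_testI:
  assumes "v \<in> H" "\<And>i. i \<in> {1..2 * n} \<Longrightarrow> int r dvd commform v (Poly_Mapping.single i 1)"
  shows "v \<in> L"
proof -
  have "int r dvd commform v x" if "x \<in> H" for x
  proof -
    have "commform v (\<Sum>i\<in>{1..2 * n}. frag_cmul (Poly_Mapping.lookup x i) (Poly_Mapping.single i 1)) =
        (\<Sum>i\<in>{1..2 * n}. Poly_Mapping.lookup x i * commform v (Poly_Mapping.single i 1))"
      by (simp only: AF.w_sum AF.w_sc_right)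
    then have "commform v x = (\<Sum>i\<in>{1..2 * n}. Poly_Mapping.lookup x i * commform v (Poly_Mapping.single i 1))"
      unfolding H_expand[OF that, symmetric] .
    then show ?thesis using assms(2) by (simp only: dvd_sum dvd_mult)
  qed
  then show ?thesis using assms(1) unfolding L_def by blast
qed

definition total_degree :: nat where "total_degree = r * block_degree r (n - 2)"

lemma radical_index_H: "AF.radical_index H (total_degree ^ 2)"
proof -
  define m where "m = n - 2"
  have n: "n = Suc (Suc m)" using n2 by (simp add: m_def)
  \<comment> \<open>Passing from \<open>ov i\<close> to \<open>ov (Suc i)\<close> changes the form
    only against \<open>yv (Suc i)\<close>, which makes \<open>W i\<close> dual to
    \<open>Yv i\<close> up to the factor 2. There is no Omega_0, so \<open>W 0\<close> is excluded;
    its place among the generators is taken by \<open>Z\<close>, the exponent of x_1 y_1^(-1) up to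
    a scalar.\<close>
  define W where "W = (\<lambda>i. ov (Suc i) - ov i)"
  define Yv where "Yv = (\<lambda>j. yv (Suc j))"
  define Z where "Z = ov 1 - frag_cmul 2 (yv 1)"
  let ?S = "insert Z (W ` {0<..<Suc (Suc m)} \<union> Yv ` {..<Suc (Suc m)})"
  have n': "Suc (Suc m) = n" by (simp only: n)
  have "AF.radical_index (AF.span ?S) ((r * block_degree r m) ^ 2)"
  proof (rule AF.radical_index_unpaired)
    fix i j :: nat
    show "commform (W i) (W j) = 0" if "0 < i" "0 < j" "i < Suc (Suc m)" "j < Suc (Suc m)"
      using that by (simp add: W_def form_diff form_ov_right n' Suc_le_eq)
    show "commform (W i) (Yv j) = (if i = j then 2 else 0)" if "0 < i" "i < Suc (Suc m)" "j < Suc (Suc m)"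
      using that by (auto simp: W_def Yv_def form_diff form_ov_right form_ov_yv n' Suc_le_eq)
    show "commform (Yv i) (Yv j) = - 1" if "i < j" "j < Suc (Suc m)"
      using that by (simp add: Yv_def form_yv_yv n' Suc_le_eq)
  next
    fix x assume "x \<in> W ` {0<..<Suc (Suc m)} \<union> Yv ` {..<Suc (Suc m)}"
    then consider i where "x = W i" "0 < i" "i < Suc (Suc m)" | i where "x = Yv i" "i < Suc (Suc m)"
      by auto
    then show "commform Z x = 0"
    proof cases
      case 1
      then show ?thesis
        by (simp add: Z_def W_def form_diff form_cmul form_ov_right form_ov_yv n' Suc_le_eq)
    next
      case 2
      then show ?thesis
        by (simp add: Z_def Yv_def form_diff form_cmul form_ov_right form_ov_yv form_yv_yv n' Suc_le_eq)
    qed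
  qed
  also have "AF.span ?S = H"
  proof
    have sub: "AF.subspace H" unfolding AF.subspace_def by (simp add: H_closed)
    have "Z \<in> H" unfolding Z_def by (intro H_closed(3) H_closed(5) H_yv_ov) (use n2 in auto)
    moreover have "W i \<in> H" if "0 < i" "i < Suc (Suc m)" for i
      unfolding W_def by (intro H_closed(3) H_yv_ov) (use that n in auto)
    moreover have "Yv i \<in> H" if "i < Suc (Suc m)" for i
      unfolding Yv_def by (intro H_yv_ov) (use that n in auto)
    ultimately have "?S \<subseteq> H" by auto
    then show "AF.span ?S \<subseteq> H" using sub by (rule AF.span_minimal)
    have y: "yv j \<in> AF.span ?S" if "j \<in> {1..n}" for j
    proof -
      have "yv j = Yv (j - 1)" "j - 1 < Suc (Suc m)" using that n by (auto simp: Yv_def)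
      then show ?thesis by (intro AF.span_base) auto
    qed
    have o: "j \<in> {1..n} \<Longrightarrow> ov j \<in> AF.span ?S" for j
    proof (induction j)
      case (Suc j)
      show ?case
      proof (cases "j = 0")
        case True
        have "ov 1 = Z + frag_cmul 2 (yv 1)" by (simp add: Z_def)
        moreover have "Z \<in> AF.span ?S" by (intro AF.span_base) auto
        moreover have "yv 1 \<in> AF.span ?S" using n by (intro y) auto
        ultimately show ?thesis using True by (simp add: AF.span_add AF.span_scale)
      next
        case False
        have "ov (Suc j) = ov j + W j" by (simp add: W_def)
        moreover have "W j \<in> AF.span ?S" using False Suc.prems n by (intro AF.span_base) auto
        moreover have "ov j \<in> AF.span ?S" using Suc False by simp
        ultimately show ?thesis using AF.span_add by metis
      qed
    qed simp
    show "H \<subseteq> AF.span ?S"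
    proof
      fix v assume "v \<in> H"
      have "(\<Sum>i\<in>{1..2 * n}. frag_cmul (Poly_Mapping.lookup v i) (Poly_Mapping.single i 1)) \<in> AF.span ?S"
      proof (intro AF.span_sum AF.span_scale)
        fix i assume "i \<in> {1..2 * n}"
        from basis_vector[OF this] show "Poly_Mapping.single i 1 \<in> AF.span ?S" using y o by auto
      qed
      then show "v \<in> AF.span ?S" using H_expand[OF \<open>v \<in> H\<close>] by simp
    qed
  qed
  finally show ?thesis by (simp add: total_degree_def m_def)
qed

text \<open>Only the monomials with nonnegative exponents are known to lie in the algebra; every other one is
  moved there by a central monomial whose exponents are large multiples of \<open>r\<close>.\<close>

definition cone :: "(nat \<Rightarrow>\<^sub>0 int) set" where
  "cone = {v \<in> H. \<forall>i. 0 \<le> Poly_Mapping.lookup v i}"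

lemma shift_into_cone:
  assumes "finite V" "V \<subseteq> H"
  shows "\<exists>e\<in>L \<inter> cone. \<forall>v\<in>V. e + v \<in> cone"
proof -
  define N where "N = (\<Sum>v\<in>V. \<Sum>i\<in>{1..2 * n}. \<bar>Poly_Mapping.lookup v i\<bar>)"
  have N: "\<bar>Poly_Mapping.lookup v i\<bar> \<le> N" if "v \<in> V" "i \<in> {1..2 * n}" for v i
  proof -
    have "\<bar>Poly_Mapping.lookup v i\<bar> \<le> (\<Sum>i\<in>{1..2 * n}. \<bar>Poly_Mapping.lookup v i\<bar>)"
      using that(2) by (intro member_le_sum) auto
    also have "\<dots> \<le> N"
      unfolding N_def using that(1) assms(1) by (intro member_le_sum) (auto intro: sum_nonneg)
    finally show ?thesis .
  qed
  have N0: "N \<ge> 0" unfolding N_def by (intro sum_nonneg) auto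
  define e0 where "e0 = (\<Sum>i\<in>{1..2 * n}. frag_cmul N (Poly_Mapping.single i 1))"
  define e where "e = frag_cmul (int r) e0"
  have l0: "Poly_Mapping.lookup e0 i = (if i \<in> {1..2 * n} then N else 0)" for i
    by (simp add: e0_def lookup_sum lookup_single when_def if_distrib[of "(*) _"] sum.delta sum.delta' cong: if_cong)
  have l: "Poly_Mapping.lookup e i = (if i \<in> {1..2 * n} then int r * N else 0)" for i
    by (simp add: e_def l0)
  have eH: "e \<in> H" by (simp add: H_iff l)
  have "e \<in> L" using eH unfolding L_def by (simp add: e_def AF.w_sc)
  moreover have "e \<in> cone" using eH N0 by (simp add: cone_def l)
  moreover have "e + v \<in> cone" if "v \<in> V" for v
  proof -
    have vH: "v \<in> H" using that assms(2) by blast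
    have "0 \<le> Poly_Mapping.lookup (e + v) i" for i
    proof (cases "i \<in> {1..2 * n}")
      case True
      have "N \<le> int r * N" using r_pos N0 by (simp add: mult_le_cancel_right1)
      then show ?thesis using N[OF that True] True by (simp add: lookup_add l)
    next
      case False
      then show ?thesis using vH unfolding H_iff by (auto simp: lookup_add l)
    qed
    then show ?thesis using H_closed(2)[OF eH vH] by (simp add: cone_def)
  qed
  ultimately show ?thesis by blast
qed

text \<open>Translating the representatives by one element of \<open>L\<close> keeps their classes
  and moves all of them into the cone, so that their monomials belong to the algebra.\<close>

lemma representatives:
  "\<exists>R. finite R \<and> card R = total_degree ^ 2 \<and> R \<subseteq> cone \<and> (\<forall>v\<in>H. \<exists>!g. g \<in> R \<and> v - g \<in> L)"
proof -
  obtain R where R: "finite R" "card R = total_degree ^ 2" "R \<subseteq> H"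
    "\<forall>v\<in>H. \<exists>!g. g \<in> R \<and> (\<forall>x\<in>H. int r dvd commform v x - commform g x)"
    using radical_index_H unfolding AF.radical_index_def by (elim exE conjE)
  obtain e where e: "e \<in> L" "e \<in> cone" "\<And>v. v \<in> R \<Longrightarrow> e + v \<in> cone"
    using shift_into_cone[OF R(1,3)] by blast
  have inj: "inj_on ((+) e) R" by simp
  have iff: "(\<forall>x\<in>H. int r dvd commform v x - commform g x) \<longleftrightarrow> v - (e + g) \<in> L"
    if "v \<in> H" "g \<in> H" for v g
  proof -
    have "(\<forall>x\<in>H. int r dvd commform v x - commform g x) \<longleftrightarrow> v - g \<in> L"
    proof -
      have "commform (v - g) x = commform v x - commform g x" for x by (rule AF.w_diff(1))
      then show ?thesis unfolding L_def mem_Collect_eq using H_closed(3)[OF that] by (simp only: simp_thms)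
    qed
    also have "\<dots> \<longleftrightarrow> v - (e + g) \<in> L"
      using L_closed(2)[OF _ e(1), of "v - g"] L_closed(1)[OF _ e(1), of "v - (e + g)"]
      by (auto simp: algebra_simps)
    finally show ?thesis .
  qed
  show ?thesis
  proof (intro exI[of _ "(+) e ` R"] conjI ballI)
    show "finite ((+) e ` R)" using R(1) by simp
    show "card ((+) e ` R) = total_degree ^ 2" using R(2) card_image[OF inj] by simp
    show "(+) e ` R \<subseteq> cone" using e(3) by blast
    fix v assume v: "v \<in> H"
    obtain g where g: "g \<in> R" "\<forall>x\<in>H. int r dvd commform v x - commform g x"
      and u: "\<And>g'. g' \<in> R \<and> (\<forall>x\<in>H. int r dvd commform v x - commform g' x) \<Longrightarrow> g' = g"
      using bspec[OF R(4) v] by (elim ex1E conjE) metis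
    show "\<exists>!g. g \<in> (+) e ` R \<and> v - g \<in> L"
    proof (rule ex1I[of _ "e + g"])
      show "e + g \<in> (+) e ` R \<and> v - (e + g) \<in> L" using g iff[OF v] R(3) by blast
      fix g' assume "g' \<in> (+) e ` R \<and> v - g' \<in> L"
      then obtain g'' where "g' = e + g''" "g'' \<in> R" "v - (e + g'') \<in> L" by blast
      then show "g' = e + g" using u[of g''] iff[OF v, of g''] R(3) by blast
    qed
  qed
qed

end

section \<open>PI degree of quantum Euclidean space\<close>

context quantum_euclid_root
begin

abbreviation A where "A \<equiv> quantum_euclidean n q"

definition B :: "((nat \<Rightarrow>\<^sub>0 int) \<Rightarrow>\<^sub>0 'k) set" where "B = lift img ` carrier FR"

text \<open>The induced isomorphism onto \<open>B\<close>: \<open>lift img\<close> is constant on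
  each coset, so the image of a coset has a single element.\<close>

definition \<psi> :: "(gen fmon \<Rightarrow>\<^sub>0 'k) set \<Rightarrow> ((nat \<Rightarrow>\<^sub>0 int) \<Rightarrow>\<^sub>0 'k)" where
  "\<psi> a = the_elem (lift img ` a)"

lemma A_ring: "ring A"
  unfolding quantum_euclidean_eq by (rule ideal.quotient_is_ring[OF \<Phi>.kernel_is_ideal])

lemma \<psi>_hom: "\<psi> \<in> ring_hom A torus_ring"
  unfolding quantum_euclidean_eq \<psi>_def by (rule \<Phi>.the_elem_hom)

lemma \<psi>_inj: "inj_on \<psi> (carrier A)"
  unfolding quantum_euclidean_eq \<psi>_def by (rule inj_onI, rule \<Phi>.the_elem_inj)

lemma \<psi>_image: "\<psi> ` carrier A = B"
  unfolding quantum_euclidean_eq \<psi>_def B_def by (rule \<Phi>.the_elem_surj)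

sublocale A: ring A by (rule A_ring)

sublocale \<psi>: ring_hom_ring A torus_ring \<psi>
  using A_ring torus_ring \<psi>_hom by (intro ring_hom_ringI2)

lemma \<psi>_simps:
  "a \<in> carrier A \<Longrightarrow> b \<in> carrier A \<Longrightarrow> \<psi> (a \<otimes>\<^bsub>A\<^esub> b) = \<psi> a \<star> \<psi> b"
  "a \<in> carrier A \<Longrightarrow> b \<in> carrier A \<Longrightarrow> \<psi> (a \<oplus>\<^bsub>A\<^esub> b) = \<psi> a + \<psi> b"
  "\<psi> \<zero>\<^bsub>A\<^esub> = 0" "\<psi> \<one>\<^bsub>A\<^esub> = 1"
  using \<psi>.hom_mult[of a b] \<psi>.hom_add[of a b] \<psi>.hom_zero \<psi>.hom_one by simp_all

lemma \<psi>_eq_iff: "a \<in> carrier A \<Longrightarrow> b \<in> carrier A \<Longrightarrow> \<psi> a = \<psi> b \<longleftrightarrow> a = b"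
  using inj_onD[OF \<psi>_inj] by blast

lemma \<psi>_in_B: "a \<in> carrier A \<Longrightarrow> \<psi> a \<in> B"
  using \<psi>_image by blast

definition \<theta> :: "((nat \<Rightarrow>\<^sub>0 int) \<Rightarrow>\<^sub>0 'k) \<Rightarrow> (gen fmon \<Rightarrow>\<^sub>0 'k) set" where
  "\<theta> = inv_into (carrier A) \<psi>"

lemma \<theta>: "f \<in> B \<Longrightarrow> \<theta> f \<in> carrier A" "f \<in> B \<Longrightarrow> \<psi> (\<theta> f) = f"
  unfolding \<theta>_def \<psi>_image[symmetric] by (rule inv_into_into, assumption, rule f_inv_into_f)

lemma B_closed: "f \<in> B \<Longrightarrow> g \<in> B \<Longrightarrow> f + g \<in> B" "f \<in> B \<Longrightarrow> g \<in> B \<Longrightarrow> f \<star> g \<in> B"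
  "Poly_Mapping.single 0 c \<in> B" "0 \<in> B"
proof -
  show "f + g \<in> B" if "f \<in> B" "g \<in> B"
    using \<psi>_in_B[OF A.a_closed[OF \<theta>(1)[OF that(1)] \<theta>(1)[OF that(2)]]]
    unfolding \<psi>_simps(2)[OF \<theta>(1)[OF that(1)] \<theta>(1)[OF that(2)]] \<theta>(2)[OF that(1)] \<theta>(2)[OF that(2)] .
  show "f \<star> g \<in> B" if "f \<in> B" "g \<in> B"
    using \<psi>_in_B[OF A.m_closed[OF \<theta>(1)[OF that(1)] \<theta>(1)[OF that(2)]]]
    unfolding \<psi>_simps(1)[OF \<theta>(1)[OF that(1)] \<theta>(1)[OF that(2)]] \<theta>(2)[OF that(1)] \<theta>(2)[OF that(2)] .
  have "lift img (scalar c) \<in> B" unfolding B_def by (rule imageI[OF FI.FA_closed(5)])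
  then show "Poly_Mapping.single 0 c \<in> B" by (simp only: lift_scalar)
  show "0 \<in> B" using \<psi>_in_B[OF A.zero_closed] \<psi>_simps(3) by simp
qed

lemma B_sum: "(\<And>a. a \<in> I \<Longrightarrow> f a \<in> B) \<Longrightarrow> sum f I \<in> B"
  by (induction I rule: infinite_finite_induct) (simp_all add: B_closed)

lemma B_img:
  assumes "a \<in> K_gens n"
  shows "img a \<in> B"
proof -
  have "lift img (var a) \<in> B" unfolding B_def by (rule imageI[OF var_FA[OF assms]])
  then show ?thesis by (simp only: lift_var)
qed

lemma B_monomial_iff: "c \<noteq> 0 \<Longrightarrow> Poly_Mapping.single u c \<in> B \<longleftrightarrow> E u \<in> B"
  using B_closed(2)[OF B_closed(3)[of c], of "E u"]
    B_closed(2)[OF B_closed(3)[of "inverse c"], of "Poly_Mapping.single u c"]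
  by (auto simp: tmult_single)

lemma B_monomial_add: "E u \<in> B \<Longrightarrow> E v \<in> B \<Longrightarrow> E (u + v) \<in> B"
  using B_closed(2)[of "E u" "E v"] B_monomial_iff[of "q powi \<beta> u v" "u + v"] q0
  by (simp add: tmult_single)

text \<open>The y_j are images of generators, and Omega_j is by \<open>sum_img_Y_X\<close> a
  combination of the products y_l x_l.\<close>

lemma B_basis:
  assumes "i \<in> {1..2 * n}"
  shows "E (Poly_Mapping.single i 1) \<in> B"
proof -
  have "E (yv j) \<in> B" if "j \<in> {1..n}" for j
    using B_img[of "Y j"] that by (simp add: K_gens_iff)
  moreover have "E (ov j) \<in> B" if j: "j \<in> {1..n}" for j
  proof -
    have "(\<Sum>l = 1..<Suc j. Poly_Mapping.single 0 cc \<star> (img (Y l) \<star> img (X l))) \<in> B"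
      by (intro B_sum B_closed B_img) (use j in \<open>auto simp: K_gens_iff\<close>)
    also have "(\<Sum>l = 1..<Suc j. Poly_Mapping.single 0 cc \<star> (img (Y l) \<star> img (X l))) = E (ov j)"
      using j by (subst sum_img_Y_X) (auto simp: Om_def)
    finally show ?thesis .
  qed
  ultimately show ?thesis using basis_vector[OF assms] by auto
qed

lemma B_cone:
  assumes "v \<in> cone"
  shows "E v \<in> B"
proof -
  have vH: "v \<in> H" and pos: "\<And>i. 0 \<le> Poly_Mapping.lookup v i" using assms by (auto simp: cone_def)
  have z: "E 0 \<in> B" by (rule B_closed(3))
  have mult: "E (frag_cmul (int k) (Poly_Mapping.single i 1)) \<in> B" if "i \<in> {1..2 * n}" for k i
  proof (induction k)
    case 0
    show ?case using z by simp
  next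
    case (Suc k)
    have "frag_cmul (int (Suc k)) (Poly_Mapping.single i 1) =
        Poly_Mapping.single i 1 + frag_cmul (int k) (Poly_Mapping.single i 1)"
      by (simp add: frag_cmul_distrib)
    then show ?case using B_monomial_add[OF B_basis[OF that] Suc] by (simp only:)
  qed
  have m: "E (frag_cmul (Poly_Mapping.lookup v i) (Poly_Mapping.single i 1)) \<in> B" if "i \<in> {1..2 * n}" for i
    using mult[OF that, of "nat (Poly_Mapping.lookup v i)"] pos[of i] by simp
  have "E (\<Sum>i\<in>S. frag_cmul (Poly_Mapping.lookup v i) (Poly_Mapping.single i 1)) \<in> B"
    if "S \<subseteq> {1..2 * n}" for S
  proof -
    have "finite S" using that finite_subset by blast
    then show ?thesis using that
    proof (induction S rule: finite_induct)
      case empty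
      show ?case using z by (simp only: sum.empty)
    next
      case (insert i S)
      have "i \<in> {1..2 * n}" "S \<subseteq> {1..2 * n}" using insert.prems by auto
      from B_monomial_add[OF m[OF this(1)] insert.IH[OF this(2)]] show ?case
        unfolding sum.insert[OF insert.hyps] .
    qed
  qed
  from this[of "{1..2 * n}"] show ?thesis
    unfolding H_expand[OF vH, symmetric] by simp
qed

lemma B_keys_cone: "Poly_Mapping.keys f \<subseteq> cone \<Longrightarrow> f \<in> B"
proof -
  assume f: "Poly_Mapping.keys f \<subseteq> cone"
  have "(\<Sum>u\<in>Poly_Mapping.keys f. Poly_Mapping.single u (Poly_Mapping.lookup f u)) \<in> B"
  proof (rule B_sum)
    fix u assume u: "u \<in> Poly_Mapping.keys f"
    then show "Poly_Mapping.single u (Poly_Mapping.lookup f u) \<in> B"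
      using B_cone f B_monomial_iff[of "Poly_Mapping.lookup f u" u] by (auto simp: in_keys_iff)
  qed
  then show "f \<in> B" by (simp only: sum_single_keys)
qed

lemma keys_B: "f \<in> B \<Longrightarrow> Poly_Mapping.keys f \<subseteq> H"
proof -
  assume "f \<in> B"
  then obtain g where g: "g \<in> carrier FR" "f = lift img g" unfolding B_def by blast
  have add: "Poly_Mapping.keys (a + b) \<subseteq> H" if "Poly_Mapping.keys a \<subseteq> H" "Poly_Mapping.keys b \<subseteq> H"
    for a b :: "(nat \<Rightarrow>\<^sub>0 int) \<Rightarrow>\<^sub>0 'k"
    using that keys_add[of a b] by blast
  have mult: "Poly_Mapping.keys (a \<star> b) \<subseteq> H" if "Poly_Mapping.keys a \<subseteq> H" "Poly_Mapping.keys b \<subseteq> H" for a b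
    using that keys_tmult[of a b] H_closed(2) by blast
  have scalar: "Poly_Mapping.keys (Poly_Mapping.single 0 c) \<subseteq> H" for c :: 'k
    using H_closed(1) by auto
  have gen: "Poly_Mapping.keys (img a) \<subseteq> H" if "a \<in> K_gens n" for a
  proof (cases a)
    case (X i)
    then have i: "i \<in> {1..n}" using that K_gens_iff by simp
    show ?thesis
    proof
      fix u assume "u \<in> Poly_Mapping.keys (img a)"
      then obtain j where "j \<in> {1..n}" "u = ov j - yv i" using keys_img_X[OF i, of u] X by blast
      then show "u \<in> H" using H_closed(3) H_yv_ov i by blast
    qed
  next
    case (Y i)
    then have "i \<in> {1..n}" using that K_gens_iff by simp
    then show ?thesis using H_yv_ov(1)[of i] Y by simp
  qed
  have word: "Poly_Mapping.keys (tprod (map img gs)) \<subseteq> H" if "set gs \<subseteq> K_gens n" for gs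
    using that
  proof (induction gs)
    case Nil
    then show ?case using H_closed(1) by simp
  next
    case (Cons a gs)
    then show ?case using mult[OF gen] by simp
  qed
  have "Poly_Mapping.keys (\<Sum>w\<in>S. Poly_Mapping.single 0 (Poly_Mapping.lookup g w) \<star> tprod (map img (letters w))) \<subseteq> H"
    if "S \<subseteq> Poly_Mapping.keys g" for S
  proof -
    have "finite S" using that finite_subset finite_keys by blast
    then show ?thesis using that
    proof (induction S rule: finite_induct)
      case (insert w S)
      have "set (letters w) \<subseteq> K_gens n" using g(1) insert.prems by simp
      from add[OF mult[OF scalar word[OF this]] insert.IH] show ?case
        unfolding sum.insert[OF insert.hyps] using insert.prems by blast
    qed simp
  qed
  then show ?thesis unfolding g(2) lift_def by blast
qed

text \<open>If \<open>z\<close> commutes with the y_i and Omega_i, which are monomials in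
  \<open>B\<close>, each of its exponents pairs to a multiple of \<open>r\<close> with the basis
  vectors. The converse holds because elements of \<open>B\<close> have support in
  \<open>H\<close>.\<close>

lemma central_iff:
  assumes "z \<in> B"
  shows "(\<forall>b\<in>B. z \<star> b = b \<star> z) \<longleftrightarrow> Poly_Mapping.keys z \<subseteq> L"
proof
  assume c: "\<forall>b\<in>B. z \<star> b = b \<star> z"
  show "Poly_Mapping.keys z \<subseteq> L"
  proof
    fix v assume v: "v \<in> Poly_Mapping.keys z"
    show "v \<in> L"
    proof (rule L_testI)
      show "v \<in> H" using keys_B[OF assms] v by blast
      fix i assume "i \<in> {1..2 * n}"
      then have "z \<star> E (Poly_Mapping.single i 1) = E (Poly_Mapping.single i 1) \<star> z" using c B_basis by blast
      from commutes_with_monomialD[OF this v]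
      show "int r dvd commform v (Poly_Mapping.single i 1)" unfolding powi_eq_iff .
    qed
  qed
next
  assume k: "Poly_Mapping.keys z \<subseteq> L"
  show "\<forall>b\<in>B. z \<star> b = b \<star> z"
  proof
    fix b assume b: "b \<in> B"
    show "z \<star> b = b \<star> z"
    proof (rule tmult_commute)
      fix u v assume "u \<in> Poly_Mapping.keys z" "v \<in> Poly_Mapping.keys b"
      then show "q powi \<beta> u v = q powi \<beta> v u"
        using k keys_B[OF b] unfolding powi_eq_iff L_def by blast
    qed
  qed
qed

lemma center_iff: "z \<in> ring_center A \<longleftrightarrow> z \<in> carrier A \<and> Poly_Mapping.keys (\<psi> z) \<subseteq> L"
proof -
  have "(\<forall>x\<in>carrier A. z \<otimes>\<^bsub>A\<^esub> x = x \<otimes>\<^bsub>A\<^esub> z) \<longleftrightarrow> (\<forall>b\<in>B. \<psi> z \<star> b = b \<star> \<psi> z)" if z: "z \<in> carrier A"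
  proof -
    have "z \<otimes>\<^bsub>A\<^esub> x = x \<otimes>\<^bsub>A\<^esub> z \<longleftrightarrow> \<psi> z \<star> \<psi> x = \<psi> x \<star> \<psi> z" if "x \<in> carrier A" for x
      using \<psi>_eq_iff[of "z \<otimes>\<^bsub>A\<^esub> x" "x \<otimes>\<^bsub>A\<^esub> z"] z that by (simp only: \<psi>_simps A.m_closed)
    then show ?thesis unfolding \<psi>_image[symmetric] by auto
  qed
  then show ?thesis unfolding ring_center_def using central_iff[OF \<psi>_in_B] by blast
qed

lemma A_prime: "prime_ring A"
  unfolding prime_ring_def
proof (intro conjI ballI impI)
  show "ring A" by (rule A_ring)
  have "\<one>\<^bsub>A\<^esub> \<noteq> \<zero>\<^bsub>A\<^esub>" using \<psi>_simps(3,4) by (metis zero_neq_one)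
  then show "carrier A \<noteq> {\<zero>\<^bsub>A\<^esub>}" using A.one_closed by blast
  fix a b assume ab: "a \<in> carrier A" "b \<in> carrier A"
    and z: "\<forall>x\<in>carrier A. a \<otimes>\<^bsub>A\<^esub> x \<otimes>\<^bsub>A\<^esub> b = \<zero>\<^bsub>A\<^esub>"
  have "a \<otimes>\<^bsub>A\<^esub> b = \<zero>\<^bsub>A\<^esub>" using bspec[OF z A.one_closed] ab by simp
  then have "\<psi> a \<star> \<psi> b = 0" using \<psi>_simps(1)[OF ab] \<psi>_simps(3) by simp
  then have "\<psi> a = \<psi> \<zero>\<^bsub>A\<^esub> \<or> \<psi> b = \<psi> \<zero>\<^bsub>A\<^esub>" unfolding tmult_eq_zero_iff \<psi>_simps(3) .
  then show "a = \<zero>\<^bsub>A\<^esub> \<or> b = \<zero>\<^bsub>A\<^esub>" using \<psi>_eq_iff ab A.zero_closed by blast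
qed

sublocale PL: prime_localization A
  by unfold_locales (rule A_prime)

lemma A_PI: "PI_ring A"
proof -
  obtain R where R: "finite R" "card R = total_degree ^ 2" "R \<subseteq> cone"
    "\<forall>v\<in>H. \<exists>!g. g \<in> R \<and> v - g \<in> L"
    using representatives by (elim exE conjE)
  define rep where "rep = (\<lambda>v. THE g. g \<in> R \<and> v - g \<in> L)"
  have rep: "rep v \<in> R" "v - rep v \<in> L" if "v \<in> H" for v
    using theI'[OF bspec[OF R(4) that]] unfolding rep_def by auto
  let ?m = "Suc (card R)"
  have "eval_poly A \<rho> (standard_poly ?m) = \<zero>\<^bsub>A\<^esub>" if \<rho>: "range \<rho> \<subseteq> carrier A" for \<rho>
  proof -
    have "alternating ?m (\<psi> \<circ> \<rho>) = 0"
    proof (rule standard_identity[where K = H and cl = rep])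
      show "u \<in> H \<Longrightarrow> v \<in> H \<Longrightarrow> u - v \<in> H" for u v by (rule H_closed(3))
      show "0 \<in> H" by (rule H_closed(1))
      have sub: "rep ` H \<subseteq> R" using rep(1) by blast
      then show "finite (rep ` H)" using R(1) finite_subset by blast
      show "card (rep ` H) < ?m" using card_mono[OF R(1) sub] by simp
      show "Poly_Mapping.keys ((\<psi> \<circ> \<rho>) i) \<subseteq> H" for i
        using keys_B[OF \<psi>_in_B] \<rho> by (auto simp: subset_iff)
      fix u v x assume u: "u \<in> H" "v \<in> H" "x \<in> H" "rep u = rep v"
      have "(u - rep u) - (v - rep v) \<in> L" by (rule L_closed(2)[OF rep(2)[OF u(1)] rep(2)[OF u(2)]])
      then have "u - v \<in> L" using u(4) by simp
      then show "q powi \<beta> (u - v) x = q powi \<beta> x (u - v)"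
        unfolding powi_eq_iff L_def using u(3) by blast
    qed
    then have "\<psi> (eval_poly A \<rho> (standard_poly ?m)) = \<psi> \<zero>\<^bsub>A\<^esub>"
      using hom_eval_poly[OF A_ring torus_ring \<psi>_hom \<rho>] eval_poly_standard \<psi>_simps(3) by simp
    then show ?thesis
      using hom_eval_poly[OF A_ring torus_ring \<psi>_hom \<rho>] \<psi>_eq_iff A.zero_closed by blast
  qed
  then show ?thesis
    unfolding PI_ring_def using A_ring monic_standard_poly by blast
qed

lemma \<psi>_combine:
  assumes "distinct gl" "\<And>g. g \<in> set gl \<Longrightarrow> a g \<in> carrier A" "\<And>g. g \<in> set gl \<Longrightarrow> b g \<in> carrier A"
  shows "A.combine (map a gl) (map b gl) \<in> carrier A \<and>
    \<psi> (A.combine (map a gl) (map b gl)) = (\<Sum>g\<in>set gl. \<psi> (a g) \<star> \<psi> (b g))"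
  using assms
proof (induction gl)
  case Nil
  then show ?case using \<psi>_simps(3) by simp
next
  case (Cons g gl)
  then show ?case using \<psi>_simps(1,2) by simp
qed

lemma A_PIdeg: "PIdeg A = total_degree"
proof -
  obtain R where R: "finite R" "card R = total_degree ^ 2" "R \<subseteq> cone"
    "\<forall>v\<in>H. \<exists>!g. g \<in> R \<and> v - g \<in> L"
    using representatives by (elim exE conjE)
  obtain gl where gl: "set gl = R" "distinct gl" using finite_distinct_list[OF R(1)] by blast
  define rep where "rep = (\<lambda>v. THE g. g \<in> R \<and> v - g \<in> L)"
  have rep: "rep v \<in> R" "v - rep v \<in> L" if "v \<in> H" for v
    using theI'[OF bspec[OF R(4) that]] unfolding rep_def by auto
  have RH: "R \<subseteq> H" using R(3) by (auto simp: cone_def)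
  have EB: "E g \<in> B" if "g \<in> R" for g using that R(3) B_cone by blast
  let ?gs = "map (\<lambda>g. \<theta> (E g)) gl"
  show ?thesis
  proof (rule PL.PIdeg_eqI[where gs = ?gs])
    show "set ?gs \<subseteq> carrier A" using \<theta>(1) EB gl(1) by auto
    show "length ?gs = total_degree ^ 2" using R(2) gl distinct_card[of gl] by simp
  next
    fix a assume a: "a \<in> carrier A"
    define f where "f = \<psi> a"
    have fB: "f \<in> B" unfolding f_def by (rule \<psi>_in_B[OF a])
    let ?K = "Poly_Mapping.keys f"
    have KH: "?K \<subseteq> H" by (rule keys_B[OF fB])
    \<comment> \<open>These differences belong to the radical but may have negative coordinates;
      multiplication by the central monomial \<open>E e\<close> brings them all into the cone at
      once.\<close>
    define V where "V = (\<lambda>v. v - rep v) ` ?K"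
    have "finite V" "V \<subseteq> H" unfolding V_def using rep KH by (auto simp: L_def)
    from shift_into_cone[OF this] obtain e where e: "e \<in> L" "e \<in> cone" "\<And>v. v \<in> V \<Longrightarrow> e + v \<in> cone" by blast
    \<comment> \<open>The part of \<open>f\<close> whose exponents lie in the class of
      \<open>g\<close>, divided on the right by \<open>E g\<close> and multiplied by
      \<open>E e\<close>. The inverse power of \<open>q\<close> cancels the twist that reappears in
      \<open>z g \<star> E g\<close>.\<close>
    define z where "z = (\<lambda>g. E e \<star> (\<Sum>v\<in>{v \<in> ?K. rep v = g}.
        Poly_Mapping.single (v - g) (Poly_Mapping.lookup f v * inverse (q powi \<beta> (v - g) g))))"
    have zkeys: "u \<in> cone \<and> u \<in> L" if u: "u \<in> Poly_Mapping.keys (z g)" for g u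
    proof -
      obtain w where w: "u = e + w" "w \<in> Poly_Mapping.keys (\<Sum>v\<in>{v \<in> ?K. rep v = g}.
        Poly_Mapping.single (v - g) (Poly_Mapping.lookup f v * inverse (q powi \<beta> (v - g) g)))"
        using subsetD[OF keys_tmult u[unfolded z_def]] by auto
      have "w \<in> (\<Union>v\<in>{v \<in> ?K. rep v = g}. Poly_Mapping.keys
        (Poly_Mapping.single (v - g) (Poly_Mapping.lookup f v * inverse (q powi \<beta> (v - g) g))))"
        by (rule subsetD[OF keys_sum w(2)])
      then obtain v where v: "v \<in> ?K" "rep v = g" "w = v - g" by (auto split: if_splits)
      then have "w \<in> V" unfolding V_def by blast
      moreover have "w \<in> L" using rep(2)[of v] v KH by blast
      ultimately show ?thesis using w(1) e(3) L_closed(1)[OF e(1)] by blast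
    qed
    have zB: "z g \<in> B" for g by (rule B_keys_cone) (use zkeys in blast)
    have EeB: "E e \<in> B" using e(2) by (rule B_cone)
    have "\<theta> (E e) \<in> denoms A"
    proof -
      have "\<psi> (\<theta> (E e)) \<noteq> \<psi> \<zero>\<^bsub>A\<^esub>" unfolding \<theta>(2)[OF EeB] \<psi>_simps(3)
        by (metis lookup_single_eq lookup_zero zero_neq_one)
      moreover have "\<theta> (E e) \<in> ring_center A"
        unfolding center_iff \<theta>(2)[OF EeB] using \<theta>(1)[OF EeB] e(1) by simp
      ultimately show ?thesis unfolding denoms_def by auto
    qed
    moreover have "set (map (\<lambda>g. \<theta> (z g)) gl) \<subseteq> ring_center A"
      using \<theta>[OF zB] zkeys by (auto simp: center_iff)
    moreover have "\<theta> (E e) \<otimes>\<^bsub>A\<^esub> a = A.combine (map (\<lambda>g. \<theta> (z g)) gl) ?gs"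
    proof -
      have 1: "A.combine (map (\<lambda>g. \<theta> (z g)) gl) ?gs \<in> carrier A \<and>
          \<psi> (A.combine (map (\<lambda>g. \<theta> (z g)) gl) ?gs) = (\<Sum>g\<in>set gl. \<psi> (\<theta> (z g)) \<star> \<psi> (\<theta> (E g)))"
        by (rule \<psi>_combine[OF gl(2)]) (use \<theta>(1) zB EB gl(1) in auto)
      have "(\<Sum>g\<in>set gl. \<psi> (\<theta> (z g)) \<star> \<psi> (\<theta> (E g))) = (\<Sum>g\<in>R. z g \<star> E g)"
        unfolding gl(1) using \<theta>(2) zB EB by (intro sum.cong refl) simp
      also have "\<dots> = (\<Sum>g\<in>R. E e \<star> (\<Sum>v\<in>{v \<in> ?K. rep v = g}. Poly_Mapping.single v (Poly_Mapping.lookup f v)))"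
      proof (intro sum.cong refl)
        fix g
        have "(\<Sum>v\<in>{v \<in> ?K. rep v = g}. Poly_Mapping.single (v - g) (Poly_Mapping.lookup f v * inverse (q powi \<beta> (v - g) g))) \<star> E g
            = (\<Sum>v\<in>{v \<in> ?K. rep v = g}. Poly_Mapping.single v (Poly_Mapping.lookup f v))"
          unfolding tmult_sum using q0 by (intro sum.cong refl) (simp add: tmult_single mult.assoc)
        then show "z g \<star> E g = E e \<star> (\<Sum>v\<in>{v \<in> ?K. rep v = g}. Poly_Mapping.single v (Poly_Mapping.lookup f v))"
          unfolding z_def tmult_assoc by (simp only:)
      qed
      also have "\<dots> = E e \<star> (\<Sum>g\<in>R. \<Sum>v\<in>{v \<in> ?K. rep v = g}. Poly_Mapping.single v (Poly_Mapping.lookup f v))"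
        unfolding tmult_sum ..
      also have "(\<Sum>g\<in>R. \<Sum>v\<in>{v \<in> ?K. rep v = g}. Poly_Mapping.single v (Poly_Mapping.lookup f v)) =
          (\<Sum>v\<in>?K. Poly_Mapping.single v (Poly_Mapping.lookup f v))"
        by (rule sum.group) (use R(1) rep(1) KH in auto)
      also have "\<dots> = f" by (rule sum_single_keys)
      finally have "\<psi> (A.combine (map (\<lambda>g. \<theta> (z g)) gl) ?gs) = E e \<star> f" using 1 by simp
      also have "\<dots> = \<psi> (\<theta> (E e) \<otimes>\<^bsub>A\<^esub> a)"
        using \<psi>_simps(1)[OF \<theta>(1)[OF EeB] a] \<theta>(2)[OF EeB] by (simp add: f_def)
      finally show ?thesis
        using \<psi>_eq_iff[OF conjunct1[OF 1] A.m_closed[OF \<theta>(1)[OF EeB] a]] by simp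
    qed
    ultimately show "\<exists>s zs. s \<in> denoms A \<and> set zs \<subseteq> ring_center A \<and> s \<otimes>\<^bsub>A\<^esub> a = A.combine zs ?gs"
      by blast
  next
    fix zs assume zs: "set zs \<subseteq> ring_center A" "length zs = length ?gs" and 0: "A.combine zs ?gs = \<zero>\<^bsub>A\<^esub>"
    \<comment> \<open>Reindexes the coefficients by representatives instead of positions, which is
      unambiguous because \<open>gl\<close> is distinct.\<close>
    define c where "c = (\<lambda>g. zs ! (THE i. i < length gl \<and> gl ! i = g))"
    have c: "c (gl ! i) = zs ! i" if "i < length gl" for i
    proof -
      have "(THE j. j < length gl \<and> gl ! j = gl ! i) = i"
        using that nth_eq_iff_index_eq[OF gl(2)] by (intro the_equality) auto
      then show ?thesis by (simp add: c_def)
    qed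
    have zs_eq: "zs = map c gl" using zs(2) c by (intro nth_equalityI) auto
    have cz: "c g \<in> ring_center A" if "g \<in> R" for g using zs(1) that gl(1) unfolding zs_eq by auto
    have cA: "c g \<in> carrier A" and cL: "Poly_Mapping.keys (\<psi> (c g)) \<subseteq> L" if "g \<in> R" for g
      using cz[OF that] unfolding center_iff by auto
    have "\<psi> (A.combine (map c gl) ?gs) = (\<Sum>g\<in>set gl. \<psi> (c g) \<star> \<psi> (\<theta> (E g)))"
      using \<psi>_combine[OF gl(2), of c "\<lambda>g. \<theta> (E g)"] cA \<theta>(1) EB gl(1) by auto
    also have "\<dots> = (\<Sum>g\<in>R. \<psi> (c g) \<star> E g)"
      unfolding gl(1) using \<theta>(2) EB by (intro sum.cong refl) simp
    finally have sum0: "(\<Sum>g\<in>R. \<psi> (c g) \<star> E g) = 0"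
      using 0 zs_eq \<psi>_simps(3) by simp
    have "c g0 = \<zero>\<^bsub>A\<^esub>" if g0: "g0 \<in> R" for g0
    proof (rule ccontr)
      assume "c g0 \<noteq> \<zero>\<^bsub>A\<^esub>"
      then have "\<psi> (c g0) \<noteq> 0" using \<psi>_eq_iff[OF cA[OF g0] A.zero_closed] \<psi>_simps(3) by simp
      then obtain u where u: "u \<in> Poly_Mapping.keys (\<psi> (c g0))" by (metis keys_eq_empty equals0I)
      \<comment> \<open>The summand of \<open>g\<close> is supported on the coset of
        \<open>g\<close> modulo \<open>L\<close>, and different representatives have disjoint
        cosets. No cancellation between the summands is possible.\<close>
      have other: "Poly_Mapping.lookup (\<psi> (c g) \<star> E g) (u + g0) = 0" if g: "g \<in> R" "g \<noteq> g0" for g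
      proof (rule ccontr)
        assume "Poly_Mapping.lookup (\<psi> (c g) \<star> E g) (u + g0) \<noteq> 0"
        then have "u + g0 - g \<in> Poly_Mapping.keys (\<psi> (c g))"
          by (auto simp: lookup_tmult_single_right in_keys_iff)
        then have "u + g0 - g \<in> L" using cL[OF g(1)] by blast
        moreover have "u \<in> L" using cL[OF g0] u by blast
        ultimately have "(u + g0 - g) - u \<in> L" by (rule L_closed(2))
        then have "g0 - g \<in> L" by (simp add: algebra_simps)
        moreover have "g0 - g0 \<in> L" using \<open>u \<in> L\<close> L_closed(2)[of u u] by simp
        moreover have "g0 \<in> H" using RH g0 by blast
        ultimately show False using bspec[OF R(4) \<open>g0 \<in> H\<close>] g g0 by blast
      qed
      have "0 = (\<Sum>g\<in>R. Poly_Mapping.lookup (\<psi> (c g) \<star> E g) (u + g0))"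
        using arg_cong[OF sum0, of "\<lambda>f. Poly_Mapping.lookup f (u + g0)"] by (simp only: lookup_sum lookup_zero)
      also have "\<dots> = (\<Sum>g\<in>{g0}. Poly_Mapping.lookup (\<psi> (c g) \<star> E g) (u + g0))"
        using R(1) g0 other by (intro sum.mono_neutral_right) auto
      also have "\<dots> \<noteq> 0" using u by (simp add: lookup_tmult_single_right in_keys_iff)
      finally show False by simp
    qed
    then show "set zs \<subseteq> {\<zero>\<^bsub>A\<^esub>}" unfolding zs_eq using gl(1) by auto
  qed
qed

text \<open>The identities for \<open>block_degree\<close> are stated as products, which makes the
  natural-number divisions here exact.\<close>

lemma total_degree_eq:
  "total_degree = (if odd r then r ^ (n - 1)
       else if \<not> 4 dvd r then r ^ (n - 1) div 2 ^ ((n - 1) div 2)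
       else r ^ (n - 1) div 2 ^ (n - 2))"
proof -
  obtain m where n: "n = Suc (Suc m)" using n2 by (metis add_2_eq_Suc le_Suc_ex)
  then have nm: "n - 2 = m" "n - 1 = Suc m" by simp_all
  have t: "total_degree = r * block_degree r m" by (simp only: total_degree_def nm)
  show ?thesis
  proof (cases "odd r")
    case True
    then show ?thesis unfolding nm by (simp add: t block_degree_odd)
  next
    case even: False
    show ?thesis
    proof (cases "4 dvd r")
      case True
      have "r ^ Suc m = total_degree * 2 ^ m" unfolding t using block_degree_doubly_even[OF True, of m] by simp
      then have "r ^ Suc m div 2 ^ m = total_degree" by simp
      then show ?thesis unfolding nm using even True by simp
    next
      case False
      have "r ^ Suc m = total_degree * 2 ^ (Suc m div 2)"
        unfolding t using block_degree_singly_even[of r m] even False by simp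
      then have "r ^ Suc m div 2 ^ (Suc m div 2) = total_degree" by simp
      then show ?thesis unfolding nm using even False by simp
    qed
  qed
qed

end

text \<open>Primeness and the PI property are asserted together with the value because the PI degree
  is meant for prime PI rings only.\<close>

theorem mainTheorem12:
  fixes q :: "'k::field" and n r :: nat
  assumes "n \<ge> 2"
    and "primitive_root_of_unity r q"
    and "q ^ 2 \<noteq> 1"
  shows "prime_ring (quantum_euclidean n q) \<and> PI_ring (quantum_euclidean n q) \<and>
    PIdeg (quantum_euclidean n q) =
      (if odd r then r ^ (n - 1)
       else if \<not> 4 dvd r then r ^ (n - 1) div 2 ^ ((n - 1) div 2)
       else r ^ (n - 1) div 2 ^ (n - 2))"
proof -
  have "q \<noteq> 0"
    using assms(2) by (auto simp: primitive_root_of_unity_def power_0_left)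
  then interpret quantum_euclid_root n q r
    using assms by unfold_locales
  show ?thesis
    using A_prime A_PI A_PIdeg total_degree_eq by simp
qed

end
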